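(* Let $V$ be the generalized Vilenkin group associated with a dilation matrix $M$ and a set of digits $D(M)$, and let $V^*$ be the generalized Vilenkin group associated with $M^*$ and a set of digits $D^*=\{s_0^*,\dots,s_{m-1}^*\}$, $s_0^*=\mathbf 0$, $m=|\det M|$. Let $n,r\in\mathbb N$, $r\ge n\ge2$, and let $\xi_0,\dots,\xi_r\in D^*\setminus\{s_0^*\}$ be a finite sequence of (not necessarily distinct) digits such that $$(\xi_k,\dots,\xi_{k+n-2})\ne(\xi_{k'},\dots,\xi_{k'+n-2})\quad\text{for all } k\ne k',\ k,k'\in\{0,\dots,r-n+2\}.$$ If $\varphi$ is the refinable function associated with $\{\xi_0,\dots,\xi_r\}$ (with mask values $b(\cdot)$), then $\varphi$ is orthogonal, $\varphi\in\mathcal S^{(n-1)}_{r-n+2}(V)$, and for $\omega\in V^*$ $$\widehat\varphi(\omega)=\sum_{k=1}^{r-n+2}\mathbf 1_{\xi_0\ldots\xi_{k-1}\boldsymbol{,}\,\xi_k\ldots\xi_{k+n-2}\,\oplus\, U^*_{n-1}}(\omega)\prod_{j=1}^{k+n-1}b(\xi_{k-j}\ldots\xi_{k+n-1-j})+\mathbf 1_{Q\oplus U^*_{n-1}}(\omega)\prod_{j=1}^{n-1}b(\mathbf 0\ldots\mathbf 0\,\omega_1\ldots\omega_{n-j}),$$ where $\xi_l=\mathbf 0$ for $l\le-1$, in the last product $b(\mathbf 0\ldots\mathbf 0\,\omega_1\ldots\omega_{n-j})$ has $j$ leading entries $\mathbf 0$, and $$Q=\{\mathbf 0\boldsymbol{,}\,\alpha_1\ldots\alpha_{n-1}\mid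 \alpha_i\in D^*,\ (\alpha_1,\ldots,\alpha_{n-1})\neq(\xi_k,\ldots,\xi_{k+n-2})\ \ \forall k=1,2,\ldots,r-n+2\}.$$
   Context: A dilation matrix is an integer $d\times d$ matrix $M$ all of whose eigenvalues are greater than $1$ in absolute value; $m:=|\det M|$ and $M^*$ is the transpose of $M$. Vectors $l,k\in\mathbb Z^d$ are congruent modulo $M$ if $l-k=Ms$ for some $s\in\mathbb Z^d$. A set of digits for $M$ is a set $D(M)=\{s_0,\dots,s_{m-1}\}\subset\mathbb Z^d$ with $s_0=\mathbf 0$ and $s_i\not\equiv s_j \pmod M$ for $i\ne j$. The generalized Vilenkin group $V$ associated with $M$ and $D(M)$ consists of all sequences $x=\{x_j\}_{j\in\mathbb Z}$ with $x_j\in D(M)$ and $x_j\neq\mathbf 0$ for only finitely many negative $j$, with coordinate-wise addition modulo $M$, denoted $\oplus$ (i.e. $(x\oplus y)_j$ is the element of $D(M)$ congruent to $x_j+y_j$ modulo $M$). A base of neighbourhoods of the neutral element $\theta$ is given by $U_l:=\{x\in V: x_j=\mathbf 0\text{ for all }j\le l\}$, $l\in\mathbb Z$; $U:=U_0$. $V$ is a locally compact abelian group with Haar measure $\mu$ normalized by $\mu(U)=1$. $H:=\{x\in V: x_j=\mathbf 0\text{ for all }j>0\}$. The map $\mathcal M:V\to V$ is the shift $(\mathcal M x)_j=x_{j+1}$. For $k\in\mathbb Z_+=\{0,1,2,\dots\}$ with $m$-ary expansion $k=\sum_{j\ge0}k_jm^j$, $k_j\in\{0,\dots,m-1\}$,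 $\gamma_{[k]}$ is the element of $H$ with $(\gamma_{[k]})_{-j}=s_{k_j}$, $j\ge 0$. Put $U_{n,k}:=\mathcal M^{-n}\gamma_{[k]}\oplus\mathcal M^{-n}(U)$, $n\in\mathbb Z$, $k\in\mathbb Z_+$. For $n,k\in\mathbb Z$, $\mathcal S_n(V)$ is the set of functions $f$ on $V$ that are constant on each $U_{n,k'}$, $k'\in\mathbb Z_+$, and $\mathcal S_n^{(k)}(V):=\{f\in\mathcal S_n(V):\operatorname{supp} f\subset\mathcal M^k(U)\}$. $V^*$ is the generalized Vilenkin group associated with the matrix $M^*$ and a set of digits $D^*=D(M^* )$; $U_l^*,U^*,H^*,\mu^*,\mathcal M^*$ are defined for $V^*$ in the same way. For $x\in V$, $\omega\in V^*$ put $\chi(x,\omega)=\exp\big(2\pi i\sum_{j\in\mathbb Z}\langle M^{-1}x_j,\omega_{1-j}\rangle\big)$. The Fourier transform of $f\in L_1(V)$ is $\widehat f(\omega)=\int_V f(x)\overline{\chi(x,\omega)}\,d\mu(x)$, $\omega\in V^*$, extended to $L_2(V)$ in the standard way. The Walsh functions on $V^*$ are $W_k:=\chi(\gamma_{[k]},\cdot)$; a Walsh polynomial of order $n$ is a linear combination of $W_0,\dots,W_{m^n-1}$. A function $\varphi\in L_2(V)$ is refinable if there are numbers $\alpha_k$ with $\varphi(x)=\sum_{k=0}^\infty\alpha_k\varphi(\mathcal M x\oplus\gamma_{[k]})$ for all $x\in V$; a refinable function is orthogonal if $\{\varphi(\cdot\oplus h)\mid h\in H\}$ is orthonormal in $L_2(V)$.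 Notation for elements of $V^*$: $\omega_{-N}\ldots\omega_0\boldsymbol{,}\,\omega_1\ldots\omega_l$ denotes the element with the indicated coordinates $\omega_j\in D^*$ for $-N\le j\le l$ and all other coordinates $\mathbf 0$ (the separating comma stands between the coordinates with indices $0$ and $1$). For $A\subset V^*$ (or a single element), $A\oplus U^*_{n-1}=\{a\oplus u: a\in A,\ u\in U^*_{n-1}\}$; $\mathbf 1_Y$ is the characteristic function of $Y$. Function associated with $\{\xi_0,\dots,\xi_r\}$: every Walsh polynomial $m_0$ of order $n$ on $V^*$ satisfies $m_0(\omega)=m_0(\mathbf 0\boldsymbol{,}\,\omega_1\ldots\omega_n)=:b(\omega_1\ldots\omega_n)$, and it is determined by the values $b(\omega_1\ldots\omega_n)$, $\omega_i\in D^*$, which can be prescribed arbitrarily. Given the digits $\xi_0,\dots,\xi_r$, define $b$ as follows: (i) $b(\xi_k\ldots\xi_{k+n-1})=\pm1$ (any choice of signs) for every $k=0,\dots,r-n+1$; (ii) if $(\omega_2,\dots,\omega_n)$ does not coincide with $(\xi_k,\dots,\xi_{k+n-2})$ for any $k=1,\dots,r-n+2$, then $b(\mathbf 0\,\omega_2\ldots\omega_n)=\pm1$ (any choice of signs), with $b(\mathbf 0\ldots\mathbf 0)=1$; (iii) $b(\omega_1\ldots\omega_n)=0$ for all other $(\omega_1,\dots,\omega_n)$. The resulting $m_0$ is the mask of a compactly supported refinable function $\varphi\in L_2(V)$ given by $\widehat\varphi=\prod_{j=1}^\infty m_0({\mathcal M^*}^{-j}\cdot)$ (at each point only finitely many factors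 differ from $1$); this $\varphi$ is called the refinable function associated with $\{\xi_0,\dots,\xi_r\}$. *)

theory Defs
  imports "HOL-Analysis.Analysis"
begin

text \<open>The dimension is the cardinality of the index type \<^typ>\<open>'d\<close>.\<close>

definition dilation_matrix :: "int ^ 'd ^ 'd::finite \<Rightarrow> bool" where
  "dilation_matrix M \<longleftrightarrow>
     (\<forall>(c::complex) v. v \<noteq> 0 \<and> (\<chi> i j. complex_of_int (M $ i $ j)) *v v = c *s v \<longrightarrow> norm c > 1)"

definition mdet :: "int ^ 'd ^ 'd::finite \<Rightarrow> nat" where
  "mdet M = nat \<bar>det M\<bar>"

definition vcong :: "int ^ 'd ^ 'd::finite \<Rightarrow> int ^ 'd \<Rightarrow> int ^ 'd \<Rightarrow> bool" where
  "vcong M l k \<longleftrightarrow> (\<exists>t. l - k = M *v t)"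

text \<open>A digit set comes with its enumeration \<open>s 0, ..., s (m - 1)\<close>; the other values of \<open>s\<close>
  play no role.\<close>

definition digit_enum :: "int ^ 'd ^ 'd::finite \<Rightarrow> (nat \<Rightarrow> int ^ 'd) \<Rightarrow> bool" where
  "digit_enum M s \<longleftrightarrow> s 0 = 0 \<and> (\<forall>i<mdet M. \<forall>j<mdet M. i \<noteq> j \<longrightarrow> \<not> vcong M (s i) (s j))"

definition digits :: "int ^ 'd ^ 'd::finite \<Rightarrow> (nat \<Rightarrow> int ^ 'd) \<Rightarrow> (int ^ 'd) set" where
  "digits M s = s ` {..<mdet M}"

type_synonym 'd vseq = "int \<Rightarrow> int ^ 'd"

definition vil :: "int ^ 'd ^ 'd::finite \<Rightarrow> (nat \<Rightarrow> int ^ 'd) \<Rightarrow> 'd vseq set" where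
  "vil M s = {x. (\<forall>j. x j \<in> digits M s) \<and> finite {j. j < 0 \<and> x j \<noteq> 0}}"

definition vadd :: "int ^ 'd ^ 'd::finite \<Rightarrow> (nat \<Rightarrow> int ^ 'd) \<Rightarrow> 'd vseq \<Rightarrow> 'd vseq \<Rightarrow> 'd vseq" where
  "vadd M s x y = (\<lambda>j. THE z. z \<in> digits M s \<and> vcong M z (x j + y j))"

definition vadd_set ::
  "int ^ 'd ^ 'd::finite \<Rightarrow> (nat \<Rightarrow> int ^ 'd) \<Rightarrow> 'd vseq set \<Rightarrow> 'd vseq set \<Rightarrow> 'd vseq set" where
  "vadd_set M s A B = {vadd M s a u | a u. a \<in> A \<and> u \<in> B}"

definition vU :: "int ^ 'd ^ 'd::finite \<Rightarrow> (nat \<Rightarrow> int ^ 'd) \<Rightarrow> int \<Rightarrow> 'd vseq set" where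
  "vU M s l = {x \<in> vil M s. \<forall>j\<le>l. x j = 0}"

definition vH :: "int ^ 'd ^ 'd::finite \<Rightarrow> (nat \<Rightarrow> int ^ 'd) \<Rightarrow> 'd vseq set" where
  "vH M s = {x \<in> vil M s. \<forall>j>0. x j = 0}"

text \<open>\<open>vshift k\<close> is the \<open>k\<close>-th power, \<open>k\<close> any integer, of the shift \<open>x \<mapsto> (\<lambda>j. x (j + 1))\<close>.\<close>

definition vshift :: "int \<Rightarrow> 'd::finite vseq \<Rightarrow> 'd vseq" where
  "vshift k x = (\<lambda>j. x (j + k))"

definition vgamma :: "int ^ 'd ^ 'd::finite \<Rightarrow> (nat \<Rightarrow> int ^ 'd) \<Rightarrow> nat \<Rightarrow> 'd vseq" where
  "vgamma M s k = (\<lambda>i. if i \<le> 0 then s ((k div mdet M ^ nat (- i)) mod mdet M) else 0)"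

definition vopen :: "int ^ 'd ^ 'd::finite \<Rightarrow> (nat \<Rightarrow> int ^ 'd) \<Rightarrow> 'd vseq set \<Rightarrow> bool" where
  "vopen M s G \<longleftrightarrow> G \<subseteq> vil M s \<and> (\<forall>x\<in>G. \<exists>l. vadd_set M s {x} (vU M s l) \<subseteq> G)"

definition vtop :: "int ^ 'd ^ 'd::finite \<Rightarrow> (nat \<Rightarrow> int ^ 'd) \<Rightarrow> 'd vseq topology" where
  "vtop M s = topology (vopen M s)"

lemma vU_antimono: "l \<le> l' \<Longrightarrow> vU M s l' \<subseteq> vU M s l"
  by (auto simp: vU_def)

lemma istopology_vopen: "istopology (vopen M s)"
  unfolding istopology_def
proof safe
  fix S T assume S: "vopen M s S" and T: "vopen M s T"
  show "vopen M s (S \<inter> T)"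
    unfolding vopen_def
  proof (intro conjI ballI)
    show "S \<inter> T \<subseteq> vil M s" using S by (auto simp: vopen_def)
    fix x assume x: "x \<in> S \<inter> T"
    obtain l where l: "vadd_set M s {x} (vU M s l) \<subseteq> S"
      using S x unfolding vopen_def by blast
    obtain l' where l': "vadd_set M s {x} (vU M s l') \<subseteq> T"
      using T x unfolding vopen_def by blast
    have "vadd_set M s {x} (vU M s (max l l')) \<subseteq> vadd_set M s {x} (vU M s l)"
      using vU_antimono[of l "max l l'" M s] by (auto simp: vadd_set_def)
    moreover have "vadd_set M s {x} (vU M s (max l l')) \<subseteq> vadd_set M s {x} (vU M s l')"
      using vU_antimono[of l' "max l l'" M s] by (auto simp: vadd_set_def)
    ultimately show "\<exists>l. vadd_set M s {x} (vU M s l) \<subseteq> S \<inter> T"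
      using l l' by blast
  qed
next
  fix K assume "\<forall>S\<in>K. vopen M s S"
  then show "vopen M s (\<Union> K)"
    unfolding vopen_def by (meson Sup_least Sup_upper UnionE order_trans)
qed

lemma openin_vtop: "openin (vtop M s) = vopen M s"
  unfolding vtop_def by (rule topology_inverse'[OF istopology_vopen])

text \<open>Since the group is second countable and the measure of every \<open>vU M s l\<close> is finite by
  invariance, regularity is automatic and the conditions determine \<open>\<mu>\<close>.\<close>

definition normalized_haar ::
  "int ^ 'd ^ 'd::finite \<Rightarrow> (nat \<Rightarrow> int ^ 'd) \<Rightarrow> 'd vseq measure \<Rightarrow> bool" where
  "normalized_haar M s \<mu> \<longleftrightarrow>
     space \<mu> = vil M s \<and>
     sets \<mu> = sigma_sets (vil M s) {G. openin (vtop M s) G} \<and>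
     (\<forall>x\<in>vil M s. \<forall>A\<in>sets \<mu>. emeasure \<mu> (vadd_set M s {x} A) = emeasure \<mu> A) \<and>
     emeasure \<mu> (vU M s 0) = 1"

definition vUnk :: "int ^ 'd ^ 'd::finite \<Rightarrow> (nat \<Rightarrow> int ^ 'd) \<Rightarrow> int \<Rightarrow> nat \<Rightarrow> 'd vseq set" where
  "vUnk M s n k = vadd_set M s {vshift (- n) (vgamma M s k)} (vshift (- n) ` vU M s 0)"

text \<open>Functions on the group are functions on all sequences; only their values on \<^const>\<open>vil\<close> matter.
  \<open>vS M s n k\<close> is the class written \<open>S\<close> with lower index \<open>n\<close> and upper index \<open>k\<close>.\<close>

definition vS :: "int ^ 'd ^ 'd::finite \<Rightarrow> (nat \<Rightarrow> int ^ 'd) \<Rightarrow> int \<Rightarrow> int \<Rightarrow> ('d vseq \<Rightarrow> complex) set" where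
  "vS M s n k =
     {f. (\<forall>k'. f constant_on vUnk M s n k') \<and>
         vtop M s closure_of {x \<in> vil M s. f x \<noteq> 0} \<subseteq> vshift k ` vU M s 0}"

text \<open>The first argument of \<^term>\<open>vchar M\<close> lives in the group of \<open>M\<close>, the second in the group of
  \<^term>\<open>transpose M\<close>. Only finitely many terms of the sum are nonzero.\<close>

definition vchar :: "int ^ 'd ^ 'd::finite \<Rightarrow> 'd vseq \<Rightarrow> 'd vseq \<Rightarrow> complex" where
  "vchar M x \<omega> =
     exp (2 * complex_of_real pi * \<i> * complex_of_real
       (\<Sum>\<^sub>\<infinity>j. (matrix_inv (\<chi> i k. real_of_int (M $ i $ k)) *v (\<chi> i. real_of_int (x j $ i)))
               \<bullet> (\<chi> i. real_of_int (\<omega> (1 - j) $ i))))"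

definition walsh_polynomial ::
  "int ^ 'd ^ 'd::finite \<Rightarrow> (nat \<Rightarrow> int ^ 'd) \<Rightarrow> (nat \<Rightarrow> int ^ 'd) \<Rightarrow> nat \<Rightarrow> ('d vseq \<Rightarrow> complex) \<Rightarrow> bool"
  where
  "walsh_polynomial M s s' n p \<longleftrightarrow>
     (\<exists>c. \<forall>\<omega>\<in>vil (transpose M) s'. p \<omega> = (\<Sum>k<mdet M ^ n. c k * vchar M (vgamma M s k) \<omega>))"

definition L1 :: "'a measure \<Rightarrow> ('a \<Rightarrow> complex) set" where
  "L1 \<mu> = {f. integrable \<mu> f}"

definition L2 :: "'a measure \<Rightarrow> ('a \<Rightarrow> complex) set" where
  "L2 \<mu> = {f \<in> borel_measurable \<mu>. integrable \<mu> (\<lambda>x. (norm (f x))\<^sup>2)}"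

definition fourier ::
  "int ^ 'd ^ 'd::finite \<Rightarrow> 'd vseq measure \<Rightarrow> ('d vseq \<Rightarrow> complex) \<Rightarrow> 'd vseq \<Rightarrow> complex" where
  "fourier M \<mu> f \<omega> = (\<integral>x. f x * cnj (vchar M x \<omega>) \<partial>\<mu>)"

text \<open>\<open>g\<close> is (a representative of) the Fourier transform of \<open>f \<in> L2 \<mu>\<close>, defined by continuous
  extension from \<open>L1 \<mu> \<inter> L2 \<mu>\<close>.\<close>

definition fourier_L2 ::
  "int ^ 'd ^ 'd::finite \<Rightarrow> 'd vseq measure \<Rightarrow> 'd vseq measure \<Rightarrow>
   ('d vseq \<Rightarrow> complex) \<Rightarrow> ('d vseq \<Rightarrow> complex) \<Rightarrow> bool" where
  "fourier_L2 M \<mu> \<mu>' f g \<longleftrightarrow>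
     f \<in> L2 \<mu> \<and> g \<in> L2 \<mu>' \<and>
     (\<exists>F. (\<forall>i::nat. F i \<in> L1 \<mu> \<inter> L2 \<mu>) \<and>
          (\<lambda>i. \<integral>\<^sup>+x. ennreal ((norm (F i x - f x))\<^sup>2) \<partial>\<mu>) \<longlonglongrightarrow> 0 \<and>
          (\<lambda>i. \<integral>\<^sup>+\<omega>. ennreal ((norm (fourier M \<mu> (F i) \<omega> - g \<omega>))\<^sup>2) \<partial>\<mu>') \<longlonglongrightarrow> 0)"

definition refinable ::
  "int ^ 'd ^ 'd::finite \<Rightarrow> (nat \<Rightarrow> int ^ 'd) \<Rightarrow> 'd vseq measure \<Rightarrow> ('d vseq \<Rightarrow> complex) \<Rightarrow> bool" where
  "refinable M s \<mu> \<phi> \<longleftrightarrow> \<phi> \<in> L2 \<mu> \<and>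
     (\<exists>\<alpha>. \<forall>x\<in>vil M s. (\<lambda>k. \<alpha> k * \<phi> (vadd M s (vshift 1 x) (vgamma M s k))) sums \<phi> x)"

definition orthogonal_refinable ::
  "int ^ 'd ^ 'd::finite \<Rightarrow> (nat \<Rightarrow> int ^ 'd) \<Rightarrow> 'd vseq measure \<Rightarrow> ('d vseq \<Rightarrow> complex) \<Rightarrow> bool" where
  "orthogonal_refinable M s \<mu> \<phi> \<longleftrightarrow> refinable M s \<mu> \<phi> \<and>
     (\<forall>h\<in>vH M s. \<forall>h'\<in>vH M s.
        (\<integral>x. \<phi> (vadd M s x h) * cnj (\<phi> (vadd M s x h')) \<partial>\<mu>) = (if h = h' then 1 else 0))"

text \<open>The word \<open>f a, f (a + 1), ..., f (a + n - 1)\<close>.\<close>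

definition seg :: "(int \<Rightarrow> 'a) \<Rightarrow> int \<Rightarrow> nat \<Rightarrow> 'a list" where
  "seg f a n = map (\<lambda>i. f (a + int i)) [0..<n]"

text \<open>The element whose coordinates with indices \<open>a, a + 1, ...\<close> form the word \<open>w\<close>,
  all other coordinates being zero.\<close>

definition velem :: "int \<Rightarrow> (int ^ 'd) list \<Rightarrow> 'd::finite vseq" where
  "velem a w = (\<lambda>j. if a \<le> j \<and> j < a + int (length w) then w ! nat (j - a) else 0)"

definition associated_values ::
  "(int ^ 'd::finite) set \<Rightarrow> nat \<Rightarrow> nat \<Rightarrow> (int \<Rightarrow> int ^ 'd) \<Rightarrow> ((int ^ 'd) list \<Rightarrow> complex) \<Rightarrow> bool" where
  "associated_values D n r \<xi> b \<longleftrightarrow>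
     (\<forall>k\<le>r - n + 1. b (seg \<xi> (int k) n) \<in> {1, -1}) \<and>
     (\<forall>w. length w = n - 1 \<and> set w \<subseteq> D \<and> (\<forall>k\<in>{1..r - n + 2}. w \<noteq> seg \<xi> (int k) (n - 1))
          \<longrightarrow> b (0 # w) \<in> {1, -1}) \<and>
     b (replicate n 0) = 1 \<and>
     (\<forall>w. length w = n \<and> set w \<subseteq> D \<and>
          \<not> (\<exists>k\<le>r - n + 1. w = seg \<xi> (int k) n) \<and>
          \<not> (\<exists>v. w = 0 # v \<and> (\<forall>k\<in>{1..r - n + 2}. v \<noteq> seg \<xi> (int k) (n - 1)))
          \<longrightarrow> b w = 0)"

text \<open>\<open>s\<close> and \<open>s'\<close> enumerate the digits of \<open>M\<close> and \<^term>\<open>transpose M\<close>, and \<open>\<mu>\<close>, \<open>\<mu>'\<close> are the Haar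
  measures of the corresponding groups. Being an element of \<open>L2 \<mu>\<close> given by its Fourier
  transform, \<open>\<phi>\<close> is determined up to equality almost everywhere.\<close>

definition associated_function ::
  "int ^ 'd ^ 'd::finite \<Rightarrow> (nat \<Rightarrow> int ^ 'd) \<Rightarrow> (nat \<Rightarrow> int ^ 'd) \<Rightarrow>
   'd vseq measure \<Rightarrow> 'd vseq measure \<Rightarrow> nat \<Rightarrow> nat \<Rightarrow> (int \<Rightarrow> int ^ 'd) \<Rightarrow>
   ((int ^ 'd) list \<Rightarrow> complex) \<Rightarrow> ('d vseq \<Rightarrow> complex) \<Rightarrow> bool" where
  "associated_function M s s' \<mu> \<mu>' n r \<xi> b \<phi> \<longleftrightarrow>
     associated_values (digits (transpose M) s') n r \<xi> b \<and>
     (\<exists>m0. walsh_polynomial M s s' n m0 \<and>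
           (\<forall>w. length w = n \<and> set w \<subseteq> digits (transpose M) s' \<longrightarrow> m0 (velem 0 (0 # w)) = b w) \<and>
           fourier_L2 M \<mu> \<mu>' \<phi> (\<lambda>\<omega>. \<Prod>j. m0 (vshift (- int (Suc j)) \<omega>)))"

definition Qset :: "(int ^ 'd::finite) set \<Rightarrow> nat \<Rightarrow> nat \<Rightarrow> (int \<Rightarrow> int ^ 'd) \<Rightarrow> 'd vseq set" where
  "Qset D n r \<xi> =
     {velem 0 (0 # w) | w. length w = n - 1 \<and> set w \<subseteq> D \<and>
        (\<forall>k\<in>{1..r - n + 2}. w \<noteq> seg \<xi> (int k) (n - 1))}"

end

theory Submission
  imports Defs
begin

text \<open>
  If the product \<open>\<Prod>m\<^sub>0(M*\<^sup>-\<^sup>j\<omega>)\<close> is nonzero at \<open>\<omega>\<close>, then \<open>b\<close> is nonzero on every window of length \<open>n\<close> of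
  \<open>\<omega>\<close> that starts at a nonpositive index. Reading \<open>\<omega>\<close> from its first nonzero coordinate on, the
  window conditions force it to spell \<open>\<xi>\<^sub>0, \<xi>\<^sub>1, \<dots>\<close> up to the separating comma, since a subword of
  length \<open>n - 1\<close> determines its position in \<open>\<xi>\<close>. Hence the product vanishes outside the cosets of the
  statement, has modulus \<open>1\<close> on them, and every element of \<open>U*\<close> has exactly one translate by \<open>H*\<close>
  in its support, which gives orthonormality. The function itself is written as a finite sum of
  characters on a coset, so that its Fourier transform, the refinement equation and the inner
  products follow from the orthogonality of characters. It agrees almost everywhere with any
  \<open>L\<^sub>2\<close> function having this Fourier transform, because the integrals over cosets of the \<open>U\<^sub>l\<close> can be
  recovered from the Fourier transform.
\<close>

section \<open>Complete residue systems modulo an integer matrix\<close>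

text \<open>A digit set is only required to consist of m pairwise incongruent vectors, while
  addition selects the digit of a class by \<open>THE\<close>; that every class has a digit is
  obtained by comparing volumes. The Fourier transform fixes \<phi> only almost everywhere, whereas
  the refinement equation, the step property and the support condition are claims about single
  points. Hence an explicit representative is built, and the conclusion is stated for it. Its two
  parameters come from two features of the product. Windows that start at nonpositive indices reach
  at most index n - 1, so the product is constant on cosets of U*_{n-1}, and the function is
  supported in U_{1-n}. A word read in the support starts at index 2 - (r - n + 2) - 1 = n - r - 1
  or later, so the product is supported in U*_{-(r-n+2)}, and the function is constant on cosets of
  U_{r-n+2}. Characters become constant on cosets at a sufficiently fine level, so their
  orthogonality reduces to a sum over the digits of one coordinate.\<close>

definition real_vec :: "int ^ 'n \<Rightarrow> real ^ 'n" where
  "real_vec v = (\<chi> i. real_of_int (v $ i))"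

definition real_mat :: "int ^ 'n ^ 'm \<Rightarrow> real ^ 'n ^ 'm" where
  "real_mat A = (\<chi> i j. real_of_int (A $ i $ j))"

lemma real_vec_nth [simp]: "real_vec v $ i = real_of_int (v $ i)"
  by (simp add: real_vec_def)

lemma real_vec_add [simp]: "real_vec (u + v) = real_vec u + real_vec v"
  by (simp add: vec_eq_iff)

lemma real_vec_diff [simp]: "real_vec (u - v) = real_vec u - real_vec v"
  by (simp add: vec_eq_iff)

lemma real_vec_0 [simp]: "real_vec 0 = 0"
  by (simp add: vec_eq_iff)

lemma real_vec_inject [simp]: "real_vec u = real_vec v \<longleftrightarrow> u = v"
  by (simp add: vec_eq_iff)

lemma real_vec_mult: "real_vec (A *v v) = real_mat A *v real_vec v"
  by (simp add: vec_eq_iff real_mat_def matrix_vector_mult_def)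

lemma det_real_mat: "det (real_mat A) = real_of_int (det A)"
  by (simp add: det_def real_mat_def)

text \<open>The half-open cube lies between the open and the closed one, both of volume 1. Half-open
  cubes are used because their integer translates tile space without overlap.\<close>

lemma unit_cube_lebesgue:
  fixes Q :: "(real ^ 'n) set"
  defines "Q \<equiv> {x. \<forall>i. 0 \<le> x $ i \<and> x $ i < 1}"
  shows "Q \<in> lmeasurable" "emeasure lebesgue Q = 1"
proof -
  have Q: "Q = (\<Inter>i\<in>UNIV. {x. 0 \<le> x $ i} \<inter> {x. x $ i < 1})"
    by (auto simp: Q_def)
  have "{x :: real ^ 'n. 0 \<le> x $ i} \<in> sets borel" "{x :: real ^ 'n. x $ i < 1} \<in> sets borel" for i
    by (auto intro!: borel_closed borel_open closed_halfspace_component_ge_cart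
        open_halfspace_component_lt_cart)
  then have borel: "Q \<in> sets borel"
    unfolding Q by (intro sets.finite_INT) auto
  have sub: "box 0 1 \<subseteq> Q" "Q \<subseteq> cbox 0 1"
    by (auto simp: Q_def mem_box_cart less_imp_le)
  show "Q \<in> lmeasurable"
    using borel sub by (intro lmeasurable_iff_integrable[THEN iffD1] bounded_set_imp_lmeasurable
        bounded_subset[OF bounded_cbox]) auto
  have ne: "cbox (0 :: real ^ 'n) 1 \<noteq> {}"
    by (auto simp: interval_ne_empty_cart)
  have 1: "emeasure lebesgue (cbox (0 :: real ^ 'n) 1) = 1"
  proof -
    have "measure lebesgue (cbox (0 :: real ^ 'n) 1) = 1"
      using ne by (simp add: content_cbox_if_cart)
    then show ?thesis
      by (metis emeasure_eq_measure2 ennreal_1 lmeasurable_cbox)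
  qed
  have 2: "emeasure lebesgue (box (0 :: real ^ 'n) 1) = 1"
  proof -
    have "measure lebesgue (box (0 :: real ^ 'n) 1) = 1"
      by (auto simp: measure_lborel_box_eq Basis_vec_def inner_axis intro!: prod.neutral)
    then show ?thesis
      by (metis emeasure_eq_measure2 ennreal_1 lmeasurable_box)
  qed
  show "emeasure lebesgue Q = 1"
    using emeasure_mono[OF sub(1), of lebesgue] emeasure_mono[OF sub(2), of lebesgue] borel 1 2
    by (auto intro: antisym)
qed

lemma emeasure_translation_lmeasurable:
  fixes S :: "'a::euclidean_space set"
  assumes "S \<in> lmeasurable"
  shows "emeasure lebesgue ((+) a ` S) = emeasure lebesgue S"
  using assms by (metis emeasure_eq_measure2 measurable_translation measure_translation)

text \<open>The unit cubes attached to incongruent vectors are disjoint modulo the lattice \<open>M\<int>\<^sup>n\<close>,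
  so that they can be moved, piece by piece, into the fundamental parallelepiped of volume
  \<open>\<bar>det M\<bar>\<close>.\<close>

lemma card_incongruent_wellorder:
  fixes M :: "int ^ 'n::{finite,wellorder} ^ 'n::_"
  assumes det: "det M \<noteq> 0" and fin: "finite S"
    and inc: "\<And>u v. u \<in> S \<Longrightarrow> v \<in> S \<Longrightarrow> vcong M u v \<Longrightarrow> u = v"
  shows "card S \<le> mdet M"
proof -
  define Q where "Q = {x :: real ^ 'n::_. \<forall>i. 0 \<le> x $ i \<and> x $ i < 1}"
  define fl where "fl = (\<lambda>x :: real ^ 'n::_. \<chi> i. \<lfloor>x $ i\<rfloor>)"
  define f where "f = (*v) (real_mat M)"
  define cubes where "cubes = (\<Union>v\<in>S. (+) (real_vec v) ` Q)"
  define E where "E = (\<lambda>t. cubes \<inter> (+) (f (real_vec t)) ` f ` Q)"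
  define F where "F = (\<lambda>t. (+) (- f (real_vec t)) ` E t)"
  have Q: "Q \<in> lmeasurable" "emeasure lebesgue Q = 1"
    using unit_cube_lebesgue by (auto simp: Q_def)
  have lin: "linear f"
    by (simp add: f_def)
  have fadd: "f (x + y) = f x + f y" "f (x - y) = f x - f y" for x y
    using lin by (simp_all add: linear_add linear_diff)
  have fvec: "f (real_vec t) = real_vec (M *v t)" for t
    by (simp add: f_def real_vec_mult)
  have inj: "inj f"
    unfolding f_def using det by (subst det_nz_iff_inj[symmetric]) (simp_all add: det_real_mat)
  have surj: "surj f"
    using inj lin by (simp add: linear_injective_imp_surjective)
  have fl_unique: "fl x = v" if "x - real_vec v \<in> Q" for x v
    using that by (auto simp: fl_def Q_def vec_eq_iff floor_eq_iff algebra_simps)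
  have fl_frac: "x - real_vec (fl x) \<in> Q" for x
    by (simp add: fl_def Q_def) linarith
  have mem_cube: "x \<in> (+) (real_vec v) ` Q \<longleftrightarrow> fl x = v" for x v
  proof
    assume "x \<in> (+) (real_vec v) ` Q"
    then show "fl x = v"
      by (intro fl_unique) auto
  next
    assume "fl x = v"
    then show "x \<in> (+) (real_vec v) ` Q"
      using fl_frac[of x] by (intro image_eqI[of _ _ "x - real_vec v"]) auto
  qed
  have cubes: "x \<in> cubes \<longleftrightarrow> fl x \<in> S" for x
    by (auto simp: cubes_def mem_cube)
  have parallelepiped: "x \<in> (+) (f (real_vec t)) ` f ` Q \<longleftrightarrow> t = fl (inv f x)" for x t
  proof -
    have "x \<in> (+) (f (real_vec t)) ` f ` Q \<longleftrightarrow> f (inv f x) \<in> f ` (+) (real_vec t) ` Q"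
      using surj by (simp add: surj_f_inv_f image_comp o_def fadd)
    also have "\<dots> \<longleftrightarrow> inv f x \<in> (+) (real_vec t) ` Q"
      using inj by (rule inj_image_mem_iff)
    finally show ?thesis
      by (auto simp: mem_cube)
  qed
  have meas_T: "f ` Q \<in> lmeasurable"
    using lin Q(1) by (rule measurable_linear_image)
  have emeas_T: "emeasure lebesgue (f ` Q) = mdet M"
  proof -
    have "measure lebesgue Q = 1"
      using Q by (simp add: measure_def)
    then have "measure lebesgue (f ` Q) = \<bar>det (matrix f)\<bar>"
      using measure_linear_image[OF lin Q(1)] by simp
    also have "\<dots> = mdet M"
      by (simp add: f_def det_real_mat mdet_def)
    finally show ?thesis
      using meas_T by (simp add: emeasure_eq_measure2 ennreal_of_nat_eq_real_of_nat)
  qed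
  have meas_cubes: "cubes \<in> lmeasurable"
    unfolding cubes_def using fin Q(1)
    by (intro fmeasurable.finite_UN) (auto intro: measurable_translation)
  have meas_E: "E t \<in> lmeasurable" for t
    unfolding E_def using meas_cubes meas_T by (intro fmeasurable.Int) (auto intro: measurable_translation)
  have meas_F: "F t \<in> lmeasurable" for t
    unfolding F_def using meas_E by (rule measurable_translation)
  have mem_F: "z \<in> F t \<longleftrightarrow> z + f (real_vec t) \<in> cubes \<and> z \<in> f ` Q" for z t
    by (force simp: F_def E_def algebra_simps image_iff)
  have mem_E: "x \<in> E t \<longleftrightarrow> x \<in> cubes \<and> t = fl (inv f x)" for x t
    using parallelepiped by (simp add: E_def)
  have disj_E: "disjoint_family_on E UNIV"
    by (auto simp: disjoint_family_on_def mem_E)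
  have disj_F: "disjoint_family_on F UNIV"
    unfolding disjoint_family_on_def
  proof (intro ballI impI, rule ccontr)
    fix t t' assume "t \<noteq> t'" "F t \<inter> F t' \<noteq> {}"
    then obtain z where z: "z + f (real_vec t) \<in> cubes" "z + f (real_vec t') \<in> cubes"
      by (auto simp: mem_F)
    \<comment> \<open>Translation by a lattice vector changes the cube index by that vector, so a
      point common to two moved pieces yields two congruent elements of \<open>S\<close>.\<close>
    have shift: "fl (z + f (real_vec u)) = fl z + M *v u" for u
      by (rule fl_unique) (use fl_frac[of z] in \<open>simp add: fvec algebra_simps\<close>)
    have "vcong M (fl z + M *v t) (fl z + M *v t')"
      unfolding vcong_def by (rule exI[of _ "t - t'"]) (simp add: matrix_vector_mult_diff_distrib)
    with z have "fl z + M *v t = fl z + M *v t'"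
      by (intro inc) (auto simp: cubes shift)
    then have "f (real_vec t) = f (real_vec t')"
      by (simp add: fvec)
    with inj \<open>t \<noteq> t'\<close> show False
      by (simp add: inj_eq)
  qed
  have "of_nat (card S) = (\<Sum>v\<in>S. emeasure lebesgue ((+) (real_vec v) ` Q))"
    using Q by (simp add: emeasure_translation_lmeasurable)
  also have "\<dots> = emeasure lebesgue cubes"
    unfolding cubes_def
  proof (rule sum_emeasure)
    show "(\<lambda>v. (+) (real_vec v) ` Q) ` S \<subseteq> sets lebesgue"
      using measurable_translation[OF Q(1)] by blast
    show "disjoint_family_on (\<lambda>v. (+) (real_vec v) ` Q) S"
      unfolding disjoint_family_on_def set_eq_iff Int_iff mem_cube by auto
  qed (fact fin)
  \<comment> \<open>Integer vectors are countable, so countable additivity applies without bounding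
    the \<open>t\<close> that actually occur.\<close>
  also have "cubes = (\<Union>t\<in>UNIV. E t)"
    by (auto simp: mem_E)
  also have "emeasure lebesgue \<dots> = (\<integral>\<^sup>+t. emeasure lebesgue (E t) \<partial>count_space UNIV)"
    using meas_E disj_E by (intro emeasure_UN_countable) auto
  also have "\<dots> = (\<integral>\<^sup>+t. emeasure lebesgue (F t) \<partial>count_space UNIV)"
    unfolding F_def using meas_E by (simp only: emeasure_translation_lmeasurable)
  also have "\<dots> = emeasure lebesgue (\<Union>t\<in>UNIV. F t)"
    using meas_F disj_F by (intro emeasure_UN_countable[symmetric]) auto
  also have "\<dots> \<le> emeasure lebesgue (f ` Q)"
    using meas_T by (intro emeasure_mono) (auto simp: mem_F)
  finally show ?thesis
    by (simp add: emeas_T)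
qed

text \<open>A copy of a finite type, ordered along an enumeration: the change of variables formula of
  the library needs the index type of vectors to be ordered.\<close>

typedef 'a enumerated = "UNIV :: 'a set" ..

lemma bij_Rep_enumerated: "bij Rep_enumerated"
  by (rule bij_betw_byWitness[where f' = Abs_enumerated])
     (auto simp: Rep_enumerated_inverse Abs_enumerated_inverse)

lemma ex_inj_nat: "\<exists>f :: ('a::finite) enumerated \<Rightarrow> nat. inj f"
proof -
  obtain f :: "'a \<Rightarrow> nat" where "inj f"
    using finite_imp_inj_to_nat_seg[of "UNIV :: 'a set"] by auto
  show ?thesis
    by (rule exI, rule inj_compose[OF \<open>inj f\<close> bij_is_inj[OF bij_Rep_enumerated]])
qed

definition enum_index :: "('a::finite) enumerated \<Rightarrow> nat" where
  "enum_index = (SOME f. inj f)"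

lemma inj_enum_index: "inj enum_index"
  unfolding enum_index_def by (rule someI_ex[OF ex_inj_nat])

instance enumerated :: (finite) finite
proof
  show "finite (UNIV :: 'a enumerated set)"
    by (rule bij_betw_finite[OF bij_Rep_enumerated, THEN iffD2]) simp
qed

instantiation enumerated :: (finite) wellorder
begin

definition less_eq_enumerated :: "'a enumerated \<Rightarrow> 'a enumerated \<Rightarrow> bool" where
  "x \<le> y \<longleftrightarrow> enum_index x \<le> enum_index y"

definition less_enumerated :: "'a enumerated \<Rightarrow> 'a enumerated \<Rightarrow> bool" where
  "x < y \<longleftrightarrow> enum_index x < enum_index y"

instance
proof
  fix P :: "'a enumerated \<Rightarrow> bool" and a
  assume step: "\<And>x. (\<And>y. y < x \<Longrightarrow> P y) \<Longrightarrow> P x"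
  show "P a"
    by (induction a rule: measure_induct_rule[of enum_index]) (auto intro: step simp: less_enumerated_def)
next
  fix x y :: "'a enumerated"
  assume "x \<le> y" "y \<le> x"
  then show "x = y"
    by (intro injD[OF inj_enum_index] antisym) (simp_all only: less_eq_enumerated_def)
qed (auto simp: less_eq_enumerated_def less_enumerated_def)

end

text \<open>Conjugation by \<open>f\<close> is a bijection between the permutations of the two index
  types and preserves signs, so the Leibniz sums agree term by term.\<close>

lemma det_reindex:
  fixes A :: "'a::comm_ring_1 ^ 'n ^ 'n" and f :: "'m::finite \<Rightarrow> 'n::finite"
  assumes "bij f"
  shows "det (\<chi> i j. A $ f i $ f j) = det A"
proof -
  have bij: "bij_betw (map_permutation UNIV f) {p. p permutes UNIV} {p. p permutes UNIV}"
  proof (rule bij_betw_byWitness[where f' = "map_permutation UNIV (inv f)"])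
    have comp: "inv f \<circ> f = id" "f \<circ> inv f = id"
      using assms by (auto simp: bij_is_inj bij_is_surj surj_iff[symmetric])
    have "bij (inv f)"
      using assms by (rule bij_imp_bij_inv)
    show "\<forall>p\<in>{p. p permutes UNIV}. map_permutation UNIV (inv f) (map_permutation UNIV f p) = p"
      using map_permutation_compose[OF assms bij_is_inj[OF \<open>bij (inv f)\<close>]] by (simp add: comp)
    show "\<forall>p\<in>{p. p permutes UNIV}. map_permutation UNIV f (map_permutation UNIV (inv f) p) = p"
      using map_permutation_compose[OF \<open>bij (inv f)\<close> bij_is_inj[OF assms]] by (simp add: comp)
  qed (use assms bij_imp_bij_inv[OF assms] in \<open>auto intro!: map_permutation_permutes\<close>)
  have map_perm: "map_permutation UNIV f p (f i) = f (p i)" for p i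
    using assms by (simp add: map_permutation_def restrict_id_def bij_is_inj)
  have "(\<Prod>i\<in>UNIV. A $ i $ map_permutation UNIV f p i) = (\<Prod>i\<in>UNIV. A $ f i $ f (p i))" for p
    using prod.reindex_bij_betw[OF assms, of "\<lambda>i. A $ i $ map_permutation UNIV f p i"]
    by (simp add: map_perm)
  moreover have "sign (map_permutation UNIV f p) = sign p" if "p permutes UNIV" for p
    using that assms by (intro sign_map_permutation) (auto simp: bij_is_inj)
  ultimately show ?thesis
    unfolding det_def by (subst sum.reindex_bij_betw[OF bij, symmetric]) simp
qed

text \<open>Relabelling the coordinates commutes with the action of the matrix, so congruence of
  relabelled vectors modulo \<open>M'\<close> comes from congruence modulo \<open>M\<close>, and the
  ordered case applies.\<close>

lemma card_incongruent:
  fixes M :: "int ^ 'n ^ 'n::finite"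
  assumes det: "det M \<noteq> 0" and fin: "finite S"
    and inc: "\<And>u v. u \<in> S \<Longrightarrow> v \<in> S \<Longrightarrow> vcong M u v \<Longrightarrow> u = v"
  shows "card S \<le> mdet M"
proof -
  define f where "f = (Rep_enumerated :: 'n enumerated \<Rightarrow> 'n)"
  have f: "bij f"
    unfolding f_def by (rule bij_Rep_enumerated)
  define M' where "M' = (\<chi> i j. M $ f i $ f j)"
  define pull where "pull = (\<lambda>v :: int ^ 'n. \<chi> i. v $ f i)"
  have inj: "inj pull"
    using f by (auto simp: inj_def pull_def vec_eq_iff) (metis bij_pointE)
  have mult: "pull (M *v t) = M' *v pull t" for t
    unfolding pull_def M'_def matrix_vector_mult_def vec_eq_iff
    by (auto intro!: sum.reindex_bij_betw[OF f, symmetric])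
  have surj: "\<exists>t. t' = pull t" for t'
    by (rule exI[of _ "\<chi> i. t' $ inv f i"]) (use f in \<open>simp add: pull_def vec_eq_iff bij_is_inj\<close>)
  have det': "det M' = det M"
    unfolding M'_def using f by (rule det_reindex)
  have "card (pull ` S) \<le> mdet M'"
  proof (rule card_incongruent_wellorder)
    fix u v assume "u \<in> pull ` S" "v \<in> pull ` S" and cong: "vcong M' u v"
    then obtain x y where xy: "x \<in> S" "y \<in> S" "u = pull x" "v = pull y"
      by auto
    obtain t where "u - v = M' *v pull t"
      using cong surj by (metis vcong_def)
    then have "pull (x - y) = pull (M *v t)"
      using xy by (simp add: mult) (simp add: pull_def vec_eq_iff)
    then have "vcong M x y"
      using inj by (auto simp: vcong_def inj_eq)
    then show "u = v"
      using inc xy by blast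
  qed (use det det' fin in auto)
  then show ?thesis
    using inj by (simp add: card_image inj_on_subset mdet_def det')
qed


section \<open>Congruence, digits, and cosets as cylinders\<close>

lemma vcong_refl: "vcong M u u"
  unfolding vcong_def by (rule exI[of _ 0]) simp

lemma vcong_sym: "vcong M u v \<Longrightarrow> vcong M v u"
  unfolding vcong_def
proof (elim exE)
  fix t assume "u - v = M *v t"
  then have "v - u = M *v (0 - t)"
    unfolding matrix_vector_mult_diff_distrib by (simp add: algebra_simps)
  then show "\<exists>t. v - u = M *v t" ..
qed

lemma vcong_add: "vcong M u v \<Longrightarrow> vcong M u' v' \<Longrightarrow> vcong M (u + u') (v + v')"
  unfolding vcong_def
proof (elim exE)
  fix t t' assume "u - v = M *v t" "u' - v' = M *v t'"
  then have "u + u' - (v + v') = M *v (t + t')"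
    by (simp add: matrix_vector_right_distrib algebra_simps)
  then show "\<exists>t. u + u' - (v + v') = M *v t" ..
qed

lemma vcong_trans: "vcong M u v \<Longrightarrow> vcong M v w \<Longrightarrow> vcong M u w"
  using vcong_add[of M u v v w] by (simp add: vcong_def algebra_simps)

locale digit_system =
  fixes M :: "int ^ 'd ^ 'd::finite" and s :: "nat \<Rightarrow> int ^ 'd"
  assumes det_nonzero: "det M \<noteq> 0" and enum: "digit_enum M s"
begin

abbreviation "D \<equiv> digits M s"
abbreviation "m \<equiv> mdet M"
abbreviation "V \<equiv> vil M s"
abbreviation "U \<equiv> vU M s"

lemma m_pos: "0 < m"
  using det_nonzero by (simp add: mdet_def)

lemma finite_digits: "finite D"
  by (simp add: digits_def)

lemma zero_digit: "0 \<in> D"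
  using enum m_pos by (force simp: digits_def digit_enum_def)

lemma digit_unique: "x \<in> D \<Longrightarrow> y \<in> D \<Longrightarrow> vcong M x y \<Longrightarrow> x = y"
  using enum unfolding digits_def digit_enum_def by blast

lemma card_digits: "card D = m"
proof -
  have "inj_on s {..<m}"
    using enum vcong_refl unfolding digit_enum_def inj_on_def by (metis lessThan_iff)
  then show ?thesis
    by (simp add: digits_def card_image)
qed

text \<open>A class without a digit would extend the digit set to m + 1 pairwise incongruent
  vectors.\<close>

lemma ex_digit: "\<exists>x\<in>D. vcong M x v"
proof (rule ccontr)
  assume none: "\<not> (\<exists>x\<in>D. vcong M x v)"
  then have "v \<notin> D"
    using vcong_refl by blast
  then have "card (insert v D) = Suc m"
    using finite_digits card_digits by simp
  moreover have "card (insert v D) \<le> m"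
    using det_nonzero finite_digits none digit_unique vcong_sym
    by (intro card_incongruent) blast+
  ultimately show False
    by simp
qed

text \<open>The choice made inside \<open>vadd\<close>, isolated from the sum to which it is
  applied.\<close>

definition rep :: "int ^ 'd \<Rightarrow> int ^ 'd" where
  "rep v = (THE z. z \<in> D \<and> vcong M z v)"

lemma rep: "rep v \<in> D" "vcong M (rep v) v"
proof -
  have "\<exists>!z. z \<in> D \<and> vcong M z v"
    using ex_digit digit_unique vcong_sym vcong_trans by meson
  from theI'[OF this] show "rep v \<in> D" "vcong M (rep v) v"
    by (auto simp: rep_def)
qed

lemma rep_eq: "z \<in> D \<Longrightarrow> vcong M z v \<Longrightarrow> rep v = z"
  using rep digit_unique vcong_sym vcong_trans by meson

lemma rep_digit [simp]: "x \<in> D \<Longrightarrow> rep x = x"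
  by (simp add: rep_eq vcong_refl)

text \<open>Collapses nested reductions: subtracting with \<open>rep\<close> and adding back returns
  the original digit.\<close>

lemma rep_add_right: "rep (x + rep y) = rep (x + y)"
  by (rule rep_eq[OF rep(1)]) (meson rep(2) vcong_add vcong_refl vcong_sym vcong_trans)

lemma vadd_nth: "vadd M s x y j = rep (x j + y j)"
  by (simp add: vadd_def rep_def)

lemma vil_digit: "x \<in> V \<Longrightarrow> x j \<in> D"
  by (simp add: vil_def)

lemma vil_iff: "x \<in> V \<longleftrightarrow> (\<forall>j. x j \<in> D) \<and> (\<exists>N. \<forall>j\<le>N. x j = 0)"
proof -
  have "finite {j. j < 0 \<and> x j \<noteq> 0} \<longleftrightarrow> (\<exists>N. \<forall>j\<le>N. x j = 0)"
  proof
    assume "finite {j. j < 0 \<and> x j \<noteq> 0}"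
    then have "bdd_below {j. j < 0 \<and> x j \<noteq> 0}"
      by (rule bdd_below_finite)
    then obtain B where B: "\<And>j. j < 0 \<Longrightarrow> x j \<noteq> 0 \<Longrightarrow> B \<le> j"
      by (auto simp: bdd_below_def)
    have "x j = 0" if "j \<le> min (-1) (B - 1)" for j
      using B[of j] that by fastforce
    then show "\<exists>N. \<forall>j\<le>N. x j = 0"
      by blast
  next
    assume "\<exists>N. \<forall>j\<le>N. x j = 0"
    then obtain N where N: "\<And>j. j \<le> N \<Longrightarrow> x j = 0"
      by blast
    have "{j. j < 0 \<and> x j \<noteq> 0} \<subseteq> {N..0}"
      using N by (auto simp: not_less[symmetric])
    then show "finite {j. j < 0 \<and> x j \<noteq> 0}"
      by (rule finite_subset) simp
  qed
  then show ?thesis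
    by (simp add: vil_def)
qed

lemma vadd_vil: "x \<in> V \<Longrightarrow> y \<in> V \<Longrightarrow> vadd M s x y \<in> V"
  unfolding vil_iff
proof (elim conjE exE, intro conjI)
  fix N N' assume "\<forall>j\<le>N. x j = 0" "\<forall>j\<le>N'. y j = 0"
  then have "\<forall>j\<le>min N N'. vadd M s x y j = 0"
    by (simp add: vadd_nth zero_digit)
  then show "\<exists>N. \<forall>j\<le>N. vadd M s x y j = 0" ..
qed (simp add: vadd_nth rep)

text \<open>The coset of \<open>U l\<close> through \<open>x\<close>, described by coordinates
  instead of addition.\<close>

definition cyl :: "int \<Rightarrow> 'd vseq \<Rightarrow> 'd vseq set" where
  "cyl l x = {y \<in> V. \<forall>j\<le>l. y j = x j}"

lemma coset_eq_cyl:
  assumes x: "x \<in> V"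
  shows "vadd_set M s {x} (U l) = cyl l x"
proof safe
  fix z assume "z \<in> vadd_set M s {x} (U l)"
  then obtain u where u: "u \<in> V" "\<And>j. j \<le> l \<Longrightarrow> u j = 0" "z = vadd M s x u"
    by (auto simp: vadd_set_def vU_def)
  then show "z \<in> cyl l x"
    using x by (auto simp: cyl_def vadd_vil vadd_nth vil_digit)
next
  fix z assume z: "z \<in> cyl l x"
  \<comment> \<open>The coordinatewise difference, reduced to digits, is the element of
    \<open>U l\<close> that carries \<open>x\<close> to \<open>z\<close>.\<close>
  define u where "u = (\<lambda>j. rep (z j - x j))"
  obtain N where N: "\<And>j. j \<le> N \<Longrightarrow> x j = 0"
    using x by (auto simp: vil_iff)
  obtain N' where N': "\<And>j. j \<le> N' \<Longrightarrow> z j = 0"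
    using z by (auto simp: vil_iff cyl_def)
  have "\<forall>j\<le>min N N'. u j = 0"
    using N N' zero_digit by (simp add: u_def)
  then have "u \<in> V"
    unfolding vil_iff using rep(1) by (metis u_def)
  then have "u \<in> U l"
    using z zero_digit by (simp add: vU_def cyl_def u_def)
  moreover have "vadd M s x u = z"
    using z by (auto simp: fun_eq_iff vadd_nth u_def rep_add_right vil_digit cyl_def)
  ultimately show "z \<in> vadd_set M s {x} (U l)"
    by (auto simp: vadd_set_def)
qed

lemma zero_vil: "(\<lambda>_. 0) \<in> V"
  by (simp add: vil_def zero_digit)

lemma U_eq_cyl: "U l = cyl l (\<lambda>_. 0)"
  by (simp add: vU_def cyl_def)

lemma cyl_subset: "cyl l x \<subseteq> V"
  by (auto simp: cyl_def)

lemma vadd_zero_right: "x \<in> V \<Longrightarrow> vadd M s x (\<lambda>_. 0) = x"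
  by (auto simp: fun_eq_iff vadd_nth vil_digit)

text \<open>Representatives of the cosets of \<open>U l\<close> in \<open>U q\<close>.\<close>

definition box :: "int \<Rightarrow> int \<Rightarrow> 'd vseq set" where
  "box q l = {a. (\<forall>j. a j \<in> D) \<and> (\<forall>j. j \<le> q \<or> l < j \<longrightarrow> a j = 0)}"

lemma box_subset: "box q l \<subseteq> V"
  by (auto simp: box_def vil_iff intro!: exI[of _ q])

lemma box_self: "box q q = {\<lambda>_. 0}"
  by (auto simp: box_def zero_digit fun_eq_iff) (metis linorder_not_le)

text \<open>Attaches one more coordinate at the top; this drives the inductions on the level
  \<open>l\<close>.\<close>

lemma bij_box_Suc:
  assumes "q \<le> l"
  shows "bij_betw (\<lambda>(a, d). a(l + 1 := d)) (box q l \<times> D) (box q (l + 1))"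
proof (rule bij_betw_byWitness[where f' = "\<lambda>a. (a(l + 1 := 0), a (l + 1))"])
  show "\<forall>a\<in>box q l \<times> D. ((case a of (a, d) \<Rightarrow> a(l + 1 := d))(l + 1 := 0),
      (case a of (a, d) \<Rightarrow> a(l + 1 := d)) (l + 1)) = a"
    by (auto simp: box_def fun_eq_iff)
qed (use assms zero_digit in \<open>auto simp: box_def fun_eq_iff\<close>)

lemma sum_box_Suc:
  fixes F :: "'d vseq \<Rightarrow> 'b::comm_monoid_add"
  assumes "q \<le> l"
  shows "(\<Sum>a\<in>box q (l + 1). F a) = (\<Sum>a\<in>box q l. \<Sum>d\<in>D. F (a(l + 1 := d)))"
  using sum.reindex_bij_betw[OF bij_box_Suc[OF assms], of F]
  by (simp add: sum.cartesian_product case_prod_unfold)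

lemma finite_box: "finite (box q l)"
proof (cases "q \<le> l")
  case True
  then show ?thesis
  proof (induction l rule: int_ge_induct)
    case base
    then show ?case by (simp add: box_self)
  next
    case (step l)
    then show ?case
      using bij_betw_finite[OF bij_box_Suc, of q l] finite_digits by simp
  qed
next
  case False
  then have "box q l \<subseteq> {\<lambda>_. 0}"
    by (auto simp: box_def fun_eq_iff) (metis linorder_not_le order_less_trans)
  then show ?thesis
    by (rule finite_subset) simp
qed

definition trunc :: "int \<Rightarrow> int \<Rightarrow> 'd vseq \<Rightarrow> 'd vseq" where
  "trunc q l x = (\<lambda>j. if q < j \<and> j \<le> l then x j else 0)"

lemma trunc_box: "x \<in> V \<Longrightarrow> trunc q l x \<in> box q l"
  by (auto simp: trunc_def box_def vil_digit zero_digit)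

text \<open>A point of \<open>U q\<close> lies in the cylinder of exactly one box element, its
  truncation. The value type is general so that the identity serves \<open>ennreal\<close> measures
  as well as complex integrals.\<close>

lemma indicator_U_sum:
  assumes "q \<le> l" "x \<in> V"
  shows "indicator (U q) x = (\<Sum>a\<in>box q l. indicator (cyl l a) x :: 'b::comm_semiring_1)"
proof (cases "x \<in> U q")
  case True
  have eq: "x \<in> cyl l a \<longleftrightarrow> a = trunc q l x" if "a \<in> box q l" for a
    using that True assms by (auto simp: cyl_def trunc_def box_def vU_def fun_eq_iff) (metis linorder_not_le)+
  have "(\<Sum>a\<in>box q l. indicator (cyl l a) x :: 'b) = (\<Sum>a\<in>box q l. if a = trunc q l x then 1 else 0)"
    by (intro sum.cong) (auto simp: eq indicator_def)
  also have "\<dots> = 1"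
    using trunc_box[OF assms(2)] by (simp add: finite_box)
  finally show ?thesis
    using True by simp
next
  case False
  then have "x \<notin> cyl l a" if "a \<in> box q l" for a
    using that assms unfolding cyl_def box_def vU_def
    by (smt (verit, best) mem_Collect_eq)
  with False show ?thesis
    by (simp add: indicator_def sum.neutral)
qed

end

section \<open>Characters\<close>

definition pairing :: "int ^ 'd ^ 'd::finite \<Rightarrow> int ^ 'd \<Rightarrow> int ^ 'd \<Rightarrow> real" where
  "pairing M y d = (matrix_inv (real_mat M) *v real_vec y) \<bullet> real_vec d"

text \<open>The factor contributed to \<open>vchar\<close> by one pair of coordinates. For
  nonsingular \<open>M\<close> it descends to the perfect pairing between the residue classes modulo
  \<open>M\<close> and those modulo its transpose.\<close>

definition kern :: "int ^ 'd ^ 'd::finite \<Rightarrow> int ^ 'd \<Rightarrow> int ^ 'd \<Rightarrow> complex" where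
  "kern M y d = exp (2 * complex_of_real pi * \<i> * complex_of_real (pairing M y d))"

lemma vchar_altdef:
  "vchar M x \<omega> = exp (2 * complex_of_real pi * \<i> *
     complex_of_real (\<Sum>\<^sub>\<infinity>j. pairing M (x j) (\<omega> (1 - j))))"
  by (simp add: vchar_def pairing_def real_mat_def real_vec_def)

lemma norm_vchar [simp]: "norm (vchar M x \<omega>) = 1"
  by (simp add: vchar_altdef)

lemma norm_kern [simp]: "norm (kern M y d) = 1"
  by (simp add: kern_def)

lemma pairing_0 [simp]: "pairing M 0 d = 0" "pairing M y 0 = 0"
  by (simp_all add: pairing_def)

lemma pairing_add_left: "pairing M (y + z) d = pairing M y d + pairing M z d"
  by (simp add: pairing_def matrix_vector_right_distrib inner_add_left)

lemma pairing_add_right: "pairing M y (c + d) = pairing M y c + pairing M y d"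
  by (simp add: pairing_def inner_add_right)

lemma inner_real_vec: "real_vec u \<bullet> real_vec v = real_of_int (\<Sum>i\<in>UNIV. u $ i * v $ i)"
  by (simp add: inner_vec_def)

lemma matrix_inv_cancel:
  fixes A :: "real ^ 'n ^ 'n"
  assumes "det A \<noteq> 0"
  shows "A *v (matrix_inv A *v v) = v" "matrix_inv A *v (A *v v) = v"
proof -
  have "\<exists>B. A ** B = mat 1 \<and> B ** A = mat 1"
    using assms invertible_det_nz[of A] by (simp add: invertible_def)
  then have "A ** matrix_inv A = mat 1 \<and> matrix_inv A ** A = mat 1"
    unfolding matrix_inv_def by (rule someI_ex)
  then show "A *v (matrix_inv A *v v) = v" "matrix_inv A *v (A *v v) = v"
    by (simp_all add: matrix_vector_mul_assoc)
qed

lemma real_mat_transpose: "real_mat (transpose M) = transpose (real_mat M)"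
  by (simp add: real_mat_def transpose_def vec_eq_iff)

lemma inner_transpose: "(transpose A *v v) \<bullet> u = v \<bullet> (A *v u)" for A :: "real ^ 'n ^ 'm"
  by (simp add: dot_lmul_matrix transpose_matrix_vector)

lemma kern_0 [simp]: "kern M 0 d = 1" "kern M y 0 = 1"
  by (simp_all add: kern_def)

lemma kern_add_left: "kern M (y + z) d = kern M y d * kern M z d"
  by (simp add: kern_def pairing_add_left ring_distribs exp_add)

lemma kern_add_right: "kern M y (c + d) = kern M y c * kern M y d"
  by (simp add: kern_def pairing_add_right ring_distribs exp_add)

lemma kern_nonzero [simp]: "kern M y d \<noteq> 0"
  by (simp add: kern_def)

lemma kern_eq_1_iff: "kern M y d = 1 \<longleftrightarrow> pairing M y d \<in> \<int>"
proof -
  have "kern M y d = 1 \<longleftrightarrow> (\<exists>k::int. pairing M y d = k)"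
    by (simp add: kern_def exp_eq_1)
  then show ?thesis
    by (auto elim: Ints_cases)
qed

text \<open>\<open>J\<close> may contain indices that contribute nothing, so several characters can
  be expanded over one common \<open>J\<close>.\<close>

lemma vchar_eq_prod:
  assumes J: "finite J" and supp: "\<And>j. j \<notin> J \<Longrightarrow> x j = 0 \<or> \<omega> (1 - j) = 0"
  shows "vchar M x \<omega> = (\<Prod>j\<in>J. kern M (x j) (\<omega> (1 - j)))"
proof -
  have "(\<Sum>\<^sub>\<infinity>j. pairing M (x j) (\<omega> (1 - j))) = (\<Sum>\<^sub>\<infinity>j\<in>J. pairing M (x j) (\<omega> (1 - j)))"
    using supp by (intro infsum_cong_neutral) force+
  also have "\<dots> = (\<Sum>j\<in>J. pairing M (x j) (\<omega> (1 - j)))"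
    using J by simp
  finally show ?thesis
    using J by (simp add: vchar_altdef kern_def exp_sum sum_distrib_left)
qed

text \<open>Arguments may differ wherever both terms vanish; this absorbs truncations and changes of
  coordinates that a character does not see.\<close>

lemma vchar_cong:
  assumes "\<And>j. x j = x' j \<and> \<omega> (1 - j) = \<omega>' (1 - j) \<or>
    (x j = 0 \<or> \<omega> (1 - j) = 0) \<and> (x' j = 0 \<or> \<omega>' (1 - j) = 0)"
  shows "vchar M x \<omega> = vchar M x' \<omega>'"
proof -
  have "pairing M (x j) (\<omega> (1 - j)) = pairing M (x' j) (\<omega>' (1 - j))" for j
    using assms[of j] by auto
  then show ?thesis
    by (simp add: vchar_altdef)
qed

text \<open>Coordinates are coupled when their indices add up to 1; shifting either argument turns
  this sum into 2.\<close>

lemma vchar_shift: "vchar M (vshift 1 x) \<omega> = vchar M x (vshift 1 \<omega>)"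
proof -
  have bij: "bij (\<lambda>j::int. j + 1)"
    by (rule bij_plus_right)
  have "(\<Sum>\<^sub>\<infinity>j. pairing M (x (j + 1)) (\<omega> (1 - j))) = (\<Sum>\<^sub>\<infinity>j. pairing M (x j) (\<omega> (2 - j)))"
    using infsum_reindex_bij_betw[OF bij, of "\<lambda>j. pairing M (x j) (\<omega> (2 - j))"] by simp
  then show ?thesis
    by (simp add: vchar_altdef vshift_def algebra_simps)
qed

text \<open>\<open>N\<close> is a parameter with an equation, not the term
  \<open>transpose M\<close>, so that the two groups can exchange roles.\<close>

locale dual_digits = A: digit_system M s + B: digit_system N s'
  for M N :: "int ^ 'd ^ 'd::finite" and s s' :: "nat \<Rightarrow> int ^ 'd" +
  assumes dual: "N = transpose M"
begin

lemma dual_sym: "dual_digits N M s' s"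
  by unfold_locales (simp add: dual transpose_transpose)

lemma mdet_dual: "mdet N = mdet M"
  by (simp add: mdet_def dual)

lemma real_det_nonzero: "det (real_mat M) \<noteq> 0" "det (real_mat N) \<noteq> 0"
  using A.det_nonzero B.det_nonzero by (simp_all add: det_real_mat)

lemma pairing_swap: "pairing N d y = pairing M y d"
proof -
  let ?w = "matrix_inv (real_mat N) *v real_vec d" and ?u = "matrix_inv (real_mat M) *v real_vec y"
  have "?w \<bullet> real_vec y = ?w \<bullet> (real_mat M *v ?u)"
    using real_det_nonzero by (simp add: matrix_inv_cancel)
  also have "\<dots> = (real_mat N *v ?w) \<bullet> ?u"
    by (simp only: dual real_mat_transpose inner_transpose)
  also have "\<dots> = ?u \<bullet> real_vec d"
    using real_det_nonzero by (simp add: matrix_inv_cancel inner_commute)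
  finally show ?thesis
    by (simp add: pairing_def)
qed

lemma vchar_swap: "vchar N \<omega> x = vchar M x \<omega>"
proof -
  have bij: "bij (\<lambda>j::int. 1 - j)"
    by (intro bij_betw_byWitness[where f' = "\<lambda>j. 1 - j"]) auto
  have "(\<Sum>\<^sub>\<infinity>j. pairing N (\<omega> j) (x (1 - j))) = (\<Sum>\<^sub>\<infinity>j. pairing M (x j) (\<omega> (1 - j)))"
    using infsum_reindex_bij_betw[OF bij, of "\<lambda>j. pairing M (x j) (\<omega> (1 - j))"]
    by (simp add: pairing_swap)
  then show ?thesis
    by (simp add: vchar_altdef)
qed

lemma kern_swap: "kern N d y = kern M y d"
  by (simp add: kern_def pairing_swap)

text \<open>The inverse matrix maps \<open>M *v t\<close> back to the integer vector
  \<open>t\<close>, so the pairing with an integer vector is an integer.\<close>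

lemma kern_cong_left:
  assumes "vcong M y z"
  shows "kern M y d = kern M z d"
proof -
  obtain t where "y = z + M *v t"
    using assms by (auto simp: vcong_def algebra_simps)
  moreover have "kern M (M *v t) d = 1"
    unfolding kern_eq_1_iff pairing_def real_vec_mult
      matrix_inv_cancel(2)[OF real_det_nonzero(1)] inner_real_vec by (rule Ints_of_int)
  ultimately show ?thesis
    by (simp add: kern_add_left)
qed

lemma kern_cong_right: "vcong N c d \<Longrightarrow> kern M y c = kern M y d"
  using dual_digits.kern_cong_left[OF dual_sym] by (simp add: kern_swap)

text \<open>If all integer vectors paired integrally with \<open>y - z\<close>, testing on
  coordinate vectors would show that the inverse matrix maps \<open>y - z\<close> to an integer
  vector, which is congruence.\<close>

lemma kern_nontrivial:
  assumes "\<not> vcong M y z"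
  shows "\<exists>d. kern M y d \<noteq> kern M z d"
proof (rule ccontr)
  assume triv: "\<not> (\<exists>d. kern M y d \<noteq> kern M z d)"
  have "kern M (y - z) d = 1" for d
    using triv kern_add_left[of M "y - z" z d] by simp
  then have int: "pairing M (y - z) d \<in> \<int>" for d
    by (simp add: kern_eq_1_iff)
  define u where "u = matrix_inv (real_mat M) *v real_vec (y - z)"
  have "u $ i \<in> \<int>" for i
  proof -
    have "real_vec (axis i 1) = axis i 1"
      by (simp add: vec_eq_iff axis_def)
    then show ?thesis
      using int[of "axis i 1"] by (simp add: pairing_def u_def inner_axis)
  qed
  then have "u = real_vec (\<chi> i. \<lfloor>u $ i\<rfloor>)"
    by (simp add: vec_eq_iff)
  then have "real_vec (y - z) = real_vec (M *v (\<chi> i. \<lfloor>u $ i\<rfloor>))"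
    using real_det_nonzero by (metis matrix_inv_cancel(1) real_vec_mult u_def)
  then have "vcong M y z"
    unfolding real_vec_inject vcong_def by blast
  with assms show False ..
qed

text \<open>Translating the summation variable by a digit on which the two characters differ
  multiplies the sum by a number other than \<open>1\<close>.\<close>

lemma sum_digits_kern:
  assumes "y \<in> A.D" "z \<in> A.D"
  shows "(\<Sum>d\<in>B.D. kern M y d * cnj (kern M z d)) = (if y = z then of_nat (mdet M) else 0)"
proof (cases "y = z")
  case True
  then show ?thesis
    by (simp add: complex_norm_square[symmetric] B.card_digits mdet_dual)
next
  case False
  then have "\<not> vcong M y z"
    using assms A.digit_unique by blast
  then obtain c where c: "kern M y c \<noteq> kern M z c"
    using kern_nontrivial by blast
  define S where "S = (\<Sum>d\<in>B.D. kern M y d * cnj (kern M z d))"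
  have bij: "bij_betw (\<lambda>d. B.rep (d + c)) B.D B.D"
  proof (rule bij_betw_byWitness[where f' = "\<lambda>d. B.rep (d - c)"])
    show "\<forall>d\<in>B.D. B.rep (B.rep (d + c) - c) = d"
      using B.rep_add_right[of "- c"] by (simp add: algebra_simps)
    show "\<forall>d\<in>B.D. B.rep (B.rep (d - c) + c) = d"
      using B.rep_add_right[of c] by (simp add: algebra_simps)
  qed (auto simp: B.rep)
  have kern_rep: "kern M x (B.rep d) = kern M x d" for x d
    by (rule kern_cong_right[OF B.rep(2)])
  have "S = (\<Sum>d\<in>B.D. kern M y (B.rep (d + c)) * cnj (kern M z (B.rep (d + c))))"
    unfolding S_def by (rule sum.reindex_bij_betw[OF bij, symmetric])
  also have "\<dots> = (kern M y c * cnj (kern M z c)) * S"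
    by (simp add: kern_rep kern_add_right S_def sum_distrib_left mult_ac)
  finally have "S = 0 \<or> kern M y c * cnj (kern M z c) = 1"
    by auto
  moreover have "cnj (kern M z c) = inverse (kern M z c)"
    using complex_norm_square[of "kern M z c"] by (simp add: field_simps)
  ultimately show ?thesis
    using c False by (auto simp: S_def field_simps)
qed

text \<open>Index \<open>l + 1\<close> is coupled with index \<open>1 - (l + 1) = - l\<close>, so
  the new coordinate brings one factor.\<close>

lemma vchar_update:
  assumes "q \<le> l" "a \<in> B.box q l"
  shows "vchar M x (a(l + 1 := d)) = vchar M x a * kern M (x (- l)) d"
proof -
  let ?J = "insert (- l) {- l + 1..- q}"
  have a0: "a i = 0" if "i \<le> q \<or> l < i" for i
    using assms that by (auto simp: B.box_def)
  have "vchar M x (a(l + 1 := d)) = (\<Prod>j\<in>?J. kern M (x j) ((a(l + 1 := d)) (1 - j)))"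
    by (rule vchar_eq_prod) (auto intro!: a0)
  also have "\<dots> = kern M (x (- l)) d * (\<Prod>j\<in>{- l + 1..- q}. kern M (x j) (a (1 - j)))"
    by (subst prod.insert) (auto intro!: prod.cong arg_cong2[of _ _ _ _ "(*)"])
  also have "(\<Prod>j\<in>{- l + 1..- q}. kern M (x j) (a (1 - j))) = vchar M x a"
    by (rule vchar_eq_prod[symmetric]) (auto intro!: a0)
  finally show ?thesis
    by (simp add: mult.commute del: fun_upd_apply)
qed

text \<open>Summing over the top coordinate splits off the factor from
  \<open>sum_digits_kern\<close>. The box sees only the coordinates of \<open>x\<close> and
  \<open>y\<close> with indices from \<open>1 - l\<close> to \<open>- q\<close>.\<close>

lemma sum_box_vchar:
  assumes "q \<le> l" "\<And>j. x j \<in> A.D" "\<And>j. y j \<in> A.D"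
  shows "(\<Sum>a\<in>B.box q l. vchar M x a * cnj (vchar M y a)) =
    (if \<forall>j. q < j \<and> j \<le> l \<longrightarrow> x (1 - j) = y (1 - j) then of_nat (mdet M) ^ nat (l - q) else 0)"
  using assms(1)
proof (induction l rule: int_ge_induct)
  case base
  have "vchar M x (\<lambda>_. 0) = 1" for x
    using vchar_eq_prod[of "{}" x "\<lambda>_. 0"] by simp
  then show ?case
    by (simp add: B.box_self)
next
  case (step l)
  have if_mult: "(if P then a else 0) * (if Q then b else 0) = (if P \<and> Q then b * a else 0)"
    for P Q and a b :: complex
    by simp
  let ?P = "\<forall>j. q < j \<and> j \<le> l \<longrightarrow> x (1 - j) = y (1 - j)"
  have "(\<Sum>a\<in>B.box q (l + 1). vchar M x a * cnj (vchar M y a)) =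
      (\<Sum>a\<in>B.box q l. vchar M x a * cnj (vchar M y a) *
        (\<Sum>d\<in>B.D. kern M (x (- l)) d * cnj (kern M (y (- l)) d)))"
    unfolding B.sum_box_Suc[OF step.hyps]
    by (intro sum.cong) (simp_all add: vchar_update[OF step.hyps] sum_distrib_left mult_ac)
  also have "\<dots> = (if ?P then of_nat (mdet M) ^ nat (l - q) else 0) *
      (if x (- l) = y (- l) then of_nat (mdet M) else 0)"
    using assms by (simp add: sum_digits_kern step.IH flip: sum_distrib_right)
  also have "\<dots> = (if ?P \<and> x (- l) = y (- l) then of_nat (mdet M) ^ Suc (nat (l - q)) else 0)"
    by (simp only: if_mult power_Suc)
  also have "?P \<and> x (- l) = y (- l) \<longleftrightarrow>
      (\<forall>j. q < j \<and> j \<le> l + 1 \<longrightarrow> x (1 - j) = y (1 - j))"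
    (is "_ \<longleftrightarrow> ?R")
  proof
    assume *: "?P \<and> x (- l) = y (- l)"
    show ?R
    proof (intro allI impI)
      fix j assume "q < j \<and> j \<le> l + 1"
      with * show "x (1 - j) = y (1 - j)"
        by (cases "j = l + 1") auto
    qed
  next
    assume *: ?R
    have "x (1 - (l + 1)) = y (1 - (l + 1))"
      using *[rule_format, of "l + 1"] step.hyps by simp
    with * show "?P \<and> x (- l) = y (- l)"
      by auto
  qed
  also have "Suc (nat (l - q)) = nat (l + 1 - q)"
    using step.hyps by simp
  finally show ?case .
qed

lemma vchar_add_left:
  assumes "x \<in> A.V" "y \<in> A.V" "\<omega> \<in> B.V"
  shows "vchar M (vadd M s x y) \<omega> = vchar M x \<omega> * vchar M y \<omega>"
proof -
  obtain p q r where zero: "\<And>j. j \<le> p \<Longrightarrow> x j = 0" "\<And>j. j \<le> q \<Longrightarrow> y j = 0"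
      "\<And>j. j \<le> r \<Longrightarrow> \<omega> j = 0"
    using assms by (auto simp: A.vil_iff B.vil_iff)
  define k where "k = min p q"
  have k: "x j = 0" "y j = 0" "vadd M s x y j = 0" if "j \<le> k" for j
    using zero that by (simp_all add: k_def A.vadd_nth A.zero_digit)
  have "kern M (vadd M s x y j) d = kern M (x j) d * kern M (y j) d" for j d
    using kern_cong_left[OF A.rep(2)] by (simp add: A.vadd_nth kern_add_left)
  moreover have "vchar M z \<omega> = (\<Prod>j\<in>{k..1 - r}. kern M (z j) (\<omega> (1 - j)))"
    if "\<And>j. j \<le> k \<Longrightarrow> z j = 0" for z
    by (rule vchar_eq_prod) (auto intro: that zero)
  ultimately show ?thesis
    using k by (simp add: prod.distrib)
qed

end

section \<open>Haar measure and Fourier transform\<close>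

text \<open>Cauchy-Schwarz against the indicator of \<open>A\<close> bounds the squared integral by
  \<open>emeasure M A\<close> times the squared L2 norm.\<close>

lemma norm_integral_tendsto_0:
  fixes f :: "nat \<Rightarrow> 'a \<Rightarrow> complex"
  assumes A: "A \<in> sets M" "emeasure M A < \<infinity>"
    and meas: "\<And>i. f i \<in> borel_measurable M"
    and lim: "(\<lambda>i. \<integral>\<^sup>+x. ennreal ((norm (f i x))\<^sup>2) \<partial>M) \<longlonglongrightarrow> 0"
    and bound: "\<And>i x. x \<in> space M \<Longrightarrow> norm (g i x) \<le> indicator A x * norm (f i x)"
    and int: "\<And>i. integrable M (g i)"
  shows "(\<lambda>i. \<integral>x. g i x \<partial>M) \<longlonglongrightarrow> (0 :: complex)"
proof -
  have le: "ennreal ((norm (\<integral>x. g i x \<partial>M))\<^sup>2) \<le> emeasure M A * (\<integral>\<^sup>+x. ennreal ((norm (f i x))\<^sup>2) \<partial>M)" for i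
  proof -
    have "ennreal (norm (\<integral>x. g i x \<partial>M)) \<le> (\<integral>\<^sup>+x. norm (g i x) \<partial>M)"
      by (rule integral_norm_bound_ennreal[OF int])
    also have "\<dots> \<le> (\<integral>\<^sup>+x. indicator A x * ennreal (norm (f i x)) \<partial>M)"
      using bound by (intro nn_integral_mono) (fastforce simp: indicator_def split: if_splits)
    finally have "(ennreal (norm (\<integral>x. g i x \<partial>M)))\<^sup>2 \<le> (\<integral>\<^sup>+x. indicator A x * ennreal (norm (f i x)) \<partial>M)\<^sup>2"
      by (rule power_mono) simp
    also have "\<dots> \<le> (\<integral>\<^sup>+x. (indicator A x)\<^sup>2 \<partial>M) * (\<integral>\<^sup>+x. (ennreal (norm (f i x)))\<^sup>2 \<partial>M)"
      using A meas by (intro Cauchy_Schwarz_nn_integral) auto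
    also have "(\<integral>\<^sup>+x. (indicator A x)\<^sup>2 \<partial>M) = emeasure M A"
    proof -
      have "(\<integral>\<^sup>+x. (indicator A x)\<^sup>2 \<partial>M) = (\<integral>\<^sup>+x. indicator A x \<partial>M)"
        by (intro nn_integral_cong) (simp split: split_indicator)
      then show ?thesis
        using A by simp
    qed
    finally show ?thesis
      by (simp add: ennreal_power)
  qed
  have "(\<lambda>i. emeasure M A * (\<integral>\<^sup>+x. ennreal ((norm (f i x))\<^sup>2) \<partial>M)) \<longlonglongrightarrow> emeasure M A * 0"
    using A by (intro ennreal_tendsto_cmult lim) simp
  then have upper: "(\<lambda>i. emeasure M A * (\<integral>\<^sup>+x. ennreal ((norm (f i x))\<^sup>2) \<partial>M)) \<longlonglongrightarrow> 0"
    by simp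
  have "(\<lambda>i. ennreal ((norm (\<integral>x. g i x \<partial>M))\<^sup>2)) \<longlonglongrightarrow> 0"
    by (rule tendsto_sandwich[OF _ _ tendsto_const upper]) (simp_all add: le)
  then have "(\<lambda>i. (norm (\<integral>x. g i x \<partial>M))\<^sup>2) \<longlonglongrightarrow> 0"
    by (simp add: tendsto_ennreal_iff[where x = 0, simplified] flip: ennreal_0)
  then have "(\<lambda>i. sqrt ((norm (\<integral>x. g i x \<partial>M))\<^sup>2)) \<longlonglongrightarrow> sqrt 0"
    by (rule tendsto_real_sqrt)
  then show ?thesis
    by (simp add: tendsto_norm_zero_iff)
qed

lemma borel_measurable_cnj [measurable (raw)]:
  "f \<in> borel_measurable M \<Longrightarrow> (\<lambda>x. cnj (f x)) \<in> borel_measurable M"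
  by (rule borel_measurable_continuous_on[OF continuous_on_cnj[OF continuous_on_id]])

lemma integrable_indicator_times:
  fixes f :: "'a \<Rightarrow> complex"
  assumes "A \<in> sets M" "integrable M f"
  shows "integrable M (\<lambda>x. indicator A x * f x)"
proof -
  have "indicator A x * f x = indicator A x *\<^sub>R f x" for x
    by (simp add: indicator_def)
  then show ?thesis
    using integrable_mult_indicator[OF assms] by simp
qed

section \<open>Cylinders as open sets and their measure\<close>

context digit_system
begin

lemma card_box: "q \<le> l \<Longrightarrow> card (box q l) = m ^ nat (l - q)"
proof (induction l rule: int_ge_induct)
  case base
  then show ?case
    by (simp add: box_self)
next
  case (step l)
  have "card (box q (l + 1)) = card (box q l) * m"
    using bij_betw_same_card[OF bij_box_Suc[OF step.hyps]]
    by (simp add: card_cartesian_product card_digits)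
  moreover have "nat (l + 1 - q) = Suc (nat (l - q))"
    using step.hyps by simp
  ultimately show ?case
    by (simp add: step.IH)
qed

lemma cyl_self: "x \<in> V \<Longrightarrow> x \<in> cyl l x"
  by (simp add: cyl_def)

lemma cyl_eq: "y \<in> cyl l x \<Longrightarrow> cyl l y = cyl l x"
  by (auto simp: cyl_def)

lemma cyl_trunc:
  assumes "x \<in> U q"
  shows "cyl l (trunc q l x) = cyl l x"
  using assms by (auto simp: cyl_def trunc_def vU_def)

lemma V_eq_UN: "V = (\<Union>k::nat. U (- int k))"
proof safe
  fix x assume x: "x \<in> V"
  then obtain N where N: "\<And>j. j \<le> N \<Longrightarrow> x j = 0"
    by (auto simp: vil_iff)
  have "x \<in> U (- int (nat (- N)))"
    using x N by (simp add: vU_def)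
  then show "x \<in> (\<Union>k::nat. U (- int k))"
    by blast
qed (auto simp: vU_def)

lemma vopen_iff: "vopen M s G \<longleftrightarrow> G \<subseteq> V \<and> (\<forall>x\<in>G. \<exists>l. cyl l x \<subseteq> G)"
  unfolding vopen_def using coset_eq_cyl by blast

lemma vopen_cyl: "vopen M s (cyl l x)"
  unfolding vopen_iff using cyl_subset cyl_eq by blast

end

locale haar = digit_system M s for M :: "int ^ 'd ^ 'd::finite" and s +
  fixes \<mu> :: "'d vseq measure"
  assumes haar: "normalized_haar M s \<mu>"
begin

lemma space_haar: "space \<mu> = V"
  using haar by (simp add: normalized_haar_def)

lemma sets_haar: "sets \<mu> = sigma_sets V {G. vopen M s G}"
  using haar by (simp add: normalized_haar_def openin_vtop)

lemma vopen_sets: "vopen M s G \<Longrightarrow> G \<in> sets \<mu>"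
  by (auto simp: sets_haar)

lemma cyl_sets [measurable]: "cyl l x \<in> sets \<mu>"
  by (rule vopen_sets[OF vopen_cyl])

lemma U_sets [measurable]: "U l \<in> sets \<mu>"
  by (simp add: U_eq_cyl cyl_sets)

text \<open>The preimage of any set whatever is a union of cylinders, hence open.\<close>

lemma measurable_locally_constant:
  fixes f :: "'d vseq \<Rightarrow> 'b::topological_space"
  assumes "\<And>x. x \<in> V \<Longrightarrow> \<exists>l. \<forall>y\<in>cyl l x. f y = f x"
  shows "f \<in> measurable \<mu> borel"
proof (rule measurableI)
  fix S :: "'b set"
  have "vopen M s (f -` S \<inter> V)"
    unfolding vopen_iff
  proof (intro conjI ballI)
    fix x assume x: "x \<in> f -` S \<inter> V"
    then obtain l where "\<forall>y\<in>cyl l x. f y = f x"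
      using assms by blast
    with x have "cyl l x \<subseteq> f -` S \<inter> V"
      using cyl_subset by auto
    then show "\<exists>l. cyl l x \<subseteq> f -` S \<inter> V" ..
  qed simp
  then show "f -` S \<inter> space \<mu> \<in> sets \<mu>"
    by (simp add: space_haar vopen_sets)
qed simp

lemma emeasure_cyl_U:
  assumes "x \<in> V"
  shows "emeasure \<mu> (cyl l x) = emeasure \<mu> (U l)"
  using haar assms U_sets unfolding normalized_haar_def coset_eq_cyl[OF assms, symmetric] by blast

lemma emeasure_U_refine:
  assumes "q \<le> l"
  shows "emeasure \<mu> (U q) = of_nat (m ^ nat (l - q)) * emeasure \<mu> (U l)"
proof -
  have "emeasure \<mu> (U q) = (\<integral>\<^sup>+x. indicator (U q) x \<partial>\<mu>)"
    by simp
  also have "\<dots> = (\<integral>\<^sup>+x. (\<Sum>a\<in>box q l. indicator (cyl l a) x) \<partial>\<mu>)"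
    using assms by (intro nn_integral_cong indicator_U_sum) (auto simp: space_haar)
  also have "\<dots> = (\<Sum>a\<in>box q l. emeasure \<mu> (cyl l a))"
    by (simp add: nn_integral_sum)
  also have "\<dots> = (\<Sum>a\<in>box q l. emeasure \<mu> (U l))"
    using box_subset by (intro sum.cong emeasure_cyl_U) auto
  finally show ?thesis
    by (simp add: card_box assms)
qed

text \<open>Refinement between level \<open>l\<close> and level 0 reduces the value to the
  normalization; for \<open>l \<ge> 0\<close> it is recovered by cancelling a finite nonzero
  factor.\<close>

lemma emeasure_U: "emeasure \<mu> (U l) = ennreal (of_nat m powi (- l))"
proof (cases "0 \<le> l")
  case True
  have one: "emeasure \<mu> (U 0) = 1"
    using haar by (simp add: normalized_haar_def)
  have "of_nat (m ^ nat l) * emeasure \<mu> (U l) = 1"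
    using emeasure_U_refine[OF True] one by simp
  moreover have "of_nat (m ^ nat l) * ennreal (of_nat m powi (- l)) = 1"
  proof -
    have "of_nat (m ^ nat l) = ennreal (of_nat m powi l)"
      using True by (simp add: power_int_def ennreal_of_nat_eq_real_of_nat)
    then show ?thesis
      using m_pos by (simp add: ennreal_mult[symmetric] power_int_minus)
  qed
  moreover have "of_nat (m ^ nat l) \<noteq> (0::ennreal)" "of_nat (m ^ nat l) \<noteq> (top::ennreal)"
    using m_pos by (simp_all del: of_nat_power)
  ultimately show ?thesis
    by (metis ennreal_mult_cancel_left)
next
  case False
  have one: "emeasure \<mu> (U 0) = 1"
    using haar by (simp add: normalized_haar_def)
  have "emeasure \<mu> (U l) = of_nat (m ^ nat (- l))"
    using emeasure_U_refine[of l 0] False one by simp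
  also have "\<dots> = ennreal (of_nat m powi (- l))"
    using False by (simp add: power_int_def ennreal_of_nat_eq_real_of_nat)
  finally show ?thesis .
qed

lemma emeasure_cyl: "x \<in> V \<Longrightarrow> emeasure \<mu> (cyl l x) = ennreal (of_nat m powi (- l))"
  by (simp add: emeasure_cyl_U emeasure_U)

lemma measure_cyl: "x \<in> V \<Longrightarrow> measure \<mu> (cyl l x) = of_nat m powi (- l)"
  by (simp add: measure_def emeasure_cyl)

lemma sigma_finite_haar: "sigma_finite_measure \<mu>"
proof
  show "\<exists>A. countable A \<and> A \<subseteq> sets \<mu> \<and> \<Union> A = space \<mu> \<and> (\<forall>a\<in>A. emeasure \<mu> a \<noteq> \<infinity>)"
    by (rule exI[of _ "range (\<lambda>k::nat. U (- int k))"])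
       (auto simp: space_haar V_eq_UN[symmetric] emeasure_U)
qed

text \<open>On \<open>U q\<close> the function is simple, with one value per cylinder of level
  \<open>l\<close>. The form \<open>has_bochner_integral\<close> gives integrability together with
  the value.\<close>

lemma has_bochner_integral_step:
  fixes f :: "'d vseq \<Rightarrow> complex"
  assumes "q \<le> l" and const: "\<And>x a. a \<in> box q l \<Longrightarrow> x \<in> cyl l a \<Longrightarrow> f x = f a"
  shows "has_bochner_integral \<mu> (\<lambda>x. indicator (U q) x * f x)
    (of_real (of_nat m powi (- l)) * (\<Sum>a\<in>box q l. f a))"
proof -
  have eq: "indicator (U q) x * f x = (\<Sum>a\<in>box q l. indicator (cyl l a) x *\<^sub>R f a)" if "x \<in> space \<mu>" for x
  proof -
    have "indicator (U q) x * f x = (\<Sum>a\<in>box q l. indicator (cyl l a) x * f x)"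
      using that assms(1) by (simp add: indicator_U_sum[OF assms(1), of x] space_haar sum_distrib_right)
    also have "\<dots> = (\<Sum>a\<in>box q l. indicator (cyl l a) x *\<^sub>R f a)"
      by (intro sum.cong) (auto simp: indicator_def const)
    finally show ?thesis .
  qed
  have "has_bochner_integral \<mu> (\<lambda>x. \<Sum>a\<in>box q l. indicator (cyl l a) x *\<^sub>R f a)
      (\<Sum>a\<in>box q l. measure \<mu> (cyl l a) *\<^sub>R f a)"
    by (intro has_bochner_integral_sum has_bochner_integral_indicator)
      (auto simp: emeasure_cyl[OF subsetD[OF box_subset]])
  also have "(\<Sum>a\<in>box q l. measure \<mu> (cyl l a) *\<^sub>R f a) = of_real (of_nat m powi (- l)) * (\<Sum>a\<in>box q l. f a)"
    unfolding sum_distrib_left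
    by (intro sum.cong) (auto simp: measure_cyl[OF subsetD[OF box_subset]] scaleR_conv_of_real)
  finally show ?thesis
    using eq by (subst has_bochner_integral_cong) auto
qed

lemma integral_U_refine:
  fixes F :: "'d vseq \<Rightarrow> complex"
  assumes "q \<le> l" and int: "integrable \<mu> F"
  shows "(\<integral>x. indicator (U q) x * F x \<partial>\<mu>) = (\<Sum>a\<in>box q l. \<integral>x. indicator (cyl l a) x * F x \<partial>\<mu>)"
proof -
  have "(\<integral>x. indicator (U q) x * F x \<partial>\<mu>) = (\<integral>x. (\<Sum>a\<in>box q l. indicator (cyl l a) x * F x) \<partial>\<mu>)"
    using assms(1) by (intro Bochner_Integration.integral_cong)
      (auto simp: indicator_U_sum[OF assms(1)] space_haar sum_distrib_right)
  also have "\<dots> = (\<Sum>a\<in>box q l. \<integral>x. indicator (cyl l a) x * F x \<partial>\<mu>)"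
    by (intro Bochner_Integration.integral_sum integrable_indicator_times int cyl_sets)
  finally show ?thesis .
qed

end


text \<open>Only one group carries a measure here, so that the results can be used for the other
  group by exchanging the roles.\<close>

locale half_haar = dual_digits M N s s' + A: haar M s \<mu>
  for M N :: "int ^ 'd ^ 'd::finite" and s s' \<mu>
begin

text \<open>A coordinate of \<open>x\<close> above \<open>l\<close> is coupled with an index of
  \<omega> not exceeding \<open>- l\<close>, where \<omega> vanishes.\<close>

lemma vchar_const_cyl:
  assumes "\<And>j. j \<le> - l \<Longrightarrow> \<omega> j = 0" "x \<in> A.cyl l a"
  shows "vchar M x \<omega> = vchar M a \<omega>"
proof (rule vchar_cong)
  fix j
  show "x j = a j \<and> \<omega> (1 - j) = \<omega> (1 - j) \<or>
      (x j = 0 \<or> \<omega> (1 - j) = 0) \<and> (a j = 0 \<or> \<omega> (1 - j) = 0)"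
    using assms by (cases "j \<le> l") (auto simp: A.cyl_def)
qed

lemma measurable_vchar:
  assumes "\<omega> \<in> B.V"
  shows "(\<lambda>x. vchar M x \<omega>) \<in> borel_measurable \<mu>"
proof (rule A.measurable_locally_constant)
  obtain N where "\<And>j. j \<le> N \<Longrightarrow> \<omega> j = 0"
    using assms by (auto simp: B.vil_iff)
  then show "\<exists>l. \<forall>y\<in>A.cyl l x. vchar M y \<omega> = vchar M x \<omega>" for x
    using vchar_const_cyl[of "- N" \<omega>] by (intro exI[of _ "- N"]) simp
qed

lemma has_bochner_integral_vchar:
  assumes \<omega>: "\<omega> \<in> B.V" "\<omega>' \<in> B.V"
  shows "has_bochner_integral \<mu> (\<lambda>x. indicator (A.U l) x * (vchar M x \<omega> * cnj (vchar M x \<omega>')))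
    (if \<forall>j\<le>- l. \<omega> j = \<omega>' j then of_real (of_nat A.m powi (- l)) else 0)"
proof -
  obtain N N' where N: "\<And>j. j \<le> N \<Longrightarrow> \<omega> j = 0" "\<And>j. j \<le> N' \<Longrightarrow> \<omega>' j = 0"
    using \<omega> by (auto simp: B.vil_iff)
  \<comment> \<open>At level \<open>L\<close> both characters are constant on cylinders, so the
    integral becomes a finite sum.\<close>
  define L where "L = max l (max (- N) (- N'))"
  have L: "l \<le> L" "\<And>j. j \<le> - L \<Longrightarrow> \<omega> j = 0" "\<And>j. j \<le> - L \<Longrightarrow> \<omega>' j = 0"
    by (auto simp: L_def intro!: N)
  have "has_bochner_integral \<mu> (\<lambda>x. indicator (A.U l) x * (vchar M x \<omega> * cnj (vchar M x \<omega>')))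
     (of_real (of_nat A.m powi (- L)) * (\<Sum>a\<in>A.box l L. vchar M a \<omega> * cnj (vchar M a \<omega>')))"
    using L by (intro A.has_bochner_integral_step) (simp_all add: vchar_const_cyl[where l = L])
  \<comment> \<open>Here the summation variable lies in the first group, so the orthogonality sum is
    used with the groups exchanged.\<close>
  also have "(\<Sum>a\<in>A.box l L. vchar M a \<omega> * cnj (vchar M a \<omega>')) =
      (if \<forall>j. l < j \<and> j \<le> L \<longrightarrow> \<omega> (1 - j) = \<omega>' (1 - j) then of_nat A.m ^ nat (L - l) else 0)"
    using dual_digits.sum_box_vchar[OF dual_sym L(1), of \<omega> \<omega>'] \<omega>
    by (simp add: vchar_swap mdet_dual B.vil_digit cong: if_cong)
  also have "(\<forall>j. l < j \<and> j \<le> L \<longrightarrow> \<omega> (1 - j) = \<omega>' (1 - j)) \<longleftrightarrow> (\<forall>j\<le>- l. \<omega> j = \<omega>' j)"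
  proof safe
    fix j assume *: "\<forall>j. l < j \<and> j \<le> L \<longrightarrow> \<omega> (1 - j) = \<omega>' (1 - j)" and "j \<le> - l"
    then show "\<omega> j = \<omega>' j"
      using L *[rule_format, of "1 - j"] by (cases "j \<le> - L") auto
  qed auto
  also have "of_real (of_nat A.m powi (- L)) * (if P then of_nat A.m ^ nat (L - l) else 0) =
      (if P then of_real (of_nat A.m powi (- l)) else (0 :: complex))" for P
  proof -
    have "(of_nat A.m :: real) powi (- L) * of_nat A.m ^ nat (L - l) = of_nat A.m powi (- L + (L - l))"
      using L(1) A.m_pos by (subst power_int_add) (auto simp: power_int_def)
    then have "complex_of_real (of_nat A.m powi (- L) * of_nat A.m ^ nat (L - l)) = of_real (of_nat A.m powi (- l))"
      by simp
    then show ?thesis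
      by simp
  qed
  finally show ?thesis .
qed

lemma integrable_times_vchar:
  assumes "integrable \<mu> F" "\<omega> \<in> B.V"
  shows "integrable \<mu> (\<lambda>x. F x * cnj (vchar M x \<omega>))"
proof (rule Bochner_Integration.integrable_bound[OF assms(1)])
  show "(\<lambda>x. F x * cnj (vchar M x \<omega>)) \<in> borel_measurable \<mu>"
    using assms by (intro borel_measurable_times borel_measurable_cnj measurable_vchar) auto
qed (simp add: norm_mult)

lemma norm_fourier_le:
  assumes "integrable \<mu> F" "\<omega> \<in> B.V"
  shows "norm (fourier M \<mu> F \<omega>) \<le> (\<integral>x. norm (F x) \<partial>\<mu>)"
  unfolding fourier_def
  using integral_norm_bound[of \<mu> "\<lambda>x. F x * cnj (vchar M x \<omega>)"] by (simp add: norm_mult)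

lemma fourier_diff:
  assumes "integrable \<mu> F" "integrable \<mu> G" "\<omega> \<in> B.V"
  shows "fourier M \<mu> (\<lambda>x. F x - G x) \<omega> = fourier M \<mu> F \<omega> - fourier M \<mu> G \<omega>"
  using assms by (simp add: fourier_def left_diff_distrib integrable_times_vchar)

text \<open>The character of such an \<omega> is constant on cylinders of level \<open>l\<close>, so
  the transform is a finite combination of characters whose coefficients are cylinder
  integrals.\<close>

lemma fourier_truncated:
  assumes F: "integrable \<mu> F" and "q \<le> l" "\<omega> \<in> B.U (- l)"
  shows "fourier M \<mu> (\<lambda>x. indicator (A.U q) x * F x) \<omega> =
    (\<Sum>a\<in>A.box q l. cnj (vchar M a \<omega>) * (\<integral>x. indicator (A.cyl l a) x * F x \<partial>\<mu>))"
proof -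
  have \<omega>: "\<omega> \<in> B.V" "\<And>j. j \<le> - l \<Longrightarrow> \<omega> j = 0"
    using assms(3) by (auto simp: vU_def)
  have "fourier M \<mu> (\<lambda>x. indicator (A.U q) x * F x) \<omega> =
      (\<integral>x. indicator (A.U q) x * (F x * cnj (vchar M x \<omega>)) \<partial>\<mu>)"
    by (simp add: fourier_def mult.assoc)
  also have "\<dots> = (\<Sum>a\<in>A.box q l. \<integral>x. indicator (A.cyl l a) x * (F x * cnj (vchar M x \<omega>)) \<partial>\<mu>)"
    by (rule A.integral_U_refine[OF assms(2) integrable_times_vchar[OF F \<omega>(1)]])
  also have "\<dots> = (\<Sum>a\<in>A.box q l. \<integral>x. cnj (vchar M a \<omega>) * (indicator (A.cyl l a) x * F x) \<partial>\<mu>)"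
    using vchar_const_cyl[OF \<omega>(2)]
    by (intro sum.cong Bochner_Integration.integral_cong) (auto simp: indicator_def)
  finally show ?thesis
    by simp
qed

lemma tendsto_integral_truncated:
  fixes F :: "'d vseq \<Rightarrow> complex"
  assumes "integrable \<mu> F"
  shows "(\<lambda>k. \<integral>x. indicator (A.U (- int k)) x * F x \<partial>\<mu>) \<longlonglongrightarrow> (\<integral>x. F x \<partial>\<mu>)"
proof (rule integral_dominated_convergence[where w = "\<lambda>x. norm (F x)"])
  show "AE x in \<mu>. (\<lambda>k. indicator (A.U (- int k)) x * F x) \<longlonglongrightarrow> F x"
  proof (rule AE_I2)
    fix x assume "x \<in> space \<mu>"
    then obtain K where K: "x \<in> A.U (- int K)"
      using A.V_eq_UN by (auto simp: A.space_haar)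
    have "indicator (A.U (- int k)) x * F x = F x" if "K \<le> k" for k
      using K vU_antimono[of "- int k" "- int K" M s] that by (auto simp: indicator_def)
    then show "(\<lambda>k. indicator (A.U (- int k)) x * F x) \<longlonglongrightarrow> F x"
      by (intro tendsto_eventually eventually_sequentiallyI[of K])
  qed
  show "AE x in \<mu>. norm (indicator (A.U (- int k)) x * F x) \<le> norm (F x)" for k
    by (simp add: indicator_def)
qed (use assms in auto)

lemma tendsto_fourier_truncated:
  assumes "integrable \<mu> F" "\<omega> \<in> B.V"
  shows "(\<lambda>k. fourier M \<mu> (\<lambda>x. indicator (A.U (- int k)) x * F x) \<omega>) \<longlonglongrightarrow> fourier M \<mu> F \<omega>"
  using tendsto_integral_truncated[OF integrable_times_vchar[OF assms]]
  by (simp add: fourier_def mult.assoc)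

end

locale dual_haar = half_haar M N s s' \<mu> + B: haar N s' \<mu>'
  for M N :: "int ^ 'd ^ 'd::finite" and s s' \<mu> \<mu>'
begin

lemma half_sym: "half_haar N M s' s \<mu>'"
  by (intro half_haar.intro dual_sym B.haar_axioms)

text \<open>Truncation in both variables leaves finite sums of characters; measurability survives
  the pointwise limits in \<open>k\<close> and in \<open>i\<close>.\<close>

lemma measurable_fourier:
  assumes F: "integrable \<mu> F"
  shows "fourier M \<mu> F \<in> borel_measurable \<mu>'"
proof -
  have step: "(\<lambda>\<omega>. indicator (B.U (- int i)) \<omega> *
      fourier M \<mu> (\<lambda>x. indicator (A.U (- int k)) x * F x) \<omega>) \<in> borel_measurable \<mu>'" for i k
  proof -
    have meas: "vchar M a \<in> borel_measurable \<mu>'" if "a \<in> A.V" for a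
      using half_haar.measurable_vchar[OF half_sym that] by (simp add: vchar_swap)
    have *: "indicator (B.U (- int i)) \<omega> * fourier M \<mu> (\<lambda>x. indicator (A.U (- int k)) x * F x) \<omega> =
        indicator (B.U (- int i)) \<omega> * (\<Sum>a\<in>A.box (- int k) (int i).
          cnj (vchar M a \<omega>) * (\<integral>x. indicator (A.cyl (int i) a) x * F x \<partial>\<mu>))" for \<omega>
      using fourier_truncated[OF F, of "- int k" "int i" \<omega>] by (simp add: indicator_def)
    show ?thesis
      unfolding * by (intro borel_measurable_times borel_measurable_sum borel_measurable_cnj
          borel_measurable_indicator B.U_sets borel_measurable_const) (auto intro: meas subsetD[OF A.box_subset])
  qed
  have "(\<lambda>\<omega>. indicator (B.U (- int i)) \<omega> * fourier M \<mu> F \<omega>) \<in> borel_measurable \<mu>'" for i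
    by (rule borel_measurable_LIMSEQ_metric[where
          f = "\<lambda>k \<omega>. indicator (B.U (- int i)) \<omega> * fourier M \<mu> (\<lambda>x. indicator (A.U (- int k)) x * F x) \<omega>"])
       (auto intro!: step tendsto_mult_left tendsto_fourier_truncated F simp: B.space_haar)
  moreover have "(\<lambda>i. indicator (B.U (- int i)) \<omega> * fourier M \<mu> F \<omega>) \<longlonglongrightarrow> fourier M \<mu> F \<omega>"
    if mem: "\<omega> \<in> space \<mu>'" for \<omega>
  proof -
    obtain K where K: "\<omega> \<in> B.U (- int K)"
      using mem B.V_eq_UN by (auto simp: B.space_haar)
    have "indicator (B.U (- int k)) \<omega> * fourier M \<mu> F \<omega> = fourier M \<mu> F \<omega>" if "K \<le> k" for k
      using K vU_antimono[of "- int k" "- int K" N s'] that by (auto simp: indicator_def)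
    then show ?thesis
      by (intro tendsto_eventually eventually_sequentiallyI[of K])
  qed
  ultimately show ?thesis
    by (rule borel_measurable_LIMSEQ_metric)
qed

text \<open>On \<open>B.U (- l)\<close> the characters of the box elements are orthogonal, so
  pairing with the character of \<open>y\<close> singles out the cylinder of
  \<open>y\<close>.\<close>

lemma fourier_inversion_truncated:
  assumes F: "integrable \<mu> F" and "q \<le> l" "y \<in> A.U q"
  shows "(\<integral>\<omega>. indicator (B.U (- l)) \<omega> *
      (fourier M \<mu> (\<lambda>x. indicator (A.U q) x * F x) \<omega> * vchar M y \<omega>) \<partial>\<mu>') =
    of_real (of_nat A.m powi l) * (\<integral>x. indicator (A.cyl l y) x * F x \<partial>\<mu>)"
proof -
  define c where "c a = (\<integral>x. indicator (A.cyl l a) x * F x \<partial>\<mu>)" for a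
  have y: "y \<in> A.V"
    using assms(3) by (simp add: vU_def)
  have int: "has_bochner_integral \<mu>' (\<lambda>\<omega>. indicator (B.U (- l)) \<omega> * (vchar M y \<omega> * cnj (vchar M a \<omega>)))
      (if \<forall>j\<le>l. y j = a j then of_real (of_nat A.m powi l) else 0)" if "a \<in> A.box q l" for a
    using half_haar.has_bochner_integral_vchar[OF half_sym y subsetD[OF A.box_subset that], of "- l"]
    by (simp add: vchar_swap mdet_dual cong: if_cong)
  have agree: "(\<forall>j\<le>l. y j = a j) \<longleftrightarrow> a = A.trunc q l y" if "a \<in> A.box q l" for a
    using that assms(3) by (auto simp: A.box_def A.trunc_def vU_def fun_eq_iff) (metis linorder_not_le)+
  have "(\<integral>\<omega>. indicator (B.U (- l)) \<omega> *
      (fourier M \<mu> (\<lambda>x. indicator (A.U q) x * F x) \<omega> * vchar M y \<omega>) \<partial>\<mu>') =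
    (\<integral>\<omega>. (\<Sum>a\<in>A.box q l. c a * (indicator (B.U (- l)) \<omega> * (vchar M y \<omega> * cnj (vchar M a \<omega>)))) \<partial>\<mu>')"
  proof (intro Bochner_Integration.integral_cong refl)
    show "indicator (B.U (- l)) \<omega> * (fourier M \<mu> (\<lambda>x. indicator (A.U q) x * F x) \<omega> * vchar M y \<omega>) =
        (\<Sum>a\<in>A.box q l. c a * (indicator (B.U (- l)) \<omega> * (vchar M y \<omega> * cnj (vchar M a \<omega>))))" for \<omega>
    proof (cases "\<omega> \<in> B.U (- l)")
      case True
      show ?thesis
        unfolding fourier_truncated[OF assms(1,2) True] c_def[symmetric]
        by (simp add: sum_distrib_left sum_distrib_right mult_ac)
    qed simp
  qed
  also have "\<dots> = (\<Sum>a\<in>A.box q l. c a * (if \<forall>j\<le>l. y j = a j then of_real (of_nat A.m powi l) else 0))"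
    using int by (intro has_bochner_integral_integral_eq has_bochner_integral_sum
        has_bochner_integral_mult_right) auto
  also have "\<dots> = (\<Sum>a\<in>A.box q l. if a = A.trunc q l y then c a * of_real (of_nat A.m powi l) else 0)"
    by (intro sum.cong) (auto simp: agree)
  also have "\<dots> = c (A.trunc q l y) * of_real (of_nat A.m powi l)"
    using A.trunc_box[OF y] by (simp add: A.finite_box)
  also have "c (A.trunc q l y) = (\<integral>x. indicator (A.cyl l y) x * F x \<partial>\<mu>)"
    by (simp add: c_def A.cyl_trunc[OF assms(3)])
  finally show ?thesis
    by simp
qed

text \<open>On the dual side the truncation is removed by dominated convergence on a set of finite
  measure; the truncated formula already has its final right-hand side for all large
  \<open>k\<close>.\<close>

lemma fourier_inversion_cyl:
  assumes F: "integrable \<mu> F" and y: "y \<in> A.V"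
  shows "(\<integral>\<omega>. indicator (B.U (- l)) \<omega> * (fourier M \<mu> F \<omega> * vchar M y \<omega>) \<partial>\<mu>') =
    of_real (of_nat A.m powi l) * (\<integral>x. indicator (A.cyl l y) x * F x \<partial>\<mu>)"
proof -
  let ?F = "\<lambda>k x. indicator (A.U (- int k)) x * F x"
  let ?I = "\<lambda>G. \<integral>\<omega>. indicator (B.U (- l)) \<omega> * (fourier M \<mu> G \<omega> * vchar M y \<omega>) \<partial>\<mu>'"
  let ?C = "\<integral>x. norm (F x) \<partial>\<mu>"
  have int: "integrable \<mu> (?F k)" for k
    by (intro integrable_indicator_times F A.U_sets)
  have [measurable]: "(\<lambda>\<omega>. vchar M y \<omega>) \<in> borel_measurable \<mu>'"
    using half_haar.measurable_vchar[OF half_sym y] by (simp add: vchar_swap)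
  have [measurable]: "fourier M \<mu> F \<in> borel_measurable \<mu>'" "\<And>k. fourier M \<mu> (?F k) \<in> borel_measurable \<mu>'"
    by (intro measurable_fourier F int)+
  have lim1: "(\<lambda>k. ?I (?F k)) \<longlonglongrightarrow> ?I F"
  proof (rule integral_dominated_convergence[where w = "\<lambda>\<omega>. indicator (B.U (- l)) \<omega> * ?C"])
    show "integrable \<mu>' (\<lambda>\<omega>. indicator (B.U (- l)) \<omega> * ?C)"
      by (intro integrable_mult_left integrable_real_indicator B.U_sets) (simp add: B.emeasure_U)
    show "AE \<omega> in \<mu>'. (\<lambda>k. indicator (B.U (- l)) \<omega> * (fourier M \<mu> (?F k) \<omega> * vchar M y \<omega>))
        \<longlonglongrightarrow> indicator (B.U (- l)) \<omega> * (fourier M \<mu> F \<omega> * vchar M y \<omega>)"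
      by (intro AE_I2 tendsto_intros tendsto_fourier_truncated F) (simp add: B.space_haar)
    show "AE \<omega> in \<mu>'. norm (indicator (B.U (- l)) \<omega> * (fourier M \<mu> (?F k) \<omega> * vchar M y \<omega>))
        \<le> indicator (B.U (- l)) \<omega> * ?C" for k
    proof (rule AE_I2)
      fix \<omega> assume "\<omega> \<in> space \<mu>'"
      then have "norm (fourier M \<mu> (?F k) \<omega>) \<le> (\<integral>x. norm (?F k x) \<partial>\<mu>)"
        using int by (intro norm_fourier_le) (simp_all add: B.space_haar)
      also have "\<dots> \<le> ?C"
        using int F by (intro integral_mono) (auto simp: indicator_def)
      finally show "norm (indicator (B.U (- l)) \<omega> * (fourier M \<mu> (?F k) \<omega> * vchar M y \<omega>))
          \<le> indicator (B.U (- l)) \<omega> * ?C"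
        by (simp add: norm_mult indicator_def)
    qed
  qed simp_all
  obtain K where K: "\<And>j. j \<le> K \<Longrightarrow> y j = 0"
    using y by (auto simp: A.vil_iff)
  \<comment> \<open>From this threshold on, \<open>y\<close> lies in \<open>A.U (- int k)\<close>,
    and \<open>- int k \<le> l\<close> holds.\<close>
  have "?I (?F k) = of_real (of_nat A.m powi l) * (\<integral>x. indicator (A.cyl l y) x * F x \<partial>\<mu>)"
    if "nat (max (- l) (- K)) \<le> k" for k
    using that y K by (intro fourier_inversion_truncated F) (auto simp: vU_def)
  then have "(\<lambda>k. ?I (?F k)) \<longlonglongrightarrow>
      of_real (of_nat A.m powi l) * (\<integral>x. indicator (A.cyl l y) x * F x \<partial>\<mu>)"
    by (intro tendsto_eventually eventually_sequentiallyI)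
  with lim1 show ?thesis
    by (rule LIMSEQ_unique)
qed

end


subsection \<open>Uniqueness\<close>

context digit_system
begin

text \<open>Centres are restricted to boxes to make the family countable; the empty set makes it
  closed under intersection.\<close>

definition cyls :: "'d vseq set set" where
  "cyls = insert {} (\<Union>l. \<Union>k::nat. cyl l ` box (- int k) l)"

lemma cyl_in_cyls:
  assumes "x \<in> V"
  shows "cyl l x \<in> cyls"
proof -
  obtain k :: nat where "x \<in> U (- int k)"
    using assms V_eq_UN by auto
  then have eq: "cyl l x = cyl l (trunc (- int k) l x)"
    by (rule cyl_trunc[symmetric])
  show ?thesis
    unfolding eq cyls_def using trunc_box[OF assms, of "- int k" l] by blast
qed

lemma cyls_cases:
  assumes "C \<in> cyls"
  obtains "C = {}" | l x where "x \<in> V" "C = cyl l x"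
proof (cases "C = {}")
  case False
  then obtain l and k :: nat and a where "a \<in> box (- int k) l" "C = cyl l a"
    using assms by (auto simp: cyls_def)
  with that(2) box_subset show thesis
    by blast
qed (rule that(1))

lemma countable_cyls: "countable cyls"
  unfolding cyls_def by (auto intro!: countable_UN countable_image finite_box[THEN countable_finite])

text \<open>Two cylinders that meet are nested, as in an ultrametric space.\<close>

lemma Int_stable_cyls: "Int_stable cyls"
proof (rule Int_stableI)
  fix B C assume "B \<in> cyls" "C \<in> cyls"
  then show "B \<inter> C \<in> cyls"
  proof (elim cyls_cases)
    fix l x l' y assume *: "x \<in> V" "B = cyl l x" "y \<in> V" "C = cyl l' y"
    show "B \<inter> C \<in> cyls"
    proof (cases "B \<inter> C = {}")
      case False
      then obtain z where z: "z \<in> cyl l x" "z \<in> cyl l' y"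
        using * by auto
      then have "B = cyl l z" "C = cyl l' z" "z \<in> V"
        using * cyl_subset by (auto simp: cyl_eq)
      moreover have "cyl l z \<inter> cyl l' z = cyl (max l l') z"
        by (auto simp: cyl_def le_max_iff_disj)
      ultimately show ?thesis
        by (simp add: cyl_in_cyls)
    qed (simp add: cyls_def)
  qed (auto simp: cyls_def)
qed

lemma cyls_subset: "cyls \<subseteq> Pow V"
  using cyl_subset by (auto elim!: cyls_cases)

lemma vopen_sigma_cyls:
  assumes "vopen M s G"
  shows "G \<in> sigma_sets V cyls"
proof -
  have "G = \<Union> {C \<in> cyls. C \<subseteq> G}"
  proof safe
    fix x assume "x \<in> G"
    then obtain l where l: "x \<in> V" "cyl l x \<subseteq> G"
      using assms unfolding vopen_iff by blast
    then show "x \<in> \<Union> {C \<in> cyls. C \<subseteq> G}"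
      using cyl_in_cyls[OF l(1)] cyl_self[OF l(1)] by blast
  qed auto
  moreover have "\<Union> {C \<in> cyls. C \<subseteq> G} \<in> sigma_sets V cyls"
    by (rule sigma_sets_UNION) (auto intro: countable_subset[OF _ countable_cyls] sigma_sets.Basic)
  ultimately show ?thesis
    by simp
qed

end

context haar
begin

lemma sets_haar_cyls: "sets \<mu> = sigma_sets V cyls"
proof
  show "sets \<mu> \<subseteq> sigma_sets V cyls"
    unfolding sets_haar by (rule sigma_sets_mono) (auto intro: vopen_sigma_cyls)
  have "cyls \<subseteq> {G. vopen M s G}"
    using vopen_cyl by (auto elim!: cyls_cases simp: vopen_iff)
  then show "sigma_sets V cyls \<subseteq> sets \<mu>"
    unfolding sets_haar by (rule sigma_sets_mono')
qed

text \<open>Dynkin's argument on the generator \<open>cyls\<close>; the assumption on the total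
  integral handles complements.\<close>

lemma set_integral_eq_0:
  fixes h :: "'d vseq \<Rightarrow> complex"
  assumes int: "integrable \<mu> h" and total: "(\<integral>x. h x \<partial>\<mu>) = 0"
    and zero: "\<And>C. C \<in> cyls \<Longrightarrow> (LINT x:C|\<mu>. h x) = 0" and A: "A \<in> sets \<mu>"
  shows "(LINT x:A|\<mu>. h x) = 0"
proof -
  have set_int: "set_integrable \<mu> B h" if "B \<in> sets \<mu>" for B
    unfolding set_integrable_def using int that by (intro integrable_mult_indicator)
  have "A \<in> sigma_sets V cyls"
    using A by (simp add: sets_haar_cyls)
  then show ?thesis
  proof (induction rule: sigma_sets_induct_disjoint[OF Int_stable_cyls cyls_subset,
        consumes 1, case_names basic empty compl union])
    case (basic A)
    then show ?case
      by (rule zero)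
  next
    case empty
    show ?case
      by (simp add: set_lebesgue_integral_def)
  next
    case (compl A)
    have A: "A \<in> sets \<mu>" "A \<subseteq> V"
      using compl sigma_sets_into_sp[OF cyls_subset] by (auto simp: sets_haar_cyls)
    have "(LINT x:A \<union> (V - A)|\<mu>. h x) = (LINT x:A|\<mu>. h x) + (LINT x:V - A|\<mu>. h x)"
      using A sets.compl_sets[of A \<mu>] by (intro set_integral_Un set_int) (auto simp: space_haar)
    moreover have "A \<union> (V - A) = space \<mu>"
      using A by (auto simp: space_haar)
    moreover have "(LINT x:space \<mu>|\<mu>. h x) = 0"
      using total int by (simp add: set_integral_space)
    ultimately show ?case
      using compl by simp
  next
    case (union A)
    then have A: "A i \<in> sets \<mu>" for i
      by (auto simp: sets_haar_cyls)
    have "(LINT x:(\<Union>i. A i)|\<mu>. h x) = (\<Sum>i. LINT x:A i|\<mu>. h x)"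
      using union A by (intro lebesgue_integral_countable_add set_int) (auto simp: disjoint_family_on_def)
    then show ?case
      using union by simp
  qed
qed

text \<open>Integrability is only local, so the vanishing is proved on each
  \<open>U (- int k)\<close> and the countably many null sets are united.\<close>

lemma AE_eq_0_if_integral_cyl:
  fixes h :: "'d vseq \<Rightarrow> complex"
  assumes int: "\<And>k::nat. integrable \<mu> (\<lambda>x. indicator (U (- int k)) x * h x)"
    and zero: "\<And>l x. x \<in> V \<Longrightarrow> (\<integral>y. indicator (cyl l x) y * h y \<partial>\<mu>) = 0"
  shows "AE x in \<mu>. h x = 0"
proof -
  interpret sigma_finite_measure \<mu>
    by (rule sigma_finite_haar)
  have zero': "(\<integral>y. indicator C y * h y \<partial>\<mu>) = 0" if "C \<in> cyls" for C
    using that by (cases rule: cyls_cases) (auto simp: zero)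
  have AE_k: "AE x in \<mu>. indicator (U (- int k)) x * h x = 0" for k :: nat
  proof (rule density_zero[OF int])
    fix A assume A: "A \<in> sets \<mu>"
    show "(LINT x:A|\<mu>. indicator (U (- int k)) x * h x) = 0"
    proof (rule set_integral_eq_0[OF int _ _ A])
      show "(\<integral>x. indicator (U (- int k)) x * h x \<partial>\<mu>) = 0"
        using zero[OF zero_vil] by (simp add: U_eq_cyl)
      fix C assume "C \<in> cyls"
      moreover have "U (- int k) \<in> cyls"
        by (simp add: U_eq_cyl cyl_in_cyls zero_vil)
      ultimately have "C \<inter> U (- int k) \<in> cyls"
        using Int_stable_cyls by (simp add: Int_stable_def)
      moreover have "(LINT x:C|\<mu>. indicator (U (- int k)) x * h x) =
          (\<integral>x. indicator (C \<inter> U (- int k)) x * h x \<partial>\<mu>)"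
        unfolding set_lebesgue_integral_def
        by (intro Bochner_Integration.integral_cong) (auto simp: indicator_def)
      ultimately show "(LINT x:C|\<mu>. indicator (U (- int k)) x * h x) = 0"
        using zero' by simp
    qed
  qed
  have "AE x in \<mu>. \<forall>k::nat. indicator (U (- int k)) x * h x = 0"
    by (intro AE_all_countable[THEN iffD2] allI AE_k)
  then show ?thesis
  proof (rule AE_mp, intro AE_I2 impI)
    fix x assume "x \<in> space \<mu>" and *: "\<forall>k::nat. indicator (U (- int k)) x * h x = 0"
    then obtain k :: nat where "x \<in> U (- int k)"
      using V_eq_UN by (auto simp: space_haar)
    then show "h x = 0"
      using *[rule_format, of k] by simp
  qed
qed

lemma integrable_L2_indicator:
  assumes "f \<in> L2 \<mu>" "A \<in> sets \<mu>" "emeasure \<mu> A < \<infinity>"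
  shows "integrable \<mu> (\<lambda>x. indicator A x * f x)"
proof (rule Bochner_Integration.integrable_bound)
  show "integrable \<mu> (\<lambda>x. indicator A x + (norm (f x))\<^sup>2)"
    using assms by (intro Bochner_Integration.integrable_add) (auto simp: L2_def)
  show "(\<lambda>x. indicator A x * f x) \<in> borel_measurable \<mu>"
    using assms by (intro borel_measurable_times borel_measurable_indicator) (auto simp: L2_def)
  have "t \<le> 1 + t\<^sup>2" for t :: real
    using zero_le_power2[of "t - 1"] by (simp add: power2_diff)
      (smt (verit) zero_le_power2)
  then show "AE x in \<mu>. norm (indicator A x * f x) \<le> norm (indicator A x + (norm (f x))\<^sup>2)"
    by (intro AE_I2) (auto simp: indicator_def)
qed

end

context dual_haar
begin

text \<open>The integral over a coset is controlled on both sides of the Fourier transform: it is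
  continuous in the \<open>L\<^sub>2\<close> norm of the function, and also, by the inversion formula, in the
  \<open>L\<^sub>2\<close> norm of the Fourier transform.\<close>

lemma fourier_L2_unique:
  assumes \<phi>: "fourier_L2 M \<mu> \<mu>' \<phi> g" and \<psi>: "\<psi> \<in> L1 \<mu>" "\<psi> \<in> L2 \<mu>"
    and eq: "\<And>\<omega>. \<omega> \<in> B.V \<Longrightarrow> fourier M \<mu> \<psi> \<omega> = g \<omega>"
  shows "AE x in \<mu>. \<phi> x = \<psi> x"
proof -
  obtain F where F: "\<And>i. F i \<in> L1 \<mu>" "\<And>i. F i \<in> L2 \<mu>"
    and lim: "(\<lambda>i::nat. \<integral>\<^sup>+x. ennreal ((norm (F i x - \<phi> x))\<^sup>2) \<partial>\<mu>) \<longlonglongrightarrow> 0"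
    and lim': "(\<lambda>i. \<integral>\<^sup>+\<omega>. ennreal ((norm (fourier M \<mu> (F i) \<omega> - g \<omega>))\<^sup>2) \<partial>\<mu>') \<longlonglongrightarrow> 0"
    and L2: "\<phi> \<in> L2 \<mu>" "g \<in> L2 \<mu>'"
    using \<phi> unfolding fourier_L2_def by blast
  have meas: "F i \<in> borel_measurable \<mu>" "\<phi> \<in> borel_measurable \<mu>" "g \<in> borel_measurable \<mu>'" for i
    using F L2 by (auto simp: L2_def)
  have int: "integrable \<mu> (F i)" "integrable \<mu> \<psi>" for i
    using F \<psi> by (auto simp: L1_def)
  have int_ind: "integrable \<mu> (\<lambda>x. indicator (A.cyl l y) x * f x)" if "f \<in> L2 \<mu>" "y \<in> A.V" for f l y
    using that by (intro A.integrable_L2_indicator A.cyl_sets) (simp_all add: A.emeasure_cyl)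
  have zero: "(\<integral>x. indicator (A.cyl l y) x * (\<phi> x - \<psi> x) \<partial>\<mu>) = 0" if y: "y \<in> A.V" for l y
  proof -
    have [measurable]: "vchar M y \<in> borel_measurable \<mu>'"
      using half_haar.measurable_vchar[OF half_sym y] by (simp add: vchar_swap)
    have 1: "(\<lambda>i. \<integral>x. indicator (A.cyl l y) x * F i x - indicator (A.cyl l y) x * \<phi> x \<partial>\<mu>) \<longlonglongrightarrow> 0"
    proof (rule norm_integral_tendsto_0[where A = "A.cyl l y", OF _ _ _ lim])
      show "integrable \<mu> (\<lambda>x. indicator (A.cyl l y) x * F i x - indicator (A.cyl l y) x * \<phi> x)" for i
        using F L2 y by (intro Bochner_Integration.integrable_diff int_ind)
    qed (use y meas in \<open>auto simp: A.emeasure_cyl indicator_def\<close>)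
    define c :: complex where "c = of_real (of_nat A.m powi l)"
    have c: "c \<noteq> 0"
      using A.m_pos by (simp add: c_def)
    have "(\<lambda>i. \<integral>\<omega>. indicator (B.U (- l)) \<omega> * (fourier M \<mu> (\<lambda>x. F i x - \<psi> x) \<omega> * vchar M y \<omega>) \<partial>\<mu>') \<longlonglongrightarrow> 0"
    proof (rule norm_integral_tendsto_0[where A = "B.U (- l)", OF _ _ _ lim'])
      fix i
      have int': "integrable \<mu> (\<lambda>x. F i x - \<psi> x)"
        using int by simp
      have [measurable]: "fourier M \<mu> (\<lambda>x. F i x - \<psi> x) \<in> borel_measurable \<mu>'"
          "fourier M \<mu> (F i) \<in> borel_measurable \<mu>'"
        by (intro measurable_fourier int int')+
      show "(\<lambda>\<omega>. fourier M \<mu> (F i) \<omega> - g \<omega>) \<in> borel_measurable \<mu>'"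
        using meas by simp
      have fd: "fourier M \<mu> (\<lambda>x. F i x - \<psi> x) \<omega> = fourier M \<mu> (F i) \<omega> - g \<omega>" if "\<omega> \<in> space \<mu>'" for \<omega>
        using that int by (simp add: fourier_diff eq B.space_haar)
      show "norm (indicator (B.U (- l)) \<omega> * (fourier M \<mu> (\<lambda>x. F i x - \<psi> x) \<omega> * vchar M y \<omega>))
          \<le> indicator (B.U (- l)) \<omega> * norm (fourier M \<mu> (F i) \<omega> - g \<omega>)" if "\<omega> \<in> space \<mu>'" for \<omega>
        using that by (simp add: norm_mult fd indicator_def)
      show "integrable \<mu>' (\<lambda>\<omega>. indicator (B.U (- l)) \<omega> * (fourier M \<mu> (\<lambda>x. F i x - \<psi> x) \<omega> * vchar M y \<omega>))"
      proof (rule Bochner_Integration.integrable_bound)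
        show "integrable \<mu>' (\<lambda>\<omega>. indicator (B.U (- l)) \<omega> * (\<integral>x. norm (F i x - \<psi> x) \<partial>\<mu>))"
          by (intro integrable_mult_left integrable_real_indicator B.U_sets) (simp add: B.emeasure_U)
        show "AE \<omega> in \<mu>'. norm (indicator (B.U (- l)) \<omega> * (fourier M \<mu> (\<lambda>x. F i x - \<psi> x) \<omega> * vchar M y \<omega>))
            \<le> norm (indicator (B.U (- l)) \<omega> * (\<integral>x. norm (F i x - \<psi> x) \<partial>\<mu>))"
          using norm_fourier_le[OF int']
          by (intro AE_I2) (simp add: norm_mult indicator_def B.space_haar)
      qed simp
    qed (auto simp: B.emeasure_U)
    then have "(\<lambda>i. c * (\<integral>x. indicator (A.cyl l y) x * (F i x - \<psi> x) \<partial>\<mu>)) \<longlonglongrightarrow> c * 0"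
      using int by (simp add: fourier_inversion_cyl y c_def)
    then have 2: "(\<lambda>i. \<integral>x. indicator (A.cyl l y) x * (F i x - \<psi> x) \<partial>\<mu>) \<longlonglongrightarrow> 0"
      using c tendsto_mult_left_iff[of c _ 0] by simp
    \<comment> \<open>The left-hand side tends to 0, while the right-hand side does not depend on
      \<open>i\<close>.\<close>
    have "(\<integral>x. indicator (A.cyl l y) x * (F i x - \<psi> x) \<partial>\<mu>) -
        (\<integral>x. indicator (A.cyl l y) x * F i x - indicator (A.cyl l y) x * \<phi> x \<partial>\<mu>) =
        (\<integral>x. indicator (A.cyl l y) x * (\<phi> x - \<psi> x) \<partial>\<mu>)" for i
      using int_ind[OF F(2) y] int_ind[OF L2(1) y] int_ind[OF \<psi>(2) y]
      by (simp add: right_diff_distrib)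
    then show ?thesis
      using tendsto_diff[OF 2 1] by (simp add: LIMSEQ_const_iff)
  qed
  have "AE x in \<mu>. \<phi> x - \<psi> x = 0"
  proof (rule A.AE_eq_0_if_integral_cyl[OF _ zero])
    show "integrable \<mu> (\<lambda>x. indicator (A.U (- int k)) x * (\<phi> x - \<psi> x))" for k
      using int_ind[OF L2(1) A.zero_vil] int_ind[OF \<psi>(2) A.zero_vil]
      by (simp add: A.U_eq_cyl right_diff_distrib)
  qed
  then show ?thesis
    by simp
qed

end

section \<open>The mask of a word\<close>

lemma length_seg [simp]: "length (seg f a n) = n"
  by (simp add: seg_def)

lemma seg_eq_iff: "seg f a n = seg g c n \<longleftrightarrow> (\<forall>i<n. f (a + int i) = g (c + int i))"
  by (auto simp: seg_def list_eq_iff_nth_eq)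

lemma seg_Suc: "seg f a (Suc n) = f a # seg f (a + 1) n"
  by (auto simp: seg_def list_eq_iff_nth_eq nth_Cons algebra_simps simp del: upt_Suc split: nat.splits)

lemma set_seg_subset: "(\<And>j. a \<le> j \<Longrightarrow> j < a + int n \<Longrightarrow> f j \<in> D) \<Longrightarrow> set (seg f a n) \<subseteq> D"
  by (auto simp: seg_def)

locale mask_word = digit_system N s' for N :: "int ^ 'd ^ 'd::finite" and s' +
  fixes n r :: nat and \<xi> :: "int \<Rightarrow> int ^ 'd" and b :: "(int ^ 'd) list \<Rightarrow> complex"
  assumes n2: "2 \<le> n" and nr: "n \<le> r"
    and letters: "\<forall>k\<in>{0..int r}. \<xi> k \<in> digits N s' - {0}"
    and before: "\<forall>l\<le>-1. \<xi> l = 0"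
    and distinct: "\<forall>k\<in>{0..r - n + 2}. \<forall>k'\<in>{0..r - n + 2}. k \<noteq> k' \<longrightarrow>
           seg \<xi> (int k) (n - 1) \<noteq> seg \<xi> (int k') (n - 1)"
    and vals: "associated_values (digits N s') n r \<xi> b"
begin

abbreviation "K \<equiv> r - n + 2"

lemma letter_nonzero: "0 \<le> k \<Longrightarrow> k \<le> int r \<Longrightarrow> \<xi> k \<noteq> 0"
  using letters by auto

lemma K_le: "K \<le> r"
  using n2 nr by arith

lemma letter_nonzero_nat: "k \<le> K \<Longrightarrow> \<xi> (int k) \<noteq> 0"
  using K_le by (intro letter_nonzero) auto

lemma letter_digit: "k \<le> int r \<Longrightarrow> \<xi> k \<in> D"
  using letters before zero_digit by (cases "0 \<le> k") auto

lemma seg_inject: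
  "k \<le> K \<Longrightarrow> k' \<le> K \<Longrightarrow> seg \<xi> (int k) (n - 1) = seg \<xi> (int k') (n - 1) \<Longrightarrow> k = k'"
  using distinct by force

text \<open>Position 0 is left out: the initial word of \<xi> counts as new and may follow a
  zero.\<close>

definition new_word :: "(int ^ 'd) list \<Rightarrow> bool" where
  "new_word v \<longleftrightarrow> (\<forall>k\<in>{1..K}. v \<noteq> seg \<xi> (int k) (n - 1))"

lemma seg_n: "seg f a n = f a # seg f (a + 1) (n - 1)"
  using n2 seg_Suc[of f a "n - 1"] by simp

text \<open>An occurrence in \<xi> at one of the excluded positions would begin with a nonzero
  letter.\<close>

lemma new_word_zero: "f a = 0 \<Longrightarrow> new_word (seg f a (n - 1))"
  unfolding new_word_def seg_eq_iff
proof (intro ballI notI)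
  fix k assume "f a = 0" and k: "k \<in> {1..K}" and "\<forall>i<n - 1. f (a + int i) = \<xi> (int k + int i)"
  then have "\<xi> (int k) = 0"
    using n2 by (auto dest!: spec[of _ 0])
  then show False
    using letter_nonzero_nat k by auto
qed

lemma b_letters: "k \<le> r - n + 1 \<Longrightarrow> b (seg \<xi> (int k) n) \<in> {1, -1}"
  using vals by (simp add: associated_values_def)

lemma b_zero_new:
  assumes "f a = 0" "new_word (seg f (a + 1) (n - 1))" "\<And>j. a \<le> j \<Longrightarrow> j < a + int n \<Longrightarrow> f j \<in> D"
  shows "b (seg f a n) \<in> {1, -1}"
proof -
  have "set (seg f (a + 1) (n - 1)) \<subseteq> D"
    using assms(3) n2 by (intro set_seg_subset) auto
  then show ?thesis
    using vals assms(1,2) unfolding associated_values_def seg_n new_word_def by (auto simp del: insert_iff)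
qed

lemma b_nonzero_cases:
  assumes "\<And>j. f j \<in> D" "b (seg f a n) \<noteq> 0"
  shows "(\<exists>k\<le>r - n + 1. seg f a n = seg \<xi> (int k) n) \<or> f a = 0 \<and> new_word (seg f (a + 1) (n - 1))"
proof (rule ccontr)
  assume "\<not> ?thesis"
  moreover have "set (seg f a n) \<subseteq> D"
    using assms(1) by (rule set_seg_subset)
  moreover have "b w = 0" if "length w = n" "set w \<subseteq> D" "\<not> (\<exists>k\<le>r - n + 1. w = seg \<xi> (int k) n)"
      "\<not> (\<exists>v. w = 0 # v \<and> new_word v)" for w
    using vals that unfolding associated_values_def new_word_def by blast
  moreover have "f a = 0 \<and> v = seg f (a + 1) (n - 1)" if "seg f a n = 0 # v" for v
    using that by (simp add: seg_n)
  ultimately have "b (seg f a n) = 0"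
    by (metis length_seg)
  with assms(2) show False ..
qed

lemma b_nonzero_letter:
  assumes "\<And>j. f j \<in> D" "b (seg f a n) \<noteq> 0" "f a \<noteq> 0"
  obtains k where "k \<le> r - n + 1" "seg f a n = seg \<xi> (int k) n"
  using b_nonzero_cases[OF assms(1,2)] assms(3) by auto

lemma b_nonzero_zero:
  assumes "\<And>j. f j \<in> D" "b (seg f a n) \<noteq> 0" "f a = 0"
  shows "new_word (seg f (a + 1) (n - 1))"
  using b_nonzero_cases[OF assms(1,2)]
proof
  assume "\<exists>k\<le>r - n + 1. seg f a n = seg \<xi> (int k) n"
  then obtain k where "k \<le> r - n + 1" "f a = \<xi> (int k)"
    by (auto simp: seg_n)
  then show ?thesis
    using assms(3) letter_nonzero[of "int k"] n2 nr by auto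
qed simp

lemma b_zeros: "(\<And>j. a \<le> j \<Longrightarrow> j < a + int n \<Longrightarrow> f j = 0) \<Longrightarrow> b (seg f a n) = 1"
proof -
  assume "\<And>j. a \<le> j \<Longrightarrow> j < a + int n \<Longrightarrow> f j = 0"
  then have "seg f a n = replicate n 0"
    by (auto simp: seg_def list_eq_iff_nth_eq)
  then show ?thesis
    using vals by (simp add: associated_values_def)
qed

text \<open>The infinite product \<open>\<Prod>m\<^sub>0(M*\<^sup>-\<^sup>j\<omega>)\<close>; the factor with index \<open>k\<close> sees the window of \<open>\<omega>\<close>
  that starts at \<open>-k\<close>.\<close>

definition ghat :: "'d vseq \<Rightarrow> complex" where
  "ghat \<omega> = (\<Prod>k. b (seg \<omega> (- int k) n))"

text \<open>The bound on \<open>J\<close> puts every omitted window inside the leading zeros, where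
  \<open>b\<close> is 1.\<close>

lemma ghat_eq_prod:
  assumes "\<And>j. j \<le> - L \<Longrightarrow> \<omega> j = 0" "L + int n - 1 \<le> int J"
  shows "ghat \<omega> = (\<Prod>k<J. b (seg \<omega> (- int k) n))"
  unfolding ghat_def using assms by (intro prodinf_finite b_zeros) auto

lemma ghat_cong: "(\<And>j. j < int n \<Longrightarrow> \<omega> j = \<omega>' j) \<Longrightarrow> ghat \<omega> = ghat \<omega>'"
proof -
  assume "\<And>j. j < int n \<Longrightarrow> \<omega> j = \<omega>' j"
  then have "seg \<omega> (- int k) n = seg \<omega>' (- int k) n" for k
    by (simp add: seg_eq_iff)
  then show ?thesis
    by (simp add: ghat_def)
qed

text \<open>Shifting adds exactly one window, the one starting at 1. This is the refinement equation
  on the Fourier side.\<close>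

lemma ghat_shift:
  assumes "\<omega> \<in> V"
  shows "ghat (vshift 1 \<omega>) = b (seg \<omega> 1 n) * ghat \<omega>"
proof -
  obtain L where L: "\<And>j. j \<le> L \<Longrightarrow> \<omega> j = 0"
    using assms by (auto simp: vil_iff)
  define J where "J = nat (- L + int n)"
  have "seg (vshift 1 \<omega>) (- int k) n = seg \<omega> (1 - int k) n" for k
    by (simp add: seg_eq_iff vshift_def algebra_simps)
  moreover have "ghat (vshift 1 \<omega>) = (\<Prod>k<Suc J. b (seg (vshift 1 \<omega>) (- int k) n))"
    by (rule ghat_eq_prod[of "- L + 1"]) (auto simp: L vshift_def J_def)
  ultimately have "ghat (vshift 1 \<omega>) = b (seg \<omega> 1 n) * (\<Prod>k<J. b (seg \<omega> (- int k) n))"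
    by (simp add: prod.lessThan_Suc_shift del: prod.lessThan_Suc)
  also have "(\<Prod>k<J. b (seg \<omega> (- int k) n)) = ghat \<omega>"
    by (rule ghat_eq_prod[symmetric, of "- L"]) (auto simp: L J_def)
  finally show ?thesis .
qed

lemma ghat_nonzero_window:
  assumes "\<omega> \<in> V" "ghat \<omega> \<noteq> 0" "a \<le> 0"
  shows "b (seg \<omega> a n) \<noteq> 0"
proof -
  obtain L where L: "\<And>j. j \<le> L \<Longrightarrow> \<omega> j = 0"
    using assms by (auto simp: vil_iff)
  define J where "J = nat (- L + int n) + nat (1 - a)"
  have "ghat \<omega> = (\<Prod>k<J. b (seg \<omega> (- int k) n))"
    by (rule ghat_eq_prod[of "- L"]) (auto simp: L J_def)
  moreover have "nat (- a) < J"
    using assms(3) unfolding J_def by linarith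
  moreover from calculation have "\<forall>k\<in>{..<J}. b (seg \<omega> (- int k) n) \<noteq> 0"
    using assms(2) by auto
  ultimately have "b (seg \<omega> (- int (nat (- a))) n) \<noteq> 0"
    by blast
  then show ?thesis
    using assms(3) by simp
qed

text \<open>The two parts of the support of \<open>ghat\<close>: the coset of \<open>\<xi>\<^sub>0\<dots>\<xi>\<^sub>k\<^sub>-\<^sub>1,\<xi>\<^sub>k\<dots>\<xi>\<^sub>k\<^sub>+\<^sub>n\<^sub>-\<^sub>2\<close> and
  the cosets of \<open>Q\<close>.\<close>

definition on_word :: "nat \<Rightarrow> 'd vseq \<Rightarrow> bool" where
  "on_word k \<omega> \<longleftrightarrow> (\<forall>j<int n. \<omega> j = \<xi> (int k - 1 + j))"

definition on_Q :: "'d vseq \<Rightarrow> bool" where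
  "on_Q \<omega> \<longleftrightarrow> (\<forall>j\<le>0. \<omega> j = 0) \<and> new_word (seg \<omega> 1 (n - 1))"

lemma on_word_zero: "on_word k \<omega> \<Longrightarrow> j \<le> - int k \<Longrightarrow> \<omega> j = 0"
  using before n2 by (auto simp: on_word_def)

lemma on_word_first: "on_word k \<omega> \<Longrightarrow> 1 \<le> k \<Longrightarrow> \<omega> (1 - int k) \<noteq> 0"
  using letter_nonzero[of 0] n2 by (auto simp: on_word_def)

text \<open>The first nonzero coordinate stands at \<open>1 - int k\<close> and thus determines
  \<open>k\<close>.\<close>

lemma on_word_unique:
  assumes "on_word k \<omega>" "on_word k' \<omega>" "1 \<le> k" "1 \<le> k'"
  shows "k = k'"
  using on_word_first[OF assms(1,3)] on_word_zero[OF assms(1), of "1 - int k'"]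
    on_word_first[OF assms(2,4)] on_word_zero[OF assms(2), of "1 - int k"]
  by (cases k k' rule: linorder_cases) auto

lemma on_word_not_Q: "on_word k \<omega> \<Longrightarrow> 1 \<le> k \<Longrightarrow> \<not> on_Q \<omega>"
  using on_word_first[of k \<omega>] by (auto simp: on_Q_def)

lemma ghat_support:
  assumes \<omega>: "\<omega> \<in> V" and nz: "ghat \<omega> \<noteq> 0"
  shows "on_Q \<omega> \<or> (\<exists>k\<in>{1..K}. on_word k \<omega>)"
proof (cases "\<forall>j\<le>0. \<omega> j = 0")
  case True
  have "new_word (seg \<omega> (0 + 1) (n - 1))"
    using \<omega> True ghat_nonzero_window[OF \<omega> nz, of 0] by (intro b_nonzero_zero) (auto simp: vil_digit)
  with True show ?thesis
    by (simp add: on_Q_def)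
next
  case False
  note window = ghat_nonzero_window[OF \<omega> nz] and digit = vil_digit[OF \<omega>]
  obtain L where L: "\<And>j. j \<le> L \<Longrightarrow> \<omega> j = 0"
    using \<omega> by (auto simp: vil_iff)
  obtain i where i: "i \<le> 0" "\<omega> i \<noteq> 0"
    using False by auto
  \<comment> \<open>The search runs over natural offsets from \<open>L\<close>, since the integers
    are not well-ordered.\<close>
  define d where "d = (LEAST d. \<omega> (L + int d) \<noteq> 0)"
  define j0 where "j0 = L + int d"
  have "L < i"
    using L[of i] i by force
  then have ex: "\<omega> (L + int (nat (i - L))) \<noteq> 0"
    using i by simp
  have j0: "\<omega> j0 \<noteq> 0" "j0 \<le> 0"
    unfolding j0_def d_def using LeastI[of "\<lambda>d. \<omega> (L + int d) \<noteq> 0", OF ex]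
      Least_le[of "\<lambda>d. \<omega> (L + int d) \<noteq> 0", OF ex] i \<open>L < i\<close> by auto
  have before_j0: "\<omega> j = 0" if "j < j0" for j
  proof (cases "j \<le> L")
    case False
    then show ?thesis
      using not_less_Least[of "nat (j - L)" "\<lambda>d. \<omega> (L + int d) \<noteq> 0"] that
      by (auto simp: j0_def d_def)
  qed (rule L)
  \<comment> \<open>The window at \<open>j0 - 1\<close> begins with 0, so a new word follows; this
    forces the reading of \<xi> to start at position 0.\<close>
  have new: "new_word (seg \<omega> j0 (n - 1))"
    using b_nonzero_zero[of \<omega> "j0 - 1", OF digit window] before_j0[of "j0 - 1"] j0 by simp
  have prefix: "seg \<omega> a (n - 1) = seg \<xi> c (n - 1)" "seg \<omega> (a + 1) (n - 1) = seg \<xi> (c + 1) (n - 1)"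
    if "seg \<omega> a n = seg \<xi> c n" for a c
    using that by (auto simp: seg_eq_iff) (auto dest!: spec[of _ "Suc _"] simp: algebra_simps)
  \<comment> \<open>The bound on \<open>t\<close> is part of the induction: it ensures that the next
    letter is still one of the nonzero letters.\<close>
  have main: "t \<le> r - n + 1 \<and> seg \<omega> (j0 + int t) n = seg \<xi> (int t) n" if "j0 + int t \<le> 0" for t
    using that
  proof (induction t)
    case 0
    obtain k where k: "k \<le> r - n + 1" "seg \<omega> j0 n = seg \<xi> (int k) n"
      using b_nonzero_letter[of \<omega> j0, OF digit window[OF j0(2)] j0(1)] by blast
    have "k = 0"
      using new prefix(1)[OF k(2)] k(1) by (auto simp: new_word_def)
    with k show ?case
      by simp
  next
    case (Suc t)
    then have IH: "t \<le> r - n + 1" "seg \<omega> (j0 + int t) n = seg \<xi> (int t) n"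
      by auto
    have seg: "seg \<omega> (j0 + int (Suc t)) (n - 1) = seg \<xi> (int (Suc t)) (n - 1)"
      using prefix(2)[OF IH(2)] by (simp add: algebra_simps)
    then have "\<omega> (j0 + int (Suc t)) = \<xi> (int (Suc t))"
      using n2 by (auto simp: seg_eq_iff dest!: spec[of _ 0])
    then have nz: "\<omega> (j0 + int (Suc t)) \<noteq> 0"
      using letter_nonzero[of "int (Suc t)"] IH(1) n2 nr by auto
    obtain k where k: "k \<le> r - n + 1" "seg \<omega> (j0 + int (Suc t)) n = seg \<xi> (int k) n"
      using b_nonzero_letter[of \<omega> "j0 + int (Suc t)", OF digit window[OF Suc.prems] nz] by blast
    have "k = Suc t"
      using seg prefix(1)[OF k(2)] k(1) IH(1) by (intro seg_inject) auto
    with k show ?case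
      by simp
  qed
  \<comment> \<open>The number of coordinates from \<open>j0\<close> up to the separating
    comma.\<close>
  define k where "k = nat (1 - j0)"
  have k: "int k = 1 - j0"
    using j0 by (simp add: k_def)
  have last: "k - 1 \<le> r - n + 1" "seg \<omega> 0 n = seg \<xi> (int k - 1) n"
    using main[of "k - 1"] k j0 by (auto simp: of_nat_diff)
  have "on_word k \<omega>"
    unfolding on_word_def
  proof (intro allI impI)
    fix j assume j: "j < int n"
    consider "j < j0" | "j0 \<le> j" "j \<le> 0" | "0 \<le> j"
      by linarith
    then show "\<omega> j = \<xi> (int k - 1 + j)"
    proof cases
      case 1
      then show ?thesis
        using before before_j0 k by auto
    next
      case 2
      then have "seg \<omega> (j0 + int (nat (j - j0))) n = seg \<xi> (int (nat (j - j0))) n"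
        using main[of "nat (j - j0)"] by simp
      then have "\<omega> (j0 + int (nat (j - j0))) = \<xi> (int (nat (j - j0)))"
        using n2 by (auto simp: seg_eq_iff dest!: spec[of _ 0])
      then have "\<omega> j = \<xi> (j - j0)"
        using 2 by simp
      moreover have "j - j0 = int k - 1 + j"
        using k by simp
      ultimately show ?thesis
        by simp
    next
      case 3
      then show ?thesis
        using last(2) j by (auto simp: seg_eq_iff dest!: spec[of _ "nat j"])
    qed
  qed
  moreover have "k \<in> {1..K}"
    using last(1) k j0 by auto
  ultimately show ?thesis
    by blast
qed

lemma ghat_zero: "\<omega> \<in> V \<Longrightarrow> j \<le> - int K \<Longrightarrow> \<omega> j \<noteq> 0 \<Longrightarrow> ghat \<omega> = 0"
  using ghat_support[of \<omega>] on_word_zero[of _ \<omega> j] by (force simp: on_Q_def)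

lemma ghat_on_word:
  assumes "on_word k \<omega>"
  shows "ghat \<omega> = (\<Prod>j=1..k + n - 1. b (seg \<xi> (int k - int j) n))"
proof -
  have "ghat \<omega> = (\<Prod>i<k + n - 1. b (seg \<omega> (- int i) n))"
    using on_word_zero[OF assms] n2 by (intro ghat_eq_prod[of "int k"]) auto
  also have "\<dots> = (\<Prod>i<k + n - 1. b (seg \<xi> (int k - int (Suc i)) n))"
  proof (intro prod.cong refl arg_cong[of _ _ b])
    show "seg \<omega> (- int i) n = seg \<xi> (int k - int (Suc i)) n" for i
      using assms by (auto simp: on_word_def seg_eq_iff algebra_simps)
  qed
  also have "\<dots> = (\<Prod>j=1..k + n - 1. b (seg \<xi> (int k - int j) n))"
    by (rule prod.reindex_bij_witness[of _ "\<lambda>j. j - 1" Suc]) auto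
  finally show ?thesis .
qed

text \<open>For \<open>c \<ge> 0\<close> this is a window of \<xi> of the first kind. For
  \<open>c < 0\<close> it is 0 followed by a new word; in the borderline case \<open>c = -1\<close>
  this is the initial word, which does not recur.\<close>

lemma b_word:
  assumes "c < int K"
  shows "norm (b (seg \<xi> c n)) = 1"
proof (cases "0 \<le> c")
  case True
  then have "b (seg \<xi> (int (nat c)) n) \<in> {1, -1}"
    using assms by (intro b_letters) auto
  then show ?thesis
    using True by auto
next
  case False
  have "new_word (seg \<xi> (c + 1) (n - 1))"
  proof (cases "c = -1")
    case True
    show ?thesis
      unfolding new_word_def
    proof (intro ballI notI)
      fix k assume "k \<in> {1..K}" "seg \<xi> (c + 1) (n - 1) = seg \<xi> (int k) (n - 1)"
      then show False
        using seg_inject[of 0 k] True by auto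
    qed
  next
    case False
    then show ?thesis
      using before \<open>\<not> 0 \<le> c\<close> by (intro new_word_zero) auto
  qed
  then have "b (seg \<xi> c n) \<in> {1, -1}"
    using False before nr assms by (intro b_zero_new letter_digit) auto
  then show ?thesis
    by auto
qed

lemma norm_ghat_on_word:
  assumes "on_word k \<omega>" "k \<in> {1..K}"
  shows "norm (ghat \<omega>) = 1"
  unfolding ghat_on_word[OF assms(1)] prod_norm[symmetric]
  using assms(2) by (intro prod.neutral ballI b_word) auto

lemma ghat_on_Q:
  assumes "on_Q \<omega>"
  shows "ghat \<omega> = (\<Prod>j=1..n - 1. b (replicate j 0 @ seg \<omega> 1 (n - j)))"
proof -
  have "ghat \<omega> = (\<Prod>i<n - 1. b (seg \<omega> (- int i) n))"
    using assms n2 by (intro ghat_eq_prod[of 0]) (auto simp: on_Q_def)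
  also have "\<dots> = (\<Prod>i<n - 1. b (replicate (Suc i) 0 @ seg \<omega> 1 (n - Suc i)))"
  proof (intro prod.cong refl arg_cong[of _ _ b])
    fix i assume "i \<in> {..<n - 1}"
    then show "seg \<omega> (- int i) n = replicate (Suc i) 0 @ seg \<omega> 1 (n - Suc i)"
      using assms
      by (auto simp: seg_def list_eq_iff_nth_eq nth_append on_Q_def of_nat_diff simp del: replicate_Suc)
  qed
  also have "\<dots> = (\<Prod>j=1..n - 1. b (replicate j 0 @ seg \<omega> 1 (n - j)))"
    by (rule prod.reindex_bij_witness[of _ "\<lambda>j. j - 1" Suc]) auto
  finally show ?thesis .
qed

lemma norm_ghat_on_Q:
  assumes "\<omega> \<in> V" "on_Q \<omega>"
  shows "norm (ghat \<omega>) = 1"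
proof -
  have "norm (b (seg \<omega> (- int i) n)) = 1" for i
  proof -
    have "new_word (seg \<omega> (- int i + 1) (n - 1))"
      using assms(2) new_word_zero[of \<omega> "- int i + 1"] by (cases "i = 0") (simp_all add: on_Q_def)
    then have "b (seg \<omega> (- int i) n) \<in> {1, -1}"
      using assms by (intro b_zero_new) (auto simp: on_Q_def vil_digit)
    then show ?thesis
      by auto
  qed
  moreover have "ghat \<omega> = (\<Prod>i<n - 1. b (seg \<omega> (- int i) n))"
    using assms(2) n2 by (intro ghat_eq_prod[of 0]) (auto simp: on_Q_def)
  ultimately show ?thesis
    by (simp add: prod_norm[symmetric])
qed

lemma norm_ghat: "\<omega> \<in> V \<Longrightarrow> ghat \<omega> \<noteq> 0 \<Longrightarrow> norm (ghat \<omega>) = 1"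
  using ghat_support norm_ghat_on_word norm_ghat_on_Q by blast

text \<open>The cosets are pairwise disjoint, so at most one term survives.\<close>

lemma ghat_formula:
  assumes "\<omega> \<in> V"
  shows "ghat \<omega> = (\<Sum>k=1..K. of_bool (on_word k \<omega>) * (\<Prod>j=1..k + n - 1. b (seg \<xi> (int k - int j) n))) +
    of_bool (on_Q \<omega>) * (\<Prod>j=1..n - 1. b (replicate j 0 @ seg \<omega> 1 (n - j)))"
proof (cases "\<exists>k\<in>{1..K}. on_word k \<omega>")
  case True
  then obtain k where k: "k \<in> {1..K}" "on_word k \<omega>"
    by blast
  have "(\<Sum>k'=1..K. of_bool (on_word k' \<omega>) * (\<Prod>j=1..k' + n - 1. b (seg \<xi> (int k' - int j) n))) =
      (\<Sum>k'=1..K. if k' = k then ghat \<omega> else 0)"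
  proof (intro sum.cong refl)
    fix k' assume "k' \<in> {1..K}"
    then have "on_word k' \<omega> \<longleftrightarrow> k' = k"
      using k on_word_unique[OF k(2), of k'] by auto
    then show "of_bool (on_word k' \<omega>) * (\<Prod>j=1..k' + n - 1. b (seg \<xi> (int k' - int j) n)) =
        (if k' = k then ghat \<omega> else 0)"
      by (simp add: ghat_on_word[OF k(2)])
  qed
  also have "\<dots> = ghat \<omega>"
    using k(1) by (simp add: sum.delta)
  finally show ?thesis
    using on_word_not_Q[OF k(2)] k(1) by simp
next
  case False
  then have "(\<Sum>k=1..K. of_bool (on_word k \<omega>) * (\<Prod>j=1..k + n - 1. b (seg \<xi> (int k - int j) n))) = 0"
    by (intro sum.neutral) auto
  then show ?thesis
    using ghat_support[OF assms] ghat_on_Q[of \<omega>] False by (cases "on_Q \<omega>") auto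
qed

lemma on_word_seg: "on_word k \<omega> \<Longrightarrow> seg \<omega> 1 (n - 1) = seg \<xi> (int k) (n - 1)"
  by (auto simp: on_word_def seg_eq_iff)

text \<open>Each element with vanishing coordinates of nonpositive index has exactly one extension in
  the support of \<open>ghat\<close>: this is why the translates of the function are orthonormal.\<close>

lemma bij_trunc_support:
  assumes "int n - 1 \<le> l"
  shows "bij_betw (trunc 0 l) {a \<in> box (- int K) l. ghat a \<noteq> 0} (box 0 l)"
  unfolding bij_betw_def
proof
  show "inj_on (trunc 0 l) {a \<in> box (- int K) l. ghat a \<noteq> 0}"
  proof (rule inj_onI)
    fix a a' assume a: "a \<in> {a \<in> box (- int K) l. ghat a \<noteq> 0}"
      and a': "a' \<in> {a \<in> box (- int K) l. ghat a \<noteq> 0}" and eq: "trunc 0 l a = trunc 0 l a'"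
    have pos: "a j = a' j" if "0 < j" for j
      using fun_cong[OF eq, of j] a a' that by (cases "j \<le> l") (auto simp: trunc_def box_def)
    then have seg: "seg a 1 (n - 1) = seg a' 1 (n - 1)"
      by (simp add: seg_eq_iff)
    have nonpos: "a j = a' j" if "j \<le> 0" for j
    proof -
      have "on_Q a \<or> (\<exists>k\<in>{1..K}. on_word k a)" "on_Q a' \<or> (\<exists>k\<in>{1..K}. on_word k a')"
        using ghat_support[of a] ghat_support[of a'] a a' box_subset by blast+
      then show ?thesis
      proof (elim disjE bexE)
        assume "on_Q a" "on_Q a'"
        then show ?thesis
          using that by (simp add: on_Q_def)
      next
        fix k k' assume k: "k \<in> {1..K}" "on_word k a" "k' \<in> {1..K}" "on_word k' a'"
        then have "k = k'"
          using seg on_word_seg[OF k(2)] on_word_seg[OF k(4)] by (intro seg_inject) simp_all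
        then show ?thesis
          using k that n2 by (simp add: on_word_def)
      next
        \<comment> \<open>Impossible: equal positive coordinates would make the new word of
          \<open>a\<close> an occurrence in \<xi>.\<close>
        fix k assume "on_Q a" "k \<in> {1..K}" "on_word k a'"
        then show ?thesis
          using seg on_word_seg[of k a'] by (auto simp: on_Q_def new_word_def)
      next
        fix k assume "on_Q a'" "k \<in> {1..K}" "on_word k a"
        then show ?thesis
          using seg on_word_seg[of k a] by (auto simp: on_Q_def new_word_def)
      qed
    qed
    show "a = a'"
      using pos nonpos by (metis ext linorder_not_le)
  qed
  show "trunc 0 l ` {a \<in> box (- int K) l. ghat a \<noteq> 0} = box 0 l"
  proof
    show "trunc 0 l ` {a \<in> box (- int K) l. ghat a \<noteq> 0} \<subseteq> box 0 l"
      using box_subset by (auto intro!: trunc_box)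
    show "box 0 l \<subseteq> trunc 0 l ` {a \<in> box (- int K) l. ghat a \<noteq> 0}"
    proof
      fix a assume a: "a \<in> box 0 l"
      then have aV: "a \<in> V"
        using box_subset by blast
      show "a \<in> trunc 0 l ` {a \<in> box (- int K) l. ghat a \<noteq> 0}"
      proof (cases "new_word (seg a 1 (n - 1))")
        case True
        then have "on_Q a"
          using a by (auto simp: on_Q_def box_def)
        then have "ghat a \<noteq> 0"
          using norm_ghat_on_Q[OF aV] by auto
        moreover have "a = trunc 0 l a"
          using a by (auto simp: trunc_def box_def fun_eq_iff)
        moreover have "a \<in> box (- int K) l"
          using a by (auto simp: box_def)
        ultimately show ?thesis
          by blast
      next
        case False
        then obtain k where k: "k \<in> {1..K}" "seg a 1 (n - 1) = seg \<xi> (int k) (n - 1)"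
          by (auto simp: new_word_def)
        \<comment> \<open>The occurrence at position \<open>k\<close> is continued to the left by
          the preceding letters, which become zeros before position 0.\<close>
        define e where "e = (\<lambda>j. if j \<le> 0 then \<xi> (int k - 1 + j) else a j)"
        have e: "on_word k e"
          unfolding on_word_def
        proof (intro allI impI)
          fix j assume "j < int n"
          then show "e j = \<xi> (int k - 1 + j)"
            using k(2)[unfolded seg_eq_iff, rule_format, of "nat (j - 1)"]
            by (cases "j \<le> 0") (auto simp: e_def algebra_simps)
        qed
        have "e \<in> box (- int K) l"
          unfolding box_def
        proof (intro CollectI conjI allI impI)
          fix j
          show "e j \<in> D"
            using aV k(1) n2 nr by (auto simp: e_def vil_digit intro!: letter_digit)
          assume "j \<le> - int K \<or> l < j"
          then show "e j = 0"
            using on_word_zero[OF e, of j] k(1) a assms n2 by (auto simp: box_def e_def)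
        qed
        moreover have "ghat e \<noteq> 0"
          using norm_ghat_on_word[OF e k(1)] by auto
        moreover have "a = trunc 0 l e"
          using a by (auto simp: trunc_def e_def box_def fun_eq_iff)
        ultimately show ?thesis
          by blast
      qed
    qed
  qed
qed

section \<open>The cosets of the statement in coordinates\<close>

lemma velem_vil: "set w \<subseteq> D \<Longrightarrow> velem a w \<in> V"
  unfolding vil_iff
proof
  assume "set w \<subseteq> D"
  then show "\<forall>j. velem a w j \<in> D"
    using zero_digit by (auto simp: velem_def subset_iff)
  show "\<exists>L. \<forall>j\<le>L. velem a w j = 0"
    by (rule exI[of _ "a - 1"]) (simp add: velem_def)
qed

text \<open>The word occupies the indices from \<open>1 - int k\<close> to \<open>int n - 1\<close>;
  before it both the element and the matching part of \<xi> vanish, so one formula covers all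
  coordinates below \<open>int n\<close>.\<close>

lemma mem_word_coset:
  assumes "\<omega> \<in> V" "k \<in> {1..K}"
  shows "\<omega> \<in> vadd_set N s' {velem (1 - int k) (seg \<xi> 0 (k + n - 1))} (U (int (n - 1))) \<longleftrightarrow> on_word k \<omega>"
proof -
  have "set (seg \<xi> 0 (k + n - 1)) \<subseteq> D"
    using assms(2) n2 nr by (intro set_seg_subset letter_digit) auto
  then have "velem (1 - int k) (seg \<xi> 0 (k + n - 1)) \<in> V"
    by (rule velem_vil)
  moreover have "velem (1 - int k) (seg \<xi> 0 (k + n - 1)) j = \<xi> (int k - 1 + j)" if "j < int n" for j
    using that n2 before by (auto simp: velem_def seg_def algebra_simps nth_append)
  ultimately show ?thesis
    using assms(1) n2 by (auto simp: coset_eq_cyl cyl_def on_word_def)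
qed

lemma mem_Q_coset:
  assumes "\<omega> \<in> V"
  shows "\<omega> \<in> vadd_set N s' (Qset D n r \<xi>) (U (int (n - 1))) \<longleftrightarrow> on_Q \<omega>"
proof -
  have velem: "velem 0 (0 # w) \<in> V" if "set w \<subseteq> D" for w
    using that zero_digit by (intro velem_vil) auto
  have *: "\<omega> \<in> vadd_set N s' {velem 0 (0 # w)} (U (int (n - 1))) \<longleftrightarrow> (\<forall>j\<le>0. \<omega> j = 0) \<and> seg \<omega> 1 (n - 1) = w"
    if w: "length w = n - 1" "set w \<subseteq> D" for w
  proof -
    have "(\<forall>j\<le>int (n - 1). \<omega> j = velem 0 (0 # w) j) \<longleftrightarrow>
        (\<forall>j\<le>0. \<omega> j = 0) \<and> (\<forall>i<n - 1. \<omega> (1 + int i) = w ! i)"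
    proof (intro iffI conjI allI impI)
      fix j assume *: "\<forall>j\<le>int (n - 1). \<omega> j = velem 0 (0 # w) j" and "(j::int) \<le> 0"
      then show "\<omega> j = 0"
        by (auto simp: velem_def)
    next
      fix i assume *: "\<forall>j\<le>int (n - 1). \<omega> j = velem 0 (0 # w) j" and "i < n - 1"
      then show "\<omega> (1 + int i) = w ! i"
        using w by (simp add: velem_def nat_add_distrib)
    next
      fix j assume *: "(\<forall>j\<le>0. \<omega> j = 0) \<and> (\<forall>i<n - 1. \<omega> (1 + int i) = w ! i)" and "j \<le> int (n - 1)"
      then show "\<omega> j = velem 0 (0 # w) j"
        using w *[THEN conjunct2, rule_format, of "nat (j - 1)"]
        by (cases "j \<le> 0") (auto simp: velem_def nth_Cons' nat_diff_distrib)
    qed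
    then show ?thesis
      using assms w by (auto simp: coset_eq_cyl[OF velem] cyl_def seg_def list_eq_iff_nth_eq)
  qed
  have "\<omega> \<in> vadd_set N s' (Qset D n r \<xi>) (U (int (n - 1))) \<longleftrightarrow>
      (\<exists>w. length w = n - 1 \<and> set w \<subseteq> D \<and> new_word w \<and> \<omega> \<in> vadd_set N s' {velem 0 (0 # w)} (U (int (n - 1))))"
    by (auto simp: vadd_set_def Qset_def new_word_def)
  also have "\<dots> \<longleftrightarrow> (\<exists>w. length w = n - 1 \<and> set w \<subseteq> D \<and> new_word w \<and> (\<forall>j\<le>0. \<omega> j = 0) \<and> seg \<omega> 1 (n - 1) = w)"
    by (intro ex_cong1 conj_cong refl *) assumption+
  also have "\<dots> \<longleftrightarrow> on_Q \<omega>"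
    using assms by (auto simp: on_Q_def intro!: set_seg_subset vil_digit)
  finally show ?thesis .
qed

end

section \<open>The refinable function of a word\<close>

context digit_system
begin

lemma enum_zero: "s 0 = 0"
  using enum by (simp add: digit_enum_def)

lemma powi_m_inverse: "complex_of_real (of_nat m powi (- l)) * of_real (of_nat m powi l) = 1"
proof -
  have "(of_nat m :: real) powi (- l) * of_nat m powi l = 1"
    using m_pos by (simp add: power_int_minus)
  then show ?thesis
    by (metis of_real_1 of_real_mult)
qed

lemma enum_mod: "s (i mod m) \<in> D"
  using m_pos by (simp add: digits_def)

lemma vgamma_small:
  assumes "k < m ^ l" "j \<le> - int l"
  shows "vgamma M s k j = 0"
proof -
  have "m ^ l \<le> m ^ nat (- j)"
    using assms(2) m_pos by (intro power_increasing) auto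
  then have "k div m ^ nat (- j) = 0"
    using assms(1) by simp
  then show ?thesis
    by (simp add: vgamma_def enum_zero)
qed

lemma vgamma_vil: "vgamma M s k \<in> V"
proof -
  have "vgamma M s k j = 0" if "j \<le> - int k" for j
  \<comment> \<open>The bound \<open>k < m ^ k\<close> requires \<open>m \<ge> 2\<close>; for
    \<open>m = 1\<close> every residue is 0 and the sequence vanishes.\<close>
  proof (cases "m = 1")
    case False
    then have "k < m ^ k"
      using m_pos by (intro power_gt_expt) auto
    with that show ?thesis
      by (rule vgamma_small[rotated])
  qed (auto simp: vgamma_def enum_zero)
  then show ?thesis
    unfolding vil_iff using enum_mod zero_digit by (auto simp: vgamma_def intro: exI[of _ "- int k"])
qed

lemma vshift_vil: "x \<in> V \<Longrightarrow> vshift i x \<in> V"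
  unfolding vil_iff
proof (elim conjE exE)
  fix L assume "\<forall>j. x j \<in> D" "\<forall>j\<le>L. x j = 0"
  then show "(\<forall>j. vshift i x j \<in> D) \<and> (\<exists>L. \<forall>j\<le>L. vshift i x j = 0)"
    by (auto simp: vshift_def intro: exI[of _ "L - i"])
qed

lemma vshift_U: "vshift i ` U l = U (l - i)"
proof
  show "vshift i ` U l \<subseteq> U (l - i)"
    using vshift_vil by (auto simp: vU_def vshift_def)
  show "U (l - i) \<subseteq> vshift i ` U l"
  proof
    fix x assume x: "x \<in> U (l - i)"
    then have "vshift (- i) x j = 0" if "j \<le> l" for j
      using that by (simp add: vU_def vshift_def)
    moreover have "vshift (- i) x \<in> V"
      using x by (intro vshift_vil) (simp add: vU_def)
    ultimately have "vshift (- i) x \<in> U l"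
      by (simp add: vU_def)
    moreover have "x = vshift i (vshift (- i) x)"
      by (simp add: vshift_def)
    ultimately show "x \<in> vshift i ` U l"
      by blast
  qed
qed

lemma vUnk_eq: "vUnk M s k i = cyl k (vshift (- k) (vgamma M s i))"
  using vshift_vil[OF vgamma_vil] by (simp add: vUnk_def vshift_U coset_eq_cyl)

text \<open>The complement is a union of cylinders of the same level.\<close>

lemma closedin_U: "closedin (vtop M s) (U l)"
proof -
  have top: "topspace (vtop M s) = V"
    unfolding topspace_def openin_vtop
  proof
    show "\<Union> {S. vopen M s S} \<subseteq> V"
      by (auto simp: vopen_def)
    have "vopen M s V"
      using cyl_subset by (auto simp: vopen_iff)
    then show "V \<subseteq> \<Union> {S. vopen M s S}"
      by blast
  qed
  have "vopen M s (V - U l)"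
    unfolding vopen_iff
  proof (intro conjI ballI exI)
    show "cyl l x \<subseteq> V - U l" if "x \<in> V - U l" for x
      using that by (auto simp: cyl_def vU_def)
  qed auto
  then show ?thesis
    using top by (auto simp: closedin_def openin_vtop vU_def)
qed

lemma vadd_nth_zero: "x \<in> V \<Longrightarrow> y j = 0 \<Longrightarrow> vadd M s x y j = x j"
  by (simp add: vadd_nth vil_digit)

end

locale word_function = dual_haar M N s s' \<mu> \<mu>' + W: mask_word N s' n r \<xi> b
  for M N :: "int ^ 'd ^ 'd::finite" and s s' \<mu> \<mu>' n r \<xi> b
begin

abbreviation "K \<equiv> r - n + 2"

text \<open>The inverse Fourier transform of \<open>ghat\<close>, as a finite sum over the cosets of \<open>B.U l\<close>. On the
  group it does not depend on \<open>l \<ge> n - 1\<close>, because \<open>ghat\<close> is constant on the cosets of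
  \<open>B.U (n - 1)\<close>.\<close>

definition psi :: "int \<Rightarrow> 'd vseq \<Rightarrow> complex" where
  "psi l x = indicator (A.U (- l)) x *
     (of_real (of_nat A.m powi (- l)) * (\<Sum>a\<in>B.box (- int K) l. W.ghat a * vchar M x a))"

abbreviation "phi \<equiv> psi (int n - 1)"

text \<open>The coefficient does not see coordinate \<open>l + 1\<close>, so summing over that
  coordinate gives m or 0 according to \<open>x (- l)\<close>. This matches the change in the power
  of m and in the indicator.\<close>

lemma psi_refine:
  assumes x: "x \<in> A.V" and l: "int n - 1 \<le> l"
  shows "psi (l + 1) x = psi l x"
proof -
  have Kl: "- int K \<le> l"
    using l W.n2 by simp
  have sum_kern: "(\<Sum>d\<in>B.D. kern M (x (- l)) d) = (if x (- l) = 0 then of_nat A.m else 0)"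
    using sum_digits_kern[OF A.vil_digit[OF x] A.zero_digit, of "- l"] by simp
  have "(\<Sum>a\<in>B.box (- int K) (l + 1). W.ghat a * vchar M x a) =
      (\<Sum>a\<in>B.box (- int K) l. \<Sum>d\<in>B.D. W.ghat a * (vchar M x a * kern M (x (- l)) d))"
    unfolding B.sum_box_Suc[OF Kl]
  proof (intro sum.cong refl)
    fix a d assume a: "a \<in> B.box (- int K) l"
    have "W.ghat (a(l + 1 := d)) = W.ghat a"
      using l by (intro W.ghat_cong) auto
    then show "W.ghat (a(l + 1 := d)) * vchar M x (a(l + 1 := d)) = W.ghat a * (vchar M x a * kern M (x (- l)) d)"
      using vchar_update[OF Kl a] by simp
  qed
  also have "\<dots> = (\<Sum>a\<in>B.box (- int K) l. W.ghat a * vchar M x a) * (\<Sum>d\<in>B.D. kern M (x (- l)) d)"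
    by (simp add: sum_distrib_left sum_distrib_right mult_ac)
  finally have sum: "(\<Sum>a\<in>B.box (- int K) (l + 1). W.ghat a * vchar M x a) =
      (\<Sum>a\<in>B.box (- int K) l. W.ghat a * vchar M x a) * (if x (- l) = 0 then of_nat A.m else 0)"
    by (simp only: sum_kern)
  have U: "x \<in> A.U (- l) \<longleftrightarrow> x \<in> A.U (- (l + 1)) \<and> x (- l) = 0"
  proof -
    have "(\<forall>j\<le>- l. x j = 0) \<longleftrightarrow> (\<forall>j\<le>- (l + 1). x j = 0) \<and> x (- l) = 0"
    proof (intro iffI conjI allI impI)
      fix j assume "(\<forall>j\<le>- (l + 1). x j = 0) \<and> x (- l) = 0" "j \<le> - l"
      then show "x j = 0"
        by (cases "j = - l") auto
    qed auto
    then show ?thesis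
      by (auto simp: vU_def)
  qed
  have "of_nat A.m powi (- (l + 1)) * of_nat A.m = (of_nat A.m :: real) powi (- l)"
    using A.m_pos by (simp add: power_int_diff power_int_minus field_simps power_int_add)
  then have pow: "complex_of_real (of_nat A.m powi (- (l + 1))) * of_nat A.m = of_real (of_nat A.m powi (- l))"
    by (metis of_real_mult of_real_of_nat_eq)
  show ?thesis
  proof (cases "x \<in> A.U (- l)")
    case True
    then show ?thesis
      using U pow unfolding psi_def sum by (simp add: mult_ac del: of_real_power_int)
  next
    case False
    then show ?thesis
      using U unfolding psi_def sum by auto
  qed
qed

lemma psi_eq_phi:
  assumes "x \<in> A.V" "int n - 1 \<le> l"
  shows "psi l x = phi x"
  using assms(2) by (induction l rule: int_ge_induct) (simp_all add: psi_refine assms(1))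

text \<open>Orthogonality leaves only box elements that agree with \<omega> up to index n - 1, and
  \<open>ghat\<close> depends on nothing beyond that index.\<close>

lemma has_bochner_integral_phi_fourier:
  assumes \<omega>: "\<omega> \<in> B.V"
  shows "has_bochner_integral \<mu> (\<lambda>x. phi x * cnj (vchar M x \<omega>)) (W.ghat \<omega>)"
proof -
  let ?p = "int n - 1" and ?B = "B.box (- int K) (int n - 1)"
  define c where "c = complex_of_real (of_nat A.m powi (- ?p))"
  have c: "c * of_real (of_nat A.m powi ?p) = 1"
    unfolding c_def by (rule A.powi_m_inverse)
  have "has_bochner_integral \<mu>
      (\<lambda>x. \<Sum>a\<in>?B. (c * W.ghat a) * (indicator (A.U (- ?p)) x * (vchar M x a * cnj (vchar M x \<omega>))))
      (\<Sum>a\<in>?B. (c * W.ghat a) * (if \<forall>j\<le>- (- ?p). a j = \<omega> j then of_real (of_nat A.m powi (- (- ?p))) else 0))"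
    by (intro has_bochner_integral_sum has_bochner_integral_mult_right has_bochner_integral_vchar \<omega>
        subsetD[OF B.box_subset])
  also have "(\<lambda>x. \<Sum>a\<in>?B. (c * W.ghat a) * (indicator (A.U (- ?p)) x * (vchar M x a * cnj (vchar M x \<omega>)))) =
      (\<lambda>x. phi x * cnj (vchar M x \<omega>))"
    by (simp add: psi_def c_def sum_distrib_left sum_distrib_right mult_ac)
  also have "(\<Sum>a\<in>?B. (c * W.ghat a) * (if \<forall>j\<le>- (- ?p). a j = \<omega> j then of_real (of_nat A.m powi (- (- ?p))) else 0)) =
      (\<Sum>a\<in>?B. if \<forall>j\<le>?p. a j = \<omega> j then W.ghat a else 0)"
    using c by (intro sum.cong) (auto simp: mult_ac)
  also have "\<dots> = W.ghat \<omega>"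
  proof (cases "\<forall>j\<le>- int K. \<omega> j = 0")
    case True
    have "(\<forall>j\<le>?p. a j = \<omega> j) \<longleftrightarrow> a = B.trunc (- int K) ?p \<omega>" if "a \<in> ?B" for a
    proof
      assume "\<forall>j\<le>?p. a j = \<omega> j"
      with that True show "a = B.trunc (- int K) ?p \<omega>"
        by (auto simp: B.box_def B.trunc_def fun_eq_iff)
    next
      assume eq: "a = B.trunc (- int K) ?p \<omega>"
      show "\<forall>j\<le>?p. a j = \<omega> j"
        unfolding eq using True by (simp add: B.trunc_def)
    qed
    then have "(\<Sum>a\<in>?B. if \<forall>j\<le>?p. a j = \<omega> j then W.ghat a else 0) =
        (\<Sum>a\<in>?B. if a = B.trunc (- int K) ?p \<omega> then W.ghat a else 0)"
      by (intro sum.cong) auto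
    also have "\<dots> = W.ghat (B.trunc (- int K) ?p \<omega>)"
      using B.trunc_box[OF \<omega>] by (simp add: B.finite_box)
    also have "\<dots> = W.ghat \<omega>"
      using True by (intro W.ghat_cong) (auto simp: B.trunc_def)
    finally show ?thesis .
  next
    \<comment> \<open>No box element agrees with such an \<omega>, and \<open>ghat\<close> vanishes
      there as well.\<close>
    case False
    then obtain j where j: "j \<le> - int K" "\<omega> j \<noteq> 0"
      by blast
    have differ: "\<not> (\<forall>j\<le>?p. a j = \<omega> j)" if "a \<in> ?B" for a
    proof -
      have "a j = 0" "j \<le> ?p"
        using that j W.n2 by (auto simp: B.box_def)
      with j show ?thesis
        by force
    qed
    show ?thesis
      unfolding W.ghat_zero[OF \<omega> j] by (intro sum.neutral ballI if_not_P differ)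
  qed
  finally show ?thesis .
qed

lemma fourier_phi: "\<omega> \<in> B.V \<Longrightarrow> fourier M \<mu> phi \<omega> = W.ghat \<omega>"
  unfolding fourier_def by (rule has_bochner_integral_integral_eq[OF has_bochner_integral_phi_fourier])

text \<open>Integrability is read off from the transform at the trivial character.\<close>

lemma phi_L1: "phi \<in> L1 \<mu>"
proof -
  have "vchar M x (\<lambda>_. 0) = 1" for x
    using vchar_eq_prod[of "{}" x "\<lambda>_. 0"] by simp
  then show ?thesis
    using integrable.intros[OF has_bochner_integral_phi_fourier[OF B.zero_vil]] by (simp add: L1_def)
qed

text \<open>For large \<open>l\<close> the set \<open>A.U (- l)\<close> is invariant under translation by \<open>h\<close>, so that translating
  \<open>psi l\<close> only multiplies the coefficients by the values of a character.\<close>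

lemma phi_translate:
  assumes x: "x \<in> A.V" and h: "h \<in> A.U (- l)" and l: "int n - 1 \<le> l"
  shows "phi (vadd M s x h) = indicator (A.U (- l)) x * (of_real (of_nat A.m powi (- l)) *
    (\<Sum>a\<in>B.box (- int K) l. W.ghat a * (vchar M h a * vchar M x a)))"
proof -
  have hV: "h \<in> A.V"
    using h by (simp add: vU_def)
  have "phi (vadd M s x h) = psi l (vadd M s x h)"
    using psi_eq_phi[OF A.vadd_vil[OF x hV] l] by simp
  moreover have "vadd M s x h \<in> A.U (- l) \<longleftrightarrow> x \<in> A.U (- l)"
    using x h A.vadd_vil[OF x hV] by (auto simp: vU_def A.vadd_nth_zero)
  moreover have "vchar M (vadd M s x h) a = vchar M h a * vchar M x a" if "a \<in> B.box (- int K) l" for a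
    using vchar_add_left[OF x hV subsetD[OF B.box_subset that]] by simp
  ultimately show ?thesis
    by (simp add: psi_def indicator_def cong: sum.cong)
qed

text \<open>Elements of \<open>vH M s\<close> live on indices \<open>j \<le> 0\<close>, coupled with
  \<open>1 - j \<ge> 1\<close>, so their characters see only positive coordinates. On the support
  the weights are 1, and by \<open>bij_trunc_support\<close> these coordinates run once through a
  full box.\<close>

lemma sum_support_vchar:
  assumes h: "h \<in> vH M s" "h' \<in> vH M s" "h \<in> A.U (- l)" "h' \<in> A.U (- l)" and l: "int n - 1 \<le> l"
  shows "(\<Sum>a\<in>B.box (- int K) l. (norm (W.ghat a))\<^sup>2 * (vchar M h a * cnj (vchar M h' a))) =
    (if h = h' then of_real (of_nat A.m powi l) else 0)"
proof -
  let ?S = "{a \<in> B.box (- int K) l. W.ghat a \<noteq> 0}"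
  have H: "h j \<in> A.D" "h' j \<in> A.D" "0 < j \<Longrightarrow> h j = 0" "0 < j \<Longrightarrow> h' j = 0"
    "j \<le> - l \<Longrightarrow> h j = 0" "j \<le> - l \<Longrightarrow> h' j = 0" for j
    using h by (auto simp: vH_def vU_def A.vil_digit)
  have trunc: "vchar M g (B.trunc 0 l a) = vchar M g a"
    if "\<And>j. 0 < j \<Longrightarrow> g j = 0" "a \<in> ?S" for g a
  proof (rule vchar_cong)
    fix j
    show "g j = g j \<and> B.trunc 0 l a (1 - j) = a (1 - j) \<or>
        (g j = 0 \<or> B.trunc 0 l a (1 - j) = 0) \<and> (g j = 0 \<or> a (1 - j) = 0)"
      using that by (cases "0 < j") (auto simp: B.trunc_def B.box_def)
  qed
  have "(\<Sum>a\<in>B.box (- int K) l. (norm (W.ghat a))\<^sup>2 * (vchar M h a * cnj (vchar M h' a))) =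
      (\<Sum>a\<in>?S. (norm (W.ghat a))\<^sup>2 * (vchar M h a * cnj (vchar M h' a)))"
    by (rule sum.mono_neutral_right) (auto simp: B.finite_box)
  also have "\<dots> = (\<Sum>a\<in>?S. vchar M h (B.trunc 0 l a) * cnj (vchar M h' (B.trunc 0 l a)))"
  proof (intro sum.cong refl)
    fix a assume a: "a \<in> ?S"
    then have "norm (W.ghat a) = 1"
      using B.box_subset by (intro W.norm_ghat) auto
    then show "(norm (W.ghat a))\<^sup>2 * (vchar M h a * cnj (vchar M h' a)) =
        vchar M h (B.trunc 0 l a) * cnj (vchar M h' (B.trunc 0 l a))"
      using trunc[OF _ a] H by simp
  qed
  also have "\<dots> = (\<Sum>a\<in>B.box 0 l. vchar M h a * cnj (vchar M h' a))"
    by (rule sum.reindex_bij_betw[OF W.bij_trunc_support[OF l]])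
  also have "\<dots> = (if \<forall>j. 0 < j \<and> j \<le> l \<longrightarrow> h (1 - j) = h' (1 - j) then of_nat (mdet M) ^ nat (l - 0) else 0)"
    using l W.n2 by (intro sum_box_vchar H) auto
  also have "(\<forall>j. 0 < j \<and> j \<le> l \<longrightarrow> h (1 - j) = h' (1 - j)) \<longleftrightarrow> h = h'"
  proof
    assume *: "\<forall>j. 0 < j \<and> j \<le> l \<longrightarrow> h (1 - j) = h' (1 - j)"
    have "h j = h' j" for j
      using *[rule_format, of "1 - j"] H by (cases "0 < j"; cases "j \<le> - l") auto
    then show "h = h'"
      by blast
  qed simp
  also have "of_nat (mdet M) ^ nat (l - 0) = complex_of_real (of_nat A.m powi l)"
    using l W.n2 by (simp add: power_int_def)
  finally show ?thesis .
qed

text \<open>Both translates are expanded at one level \<open>l\<close> whose subgroup contains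
  \<open>h\<close> and \<open>h'\<close>; orthogonality reduces the double sum to its
  diagonal.\<close>

lemma has_bochner_integral_phi_phi:
  assumes h: "h \<in> vH M s" "h' \<in> vH M s"
  shows "has_bochner_integral \<mu> (\<lambda>x. phi (vadd M s x h) * cnj (phi (vadd M s x h'))) (if h = h' then 1 else 0)"
proof -
  have "h \<in> A.V" "h' \<in> A.V"
    using h by (auto simp: vH_def)
  then obtain L L' where L: "\<And>j. j \<le> L \<Longrightarrow> h j = 0" "\<And>j. j \<le> L' \<Longrightarrow> h' j = 0"
    unfolding A.vil_iff by blast
  define l where "l = max (int n - 1) (max (- L) (- L'))"
  have hU: "h \<in> A.U (- l)" "h' \<in> A.U (- l)"
    using L \<open>h \<in> A.V\<close> \<open>h' \<in> A.V\<close> by (auto simp: vU_def l_def)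
  have l: "int n - 1 \<le> l"
    by (simp add: l_def)
  let ?B = "B.box (- int K) l"
  define c where "c = complex_of_real (of_nat A.m powi (- l))"
  have c: "c * of_real (of_nat A.m powi l) = 1" "cnj c = c"
    unfolding c_def by (rule A.powi_m_inverse) simp
  define f where "f a = c * W.ghat a * vchar M h a" for a
  define f' where "f' a = c * W.ghat a * vchar M h' a" for a
  have "has_bochner_integral \<mu>
      (\<lambda>x. \<Sum>a\<in>?B. \<Sum>a'\<in>?B. (f a * cnj (f' a')) * (indicator (A.U (- l)) x * (vchar M x a * cnj (vchar M x a'))))
      (\<Sum>a\<in>?B. \<Sum>a'\<in>?B. (f a * cnj (f' a')) *
        (if \<forall>j\<le>- (- l). a j = a' j then of_real (of_nat A.m powi (- (- l))) else 0))"
    by (intro has_bochner_integral_sum has_bochner_integral_mult_right has_bochner_integral_vchar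
        subsetD[OF B.box_subset])
  also have "(\<Sum>a\<in>?B. \<Sum>a'\<in>?B. (f a * cnj (f' a')) *
        (if \<forall>j\<le>- (- l). a j = a' j then of_real (of_nat A.m powi (- (- l))) else 0)) =
      (\<Sum>a\<in>?B. \<Sum>a'\<in>?B. if a = a' then f a * cnj (f' a) * of_real (of_nat A.m powi l) else 0)"
  proof (intro sum.cong refl)
    fix a a' assume "a \<in> ?B" "a' \<in> ?B"
    then have "(\<forall>j\<le>- (- l). a j = a' j) \<longleftrightarrow> a = a'"
      by (auto simp: B.box_def fun_eq_iff) (metis linorder_not_le)
    then show "(f a * cnj (f' a')) * (if \<forall>j\<le>- (- l). a j = a' j then of_real (of_nat A.m powi (- (- l))) else 0) =
        (if a = a' then f a * cnj (f' a) * of_real (of_nat A.m powi l) else 0)"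
      by simp
  qed
  also have "\<dots> = (\<Sum>a\<in>?B. f a * cnj (f' a) * of_real (of_nat A.m powi l))"
    by (simp add: B.finite_box)
  also have "\<dots> = c * (\<Sum>a\<in>?B. (norm (W.ghat a))\<^sup>2 * (vchar M h a * cnj (vchar M h' a)))"
    unfolding sum_distrib_left
  proof (intro sum.cong refl)
    fix a
    have "f a * cnj (f' a) * of_real (of_nat A.m powi l) =
        (c * of_real (of_nat A.m powi l)) * (c * ((W.ghat a * cnj (W.ghat a)) * (vchar M h a * cnj (vchar M h' a))))"
      by (simp add: f_def f'_def c(2) mult_ac)
    then show "f a * cnj (f' a) * of_real (of_nat A.m powi l) =
        c * ((norm (W.ghat a))\<^sup>2 * (vchar M h a * cnj (vchar M h' a)))"
      unfolding c(1) complex_norm_square by simp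
  qed
  also have "\<dots> = (if h = h' then 1 else 0)"
    unfolding sum_support_vchar[OF h hU l] using c by simp
  finally have int: "has_bochner_integral \<mu>
      (\<lambda>x. \<Sum>a\<in>?B. \<Sum>a'\<in>?B. (f a * cnj (f' a')) * (indicator (A.U (- l)) x * (vchar M x a * cnj (vchar M x a'))))
      (if h = h' then 1 else 0)" .
  have "phi (vadd M s x h) * cnj (phi (vadd M s x h')) =
      (\<Sum>a\<in>?B. \<Sum>a'\<in>?B. (f a * cnj (f' a')) * (indicator (A.U (- l)) x * (vchar M x a * cnj (vchar M x a'))))"
    if x: "x \<in> A.V" for x
  proof (cases "x \<in> A.U (- l)")
    case True
    have "phi (vadd M s x h) = (\<Sum>a\<in>?B. f a * vchar M x a)" "phi (vadd M s x h') = (\<Sum>a\<in>?B. f' a * vchar M x a)"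
      using True by (simp_all add: phi_translate[OF x _ l] hU f_def f'_def c_def sum_distrib_left mult_ac)
    then show ?thesis
      using True by (simp add: sum_product mult_ac)
  next
    case False
    then show ?thesis
      by (simp add: phi_translate[OF x _ l] hU)
  qed
  then show ?thesis
    using int by (subst has_bochner_integral_cong[OF refl _ refl]) (auto simp: A.space_haar)
qed

text \<open>The orthonormality relation with both translations trivial.\<close>

lemma phi_L2: "phi \<in> L2 \<mu>"
proof -
  have zero: "(\<lambda>_. 0) \<in> vH M s"
    using A.zero_vil by (simp add: vH_def)
  have "integrable \<mu> (\<lambda>x. phi (vadd M s x (\<lambda>_. 0)) * cnj (phi (vadd M s x (\<lambda>_. 0))))"
    by (rule integrable.intros[OF has_bochner_integral_phi_phi[OF zero zero]])
  then have "integrable \<mu> (\<lambda>x. Re (phi (vadd M s x (\<lambda>_. 0)) * cnj (phi (vadd M s x (\<lambda>_. 0)))))"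
    by (rule integrable_Re)
  moreover have "Re (phi (vadd M s x (\<lambda>_. 0)) * cnj (phi (vadd M s x (\<lambda>_. 0)))) = (norm (phi x))\<^sup>2"
    if "x \<in> space \<mu>" for x
    using that by (simp add: A.space_haar A.vadd_zero_right complex_norm_square[symmetric] del: of_real_power)
  ultimately have "integrable \<mu> (\<lambda>x. (norm (phi x))\<^sup>2)"
    by (subst Bochner_Integration.integrable_cong[OF refl, symmetric]) auto
  then show ?thesis
    using phi_L1 by (auto simp: L1_def L2_def)
qed

text \<open>The frequencies in the sum vanish up to index \<open>- int K\<close>, so their
  characters are constant on cylinders of level \<open>K\<close>; the indicator confines the support
  to a closed subgroup.\<close>

lemma phi_vS: "phi \<in> vS M s (int K) (int (n - 1))"
  unfolding vS_def
proof (intro CollectI conjI allI)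
  fix i
  let ?g = "vshift (- int K) (vgamma M s i)"
  have g: "?g \<in> A.V"
    by (intro A.vshift_vil A.vgamma_vil)
  have "phi y = phi ?g" if y: "y \<in> A.cyl (int K) ?g" for y
  proof -
    have "vchar M y a = vchar M ?g a" if "a \<in> B.box (- int K) (int n - 1)" for a
      using that y by (intro vchar_const_cyl[where l = "int K"]) (auto simp: B.box_def)
    moreover have "y \<in> A.U (- (int n - 1)) \<longleftrightarrow> ?g \<in> A.U (- (int n - 1))"
      using y g W.n2 by (auto simp: A.cyl_def vU_def)
    ultimately show ?thesis
      by (simp add: psi_def indicator_def cong: sum.cong)
  qed
  then show "phi constant_on vUnk M s (int K) i"
    unfolding A.vUnk_eq constant_on_def by blast
next
  have p: "0 - int (n - 1) = - (int n - 1)"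
    using W.n2 by auto
  show "vtop M s closure_of {x \<in> A.V. phi x \<noteq> 0} \<subseteq> vshift (int (n - 1)) ` A.U 0"
    unfolding A.vshift_U p
    by (intro closure_of_minimal A.closedin_U) (auto simp: psi_def indicator_def split: if_splits)
qed

section \<open>The refinement equation\<close>

lemma bij_shift_box: "bij_betw (vshift 1) (B.box q (l + 1)) (B.box (q - 1) l)"
proof (rule bij_betw_byWitness[where f' = "vshift (- 1)"])
qed (auto simp: vshift_def B.box_def)

text \<open>With the translates expanded at level n, the sum over \<open>k\<close> reassembles the
  mask value, which \<open>ghat_shift\<close> merges with \<open>ghat\<close>. The factor m in the
  coefficients turns the volume factor of level n into that of level n - 1.\<close>

lemma phi_refinement:
  assumes mask: "\<And>a. a \<in> B.V \<Longrightarrow> b (seg a 1 n) = (\<Sum>k<A.m ^ n. c k * vchar M (vgamma M s k) a)"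
    and x: "x \<in> A.V"
  shows "phi x = (\<Sum>k<A.m ^ n. (of_nat A.m * c k) * phi (vadd M s (vshift 1 x) (vgamma M s k)))"
proof -
  let ?B = "B.box (- int K) (int n)"
  define S where "S = (\<Sum>a\<in>?B. W.ghat (vshift 1 a) * vchar M x (vshift 1 a))"
  define e where "e = complex_of_real (of_nat A.m powi (- int n))"
  have "of_nat A.m powi (- int n) * of_nat A.m = (of_nat A.m :: real) powi (- (int n - 1))"
    using A.m_pos by (simp add: power_int_diff power_int_minus field_simps power_int_add)
  then have e: "e * of_nat A.m = of_real (of_nat A.m powi (- (int n - 1)))"
    unfolding e_def by (metis of_real_mult of_real_of_nat_eq)
  have U: "vshift 1 x \<in> A.U (- int n) \<longleftrightarrow> x \<in> A.U (- (int n - 1))"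
  proof -
    have "(\<forall>j\<le>- int n. x (j + 1) = 0) \<longleftrightarrow> (\<forall>j\<le>1 - int n. x j = 0)"
    proof (intro iffI allI impI)
      fix j assume "\<forall>j\<le>- int n. x (j + 1) = 0" "j \<le> 1 - int n"
      then show "x j = 0"
        by (auto dest: spec[of _ "j - 1"])
    qed auto
    then show ?thesis
      using x A.vshift_vil[OF x] by (simp add: vU_def vshift_def)
  qed
  have translate: "phi (vadd M s (vshift 1 x) (vgamma M s k)) = indicator (A.U (- (int n - 1))) x *
      (e * (\<Sum>a\<in>?B. W.ghat a * (vchar M (vgamma M s k) a * vchar M x (vshift 1 a))))"
    if "k < A.m ^ n" for k
  proof -
    have "vgamma M s k \<in> A.U (- int n)"
      using that A.vgamma_vil by (auto simp: vU_def A.vgamma_small)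
    then show ?thesis
      using phi_translate[OF A.vshift_vil[OF x], of "vgamma M s k" "int n" 1] U
      by (simp add: e_def indicator_def vchar_shift)
  qed
  have "(\<Sum>k<A.m ^ n. (of_nat A.m * c k) * phi (vadd M s (vshift 1 x) (vgamma M s k))) =
      (\<Sum>k<A.m ^ n. \<Sum>a\<in>?B. indicator (A.U (- (int n - 1))) x * (e * of_nat A.m) *
        (W.ghat a * vchar M x (vshift 1 a) * (c k * vchar M (vgamma M s k) a)))"
    by (intro sum.cong refl) (simp add: translate sum_distrib_left mult_ac)
  also have "\<dots> = (\<Sum>a\<in>?B. indicator (A.U (- (int n - 1))) x * (e * of_nat A.m) *
        (W.ghat a * vchar M x (vshift 1 a) * (\<Sum>k<A.m ^ n. c k * vchar M (vgamma M s k) a)))"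
    by (subst sum.swap) (simp add: sum_distrib_left)
  also have "\<dots> = (\<Sum>a\<in>?B. indicator (A.U (- (int n - 1))) x * (e * of_nat A.m) *
        (W.ghat (vshift 1 a) * vchar M x (vshift 1 a)))"
  proof (intro sum.cong refl)
    fix a assume "a \<in> ?B"
    then have a: "a \<in> B.V"
      using B.box_subset by blast
    show "indicator (A.U (- (int n - 1))) x * (e * of_nat A.m) *
        (W.ghat a * vchar M x (vshift 1 a) * (\<Sum>k<A.m ^ n. c k * vchar M (vgamma M s k) a)) =
        indicator (A.U (- (int n - 1))) x * (e * of_nat A.m) * (W.ghat (vshift 1 a) * vchar M x (vshift 1 a))"
      unfolding mask[OF a, symmetric] W.ghat_shift[OF a] by simp
  qed
  also have "\<dots> = indicator (A.U (- (int n - 1))) x * (e * of_nat A.m) * S"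
    by (simp add: S_def sum_distrib_left)
  \<comment> \<open>The shift lowers both ends of the box by one; on elements with a nonzero
    coordinate at the new bottom index \<open>- int K\<close>, \<open>ghat\<close> is 0.\<close>
  also have "S = (\<Sum>a\<in>B.box (- int K - 1) (int n - 1). W.ghat a * vchar M x a)"
    unfolding S_def using sum.reindex_bij_betw[OF bij_shift_box[of "- int K" "int n - 1"]] by simp
  also have "\<dots> = (\<Sum>a\<in>B.box (- int K) (int n - 1). W.ghat a * vchar M x a)"
  proof (rule sum.mono_neutral_right)
    show "\<forall>a\<in>B.box (- int K - 1) (int n - 1) - B.box (- int K) (int n - 1). W.ghat a * vchar M x a = 0"
    proof
      fix a assume a: "a \<in> B.box (- int K - 1) (int n - 1) - B.box (- int K) (int n - 1)"
      then obtain j where "j \<le> - int K" "a j \<noteq> 0"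
        by (auto simp: B.box_def)
      then show "W.ghat a * vchar M x a = 0"
        using a B.box_subset W.ghat_zero[of a j] by auto
    qed
    show "B.box (- int K) (int n - 1) \<subseteq> B.box (- int K - 1) (int n - 1)"
      by (auto simp: B.box_def)
  qed (rule B.finite_box)
  finally show ?thesis
    by (simp add: psi_def e)
qed

lemma phi_refinable:
  assumes mask: "\<And>a. a \<in> B.V \<Longrightarrow> b (seg a 1 n) = (\<Sum>k<A.m ^ n. c k * vchar M (vgamma M s k) a)"
  shows "refinable M s \<mu> phi"
  unfolding refinable_def
proof (intro conjI phi_L2 exI ballI)
  fix x assume x: "x \<in> A.V"
  let ?\<alpha> = "\<lambda>k. if k < A.m ^ n then of_nat A.m * c k else 0"
  have "(\<lambda>k. ?\<alpha> k * phi (vadd M s (vshift 1 x) (vgamma M s k))) sums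
      (\<Sum>k<A.m ^ n. ?\<alpha> k * phi (vadd M s (vshift 1 x) (vgamma M s k)))"
    by (rule sums_finite) auto
  also have "(\<Sum>k<A.m ^ n. ?\<alpha> k * phi (vadd M s (vshift 1 x) (vgamma M s k))) = phi x"
  proof -
    have "phi x = (\<Sum>k<A.m ^ n. (of_nat A.m * c k) * phi (vadd M s (vshift 1 x) (vgamma M s k)))"
      by (rule phi_refinement[OF mask x])
    also have "\<dots> = (\<Sum>k<A.m ^ n. ?\<alpha> k * phi (vadd M s (vshift 1 x) (vgamma M s k)))"
      by (intro sum.cong) auto
    finally show ?thesis ..
  qed
  finally show "(\<lambda>k. ?\<alpha> k * phi (vadd M s (vshift 1 x) (vgamma M s k))) sums phi x" .
qed

lemma phi_orthogonal:
  assumes mask: "\<And>a. a \<in> B.V \<Longrightarrow> b (seg a 1 n) = (\<Sum>k<A.m ^ n. c k * vchar M (vgamma M s k) a)"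
  shows "orthogonal_refinable M s \<mu> phi"
  unfolding orthogonal_refinable_def
proof (intro conjI ballI)
  show "refinable M s \<mu> phi"
    by (rule phi_refinable[OF mask])
qed (rule has_bochner_integral_integral_eq[OF has_bochner_integral_phi_phi])

text \<open>For \<open>k < A.m ^ n\<close> the element \<open>vgamma M s k\<close> lives on the
  indices from \<open>1 - int n\<close> to 0, so its character sees only the coordinates 1 to
  n.\<close>

lemma mask_values:
  assumes m0: "\<And>\<omega>. \<omega> \<in> B.V \<Longrightarrow> m0 \<omega> = (\<Sum>k<A.m ^ n. c k * vchar M (vgamma M s k) \<omega>)"
    and w: "\<And>w. length w = n \<Longrightarrow> set w \<subseteq> B.D \<Longrightarrow> m0 (velem 0 (0 # w)) = b w" and a: "a \<in> B.V"
  shows "b (seg a 1 n) = (\<Sum>k<A.m ^ n. c k * vchar M (vgamma M s k) a)"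
proof -
  let ?e = "velem 0 (0 # seg a 1 n)"
  have seg: "set (seg a 1 n) \<subseteq> B.D"
    using a by (intro set_seg_subset B.vil_digit)
  then have e: "?e \<in> B.V"
    using B.zero_digit by (intro W.velem_vil) auto
  have e_nth: "?e j = a j" if "1 \<le> j" "j \<le> int n" for j
    using that by (auto simp: velem_def seg_def nth_Cons' nat_diff_distrib)
  have "b (seg a 1 n) = m0 ?e"
    using w[of "seg a 1 n"] seg by simp
  also have "\<dots> = (\<Sum>k<A.m ^ n. c k * vchar M (vgamma M s k) ?e)"
    using e by (rule m0)
  also have "\<dots> = (\<Sum>k<A.m ^ n. c k * vchar M (vgamma M s k) a)"
  proof (intro sum.cong refl arg_cong2[of _ _ _ _ "(*)"] vchar_cong)
    fix k j assume "k \<in> {..<A.m ^ n}"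
    then have "vgamma M s k j = 0" if "j \<le> - int n \<or> 0 < j"
      using that A.vgamma_small[of k n j] by (auto simp: vgamma_def)
    then show "vgamma M s k j = vgamma M s k j \<and> ?e (1 - j) = a (1 - j) \<or>
        (vgamma M s k j = 0 \<or> ?e (1 - j) = 0) \<and> (vgamma M s k j = 0 \<or> a (1 - j) = 0)"
      using e_nth[of "1 - j"] by (cases "j \<le> - int n \<or> 0 < j") auto
  qed
  finally show ?thesis .
qed

end

theorem theorem7:
  fixes M :: "int ^ 'd ^ 'd::finite"
    and s s' :: "nat \<Rightarrow> int ^ 'd"
    and \<mu> \<mu>' :: "'d vseq measure"
    and n r :: nat
    and \<xi> :: "int \<Rightarrow> int ^ 'd"
    and b :: "(int ^ 'd) list \<Rightarrow> complex"
    and \<phi> :: "'d vseq \<Rightarrow> complex"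
  assumes "dilation_matrix M"
    and "digit_enum M s"
    and "digit_enum (transpose M) s'"
    and "normalized_haar M s \<mu>"
    and "normalized_haar (transpose M) s' \<mu>'"
    and "2 \<le> n" and "n \<le> r"
    and "\<forall>k\<in>{0..int r}. \<xi> k \<in> digits (transpose M) s' - {0}"
    and "\<forall>l\<le>-1. \<xi> l = 0"
    and "\<forall>k\<in>{0..r - n + 2}. \<forall>k'\<in>{0..r - n + 2}. k \<noteq> k' \<longrightarrow>
           seg \<xi> (int k) (n - 1) \<noteq> seg \<xi> (int k') (n - 1)"
    and "associated_function M s s' \<mu> \<mu>' n r \<xi> b \<phi>"
  shows "\<exists>\<phi>'. (AE x in \<mu>. \<phi> x = \<phi>' x) \<and>
    orthogonal_refinable M s \<mu> \<phi>' \<and>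
    \<phi>' \<in> vS M s (int (r - n + 2)) (int (n - 1)) \<and>
    \<phi>' \<in> L1 \<mu> \<and>
    (\<forall>\<omega>\<in>vil (transpose M) s'.
       fourier M \<mu> \<phi>' \<omega> =
         (\<Sum>k=1..r - n + 2.
            indicator (vadd_set (transpose M) s' {velem (1 - int k) (seg \<xi> 0 (k + n - 1))}
                         (vU (transpose M) s' (int (n - 1)))) \<omega> *
            (\<Prod>j=1..k + n - 1. b (seg \<xi> (int k - int j) n))) +
         indicator (vadd_set (transpose M) s' (Qset (digits (transpose M) s') n r \<xi>)
                      (vU (transpose M) s' (int (n - 1)))) \<omega> *
         (\<Prod>j=1..n - 1. b (replicate j 0 @ seg \<omega> 1 (n - j))))"
proof -
  \<comment> \<open>The existence of a digit makes their number positive, and hence the determinant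
    nonzero.\<close>
  have "\<xi> 0 \<in> digits (transpose M) s'"
    using assms(8) by auto
  then have "0 < mdet (transpose M)"
    by (auto simp: digits_def)
  then have det: "det M \<noteq> 0"
    by (auto simp: mdet_def)
  have vals: "associated_values (digits (transpose M) s') n r \<xi> b"
    using assms(11) by (simp add: associated_function_def)
  interpret word_function M "transpose M" s s' \<mu> \<mu>' n r \<xi> b
    by unfold_locales (use assms det vals in simp_all)
  obtain m0 where walsh: "walsh_polynomial M s s' n m0"
    and m0: "\<And>w. length w = n \<Longrightarrow> set w \<subseteq> B.D \<Longrightarrow> m0 (velem 0 (0 # w)) = b w"
    and F: "fourier_L2 M \<mu> \<mu>' \<phi> (\<lambda>\<omega>. \<Prod>j. m0 (vshift (- int (Suc j)) \<omega>))"
    using assms(11) unfolding associated_function_def by blast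
  obtain c where c: "\<And>\<omega>. \<omega> \<in> B.V \<Longrightarrow> m0 \<omega> = (\<Sum>k<A.m ^ n. c k * vchar M (vgamma M s k) \<omega>)"
    using walsh unfolding walsh_polynomial_def by blast
  have mask: "b (seg a 1 n) = (\<Sum>k<A.m ^ n. c k * vchar M (vgamma M s k) a)" if "a \<in> B.V" for a
    by (rule mask_values[OF c m0 that])
  have ghat: "W.ghat \<omega> = (\<Prod>j. m0 (vshift (- int (Suc j)) \<omega>))" if "\<omega> \<in> B.V" for \<omega>
  proof -
    have "m0 (vshift (- int (Suc j)) \<omega>) = b (seg \<omega> (- int j) n)" for j
    proof -
      have v: "vshift (- int (Suc j)) \<omega> \<in> B.V"
        using that by (rule B.vshift_vil)
      have "m0 (vshift (- int (Suc j)) \<omega>) = b (seg (vshift (- int (Suc j)) \<omega>) 1 n)"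
        unfolding c[OF v] mask[OF v] ..
      also have "seg (vshift (- int (Suc j)) \<omega>) 1 n = seg \<omega> (- int j) n"
        by (simp add: seg_eq_iff vshift_def algebra_simps)
      finally show ?thesis .
    qed
    then show ?thesis
      by (simp add: W.ghat_def)
  qed
  have "AE x in \<mu>. \<phi> x = phi x"
    using fourier_L2_unique[OF F phi_L1 phi_L2] by (simp add: fourier_phi ghat)
  moreover have "orthogonal_refinable M s \<mu> phi"
    by (rule phi_orthogonal[OF mask])
  moreover have "fourier M \<mu> phi \<omega> =
         (\<Sum>k=1..r - n + 2.
            indicator (vadd_set (transpose M) s' {velem (1 - int k) (seg \<xi> 0 (k + n - 1))}
                         (vU (transpose M) s' (int (n - 1)))) \<omega> *
            (\<Prod>j=1..k + n - 1. b (seg \<xi> (int k - int j) n))) +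
         indicator (vadd_set (transpose M) s' (Qset (digits (transpose M) s') n r \<xi>)
                      (vU (transpose M) s' (int (n - 1)))) \<omega> *
         (\<Prod>j=1..n - 1. b (replicate j 0 @ seg \<omega> 1 (n - j)))" if \<omega>: "\<omega> \<in> B.V" for \<omega>
    unfolding fourier_phi[OF \<omega>] W.ghat_formula[OF \<omega>] indicator_def W.mem_Q_coset[OF \<omega>]
    by (intro arg_cong2[of _ _ _ _ "(+)"] sum.cong refl) (simp only: W.mem_word_coset[OF \<omega>])
  ultimately show ?thesis
    using phi_vS phi_L1 by blast
qed

end
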